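(* Let $M$ be a complete metric space (not necessarily locally compact). Let $\mathcal{C}_\natural(M)$ be the algebra of all continuous functions $f:M\to\mathbb{C}$ with pointwise operations and the topology of uniform convergence on compact subsets of $M$, and let $\mathcal{C}(M):=\mathcal{C}_\natural(M)^{\vartriangle}$ be its pseudosaturation. Then $\mathcal{C}(M)$ has the stereotype approximation property; that is, the identity operator $I:\mathcal{C}(M)\to\mathcal{C}(M)$ belongs to the closure, in the space $\mathcal{L}(\mathcal{C}(M))=(\mathcal{C}(M):\mathcal{C}(M))^{\vartriangle}$, of the set of continuous linear operators $\mathcal{C}(M)\to\mathcal{C}(M)$ of finite rank.
   Context: All vector spaces are over $\mathbb{C}$ and all locally convex spaces are Hausdorff. **The space $\mathcal{C}_\natural(M)$.** Its topology is generated by the seminorms $\|f\|_T=\max_{t\in T}|f(t)|$, where $T$ runs over all compact subsets of $M$. **Capacious sets and pseudosaturated spaces.** Let $X$ be a locally convex space. A set $D\subseteq X$ is called capacious if for every totally bounded set $A\subseteq X$ there is a finite set $F\subseteq X$ with $A\subseteq D+F$. The space $X$ is called pseudosaturated if every closed convex balanced capacious set in $X$ is a neighbourhood of zero. **Pseudosaturation.** The pseudosaturation $X^{\vartriangle}$ of a locally convex space $X$ is the vector space $X$ endowed with the coarsest pseudosaturated locally convex topology that is finer than or equal to the original topology of $X$. Equivalently, the topology of $X^{\vartriangle}$ is obtained by transfinite iteration: at each successor step one takes all closed convex balanced capacious sets of the current topology as a base of neighbourhoods of zero, at limit steps one takes the supremum of the previous topologies, and one stops when the topology stabilizes. Known facts: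 every continuous linear map $X\to Y$ is also continuous as a map $X^{\vartriangle}\to Y^{\vartriangle}$; $X$ and $X^{\vartriangle}$ have the same totally bounded sets and induce the same topology on each of them. **Stereotype spaces.** For a locally convex space $X$, let $X^\star$ be the space of continuous linear functionals on $X$ with the topology of uniform convergence on totally bounded subsets of $X$. $X$ is a stereotype space if the natural map $X\to (X^\star)^\star$ is an isomorphism of locally convex spaces; equivalently, if $X$ is pseudosaturated and pseudocomplete (every totally bounded Cauchy net in $X$ converges). The space $\mathcal{C}(M)=\mathcal{C}_\natural(M)^{\vartriangle}$ is a stereotype space (and, with pointwise multiplication, a stereotype algebra). **Operator spaces.** For locally convex spaces $X,Y$, $Y:X$ denotes the space of all continuous linear maps $\varphi:X\to Y$ with the topology of uniform convergence on compact subsets of $X$ (equivalently, when $X$ is stereotype, on totally bounded subsets of $X$). For a stereotype space $X$ one puts $\mathcal{L}(X):=(X:X)^{\vartriangle}$, the pseudosaturation of $X:X$. **Stereotype approximation property.** A stereotype space $X$ has the stereotype approximation property if the identity operator of $X$ can be approximated in $\mathcal{L}(X)$ by finite-dimensional operators, i.e. lies in the closure in $\mathcal{L}(X)$ of the set of finite-rank continuous linear operators $X\to X$. *)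

theory Defs
  imports "HOL-Analysis.Analysis" "HOL-Library.Function_Algebras"
begin

class complex_vector = real_vector +
  fixes scaleC :: "complex \<Rightarrow> 'a \<Rightarrow> 'a"  (infixr "*\<^sub>C" 75)
  assumes scaleC_add_right: "c *\<^sub>C (x + y) = c *\<^sub>C x + c *\<^sub>C y"
    and scaleC_add_left: "(c + d) *\<^sub>C x = c *\<^sub>C x + d *\<^sub>C x"
    and scaleC_scaleC: "c *\<^sub>C d *\<^sub>C x = (c * d) *\<^sub>C x"
    and scaleC_one: "1 *\<^sub>C x = x"
    and scaleR_scaleC: "r *\<^sub>R x = complex_of_real r *\<^sub>C x"

global_interpretation complex_vector: vector_space "scaleC :: complex \<Rightarrow> 'a \<Rightarrow> 'a::complex_vector"
  by standard (simp_all add: scaleC_add_right scaleC_add_left scaleC_scaleC scaleC_one)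

instantiation complex :: complex_vector
begin

definition scaleC_complex :: "complex \<Rightarrow> complex \<Rightarrow> complex"
  where "scaleC_complex = (*)"

instance
  by standard (simp_all add: scaleC_complex_def algebra_simps scaleR_conv_of_real)

end

instantiation "fun" :: (type, real_vector) real_vector
begin

definition scaleR_fun :: "real \<Rightarrow> ('a \<Rightarrow> 'b) \<Rightarrow> 'a \<Rightarrow> 'b"
  where "scaleR_fun r f = (\<lambda>x. r *\<^sub>R f x)"

instance
  by standard (simp_all add: scaleR_fun_def fun_eq_iff scaleR_add_right scaleR_add_left)

end

instantiation "fun" :: (type, complex_vector) complex_vector
begin

definition scaleC_fun :: "complex \<Rightarrow> ('a \<Rightarrow> 'b) \<Rightarrow> 'a \<Rightarrow> 'b"
  where "scaleC_fun c f = (\<lambda>x. c *\<^sub>C f x)"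

instance
  by standard (simp_all add: scaleC_fun_def scaleR_fun_def fun_eq_iff scaleC_add_right
      scaleC_add_left scaleC_scaleC scaleC_one scaleR_scaleC)

end

definition balanced :: "'v::complex_vector set \<Rightarrow> bool" where
  "balanced S \<longleftrightarrow> (\<forall>x\<in>S. \<forall>c. norm c \<le> 1 \<longrightarrow> c *\<^sub>C x \<in> S)"

text \<open>
  A locally convex space is represented by its topology \<open>X\<close> alone: the underlying set is
  \<open>topspace X\<close>, a complex subspace of the ambient type, from which the algebraic operations
  are inherited.
\<close>

definition zero_nhd :: "'v::complex_vector topology \<Rightarrow> 'v set \<Rightarrow> bool" where
  "zero_nhd X U \<longleftrightarrow> U \<subseteq> topspace X \<and> (\<exists>W. openin X W \<and> 0 \<in> W \<and> W \<subseteq> U)"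

definition locally_convex_space :: "'v::complex_vector topology \<Rightarrow> bool" where
  "locally_convex_space X \<longleftrightarrow>
     complex_vector.subspace (topspace X) \<and>
     Hausdorff_space X \<and>
     continuous_map (prod_topology X X) X (\<lambda>(x, y). x + y) \<and>
     continuous_map (prod_topology euclidean X) X (\<lambda>(c, x). c *\<^sub>C x) \<and>
     (\<forall>U. zero_nhd X U \<longrightarrow> (\<exists>V. zero_nhd X V \<and> convex V \<and> V \<subseteq> U))"

definition finer_topology :: "'a topology \<Rightarrow> 'a topology \<Rightarrow> bool" where
  "finer_topology X Y \<longleftrightarrow> topspace X = topspace Y \<and> (\<forall>U. openin Y U \<longrightarrow> openin X U)"

definition totally_bounded_in :: "'v::complex_vector topology \<Rightarrow> 'v set \<Rightarrow> bool" where
  "totally_bounded_in X A \<longleftrightarrow> A \<subseteq> topspace X \<and>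
     (\<forall>U. zero_nhd X U \<longrightarrow>
        (\<exists>F. finite F \<and> F \<subseteq> topspace X \<and> A \<subseteq> {u + f |u f. u \<in> U \<and> f \<in> F}))"

definition capacious :: "'v::complex_vector topology \<Rightarrow> 'v set \<Rightarrow> bool" where
  "capacious X D \<longleftrightarrow> D \<subseteq> topspace X \<and>
     (\<forall>A. totally_bounded_in X A \<longrightarrow>
        (\<exists>F. finite F \<and> F \<subseteq> topspace X \<and> A \<subseteq> {d + f |d f. d \<in> D \<and> f \<in> F}))"

definition pseudosaturated :: "'v::complex_vector topology \<Rightarrow> bool" where
  "pseudosaturated X \<longleftrightarrow> locally_convex_space X \<and>
     (\<forall>D. closedin X D \<and> convex D \<and> balanced D \<and> capacious X D \<longrightarrow> zero_nhd X D)"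

text \<open>
  For a locally convex \<open>X\<close> the description below is proper.  Infima of pseudosaturated locally
  convex topologies finer than \<open>X\<close> are again of this kind, and the finest locally convex
  topology is one of them.
\<close>

definition pseudosaturation :: "'v::complex_vector topology \<Rightarrow> 'v topology" where
  "pseudosaturation X = (THE Y. pseudosaturated Y \<and> finer_topology Y X \<and>
     (\<forall>Z. pseudosaturated Z \<and> finer_topology Z X \<longrightarrow> finer_topology Z Y))"

definition seminorm_topology :: "'v::complex_vector set \<Rightarrow> ('v \<Rightarrow> real) set \<Rightarrow> 'v topology" where
  "seminorm_topology V P =
     topology_generated_by {{g \<in> V. p (g - f) < e} |f p e. f \<in> V \<and> p \<in> P \<and> 0 < e}"

text \<open>
  On continuous functions and nonempty compact \<open>K\<close> the supremum below is a maximum.  The empty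
  set is left out because the supremum of the empty set of reals is unspecified.
\<close>

definition C_natural :: "('m::metric_space \<Rightarrow> complex) topology" where
  "C_natural = seminorm_topology {f. continuous_on UNIV f}
     {(\<lambda>f. SUP t\<in>K. norm (f t)) |K. compact K \<and> K \<noteq> {}}"

definition C_space :: "('m::metric_space \<Rightarrow> complex) topology" where
  "C_space = pseudosaturation C_natural"

definition linear_on :: "'v::complex_vector set \<Rightarrow> ('v \<Rightarrow> 'w::complex_vector) \<Rightarrow> bool" where
  "linear_on V \<phi> \<longleftrightarrow> (\<forall>x\<in>V. \<forall>y\<in>V. \<phi> (x + y) = \<phi> x + \<phi> y) \<and>
     (\<forall>c. \<forall>x\<in>V. \<phi> (c *\<^sub>C x) = c *\<^sub>C \<phi> x)"

text \<open>
  A map defined on \<open>topspace X\<close> is encoded by its extension by zero to the ambient type, so that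
  operators with the same values on \<open>X\<close> are equal and the operators form a complex subspace of
  the function type.
\<close>

definition continuous_operators ::
  "'v::complex_vector topology \<Rightarrow> 'w::complex_vector topology \<Rightarrow> ('v \<Rightarrow> 'w) set" where
  "continuous_operators X Y =
     {\<phi>. linear_on (topspace X) \<phi> \<and> continuous_map X Y \<phi> \<and> (\<forall>x. x \<notin> topspace X \<longrightarrow> \<phi> x = 0)}"

definition operator_nhd ::
  "'v::complex_vector topology \<Rightarrow> 'w::complex_vector topology \<Rightarrow> ('v \<Rightarrow> 'w) \<Rightarrow> 'v set \<Rightarrow> 'w set
     \<Rightarrow> ('v \<Rightarrow> 'w) set" where
  "operator_nhd X Y \<phi> K U = {\<psi> \<in> continuous_operators X Y. \<forall>x\<in>K. \<psi> x - \<phi> x \<in> U}"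

definition operator_open ::
  "'v::complex_vector topology \<Rightarrow> 'w::complex_vector topology \<Rightarrow> ('v \<Rightarrow> 'w) set \<Rightarrow> bool" where
  "operator_open X Y W \<longleftrightarrow> W \<subseteq> continuous_operators X Y \<and>
     (\<forall>\<phi>\<in>W. \<exists>K U. compactin X K \<and> zero_nhd Y U \<and> operator_nhd X Y \<phi> K U \<subseteq> W)"

definition operator_space ::
  "'v::complex_vector topology \<Rightarrow> 'w::complex_vector topology \<Rightarrow> ('v \<Rightarrow> 'w) topology" where
  "operator_space X Y = topology (operator_open X Y)"

lemma zero_nhd_Int: "zero_nhd X U \<Longrightarrow> zero_nhd X V \<Longrightarrow> zero_nhd X (U \<inter> V)"
  unfolding zero_nhd_def by (metis IntI inf.coboundedI1 inf_mono openin_Int)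

lemma istopology_operator_open: "istopology (operator_open X Y)"
  unfolding istopology_def
proof (intro conjI allI impI)
  fix S T assume S: "operator_open X Y S" and T: "operator_open X Y T"
  show "operator_open X Y (S \<inter> T)"
    unfolding operator_open_def
  proof (intro conjI ballI)
    show "S \<inter> T \<subseteq> continuous_operators X Y"
      using S by (auto simp: operator_open_def)
    fix \<phi> assume "\<phi> \<in> S \<inter> T"
    then obtain K U L V where
      "compactin X K" "zero_nhd Y U" "operator_nhd X Y \<phi> K U \<subseteq> S"
      "compactin X L" "zero_nhd Y V" "operator_nhd X Y \<phi> L V \<subseteq> T"
      using S T unfolding operator_open_def by (metis IntE)
    moreover have "operator_nhd X Y \<phi> (K \<union> L) (U \<inter> V)
        \<subseteq> operator_nhd X Y \<phi> K U \<inter> operator_nhd X Y \<phi> L V"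
      by (auto simp: operator_nhd_def)
    ultimately show "\<exists>K U. compactin X K \<and> zero_nhd Y U \<and> operator_nhd X Y \<phi> K U \<subseteq> S \<inter> T"
      by (intro exI[of _ "K \<union> L"] exI[of _ "U \<inter> V"]) (auto simp: compactin_Un zero_nhd_Int)
  qed
next
  fix \<W> assume W: "\<forall>W\<in>\<W>. operator_open X Y W"
  show "operator_open X Y (\<Union>\<W>)"
    unfolding operator_open_def
  proof (intro conjI ballI)
    show "\<Union>\<W> \<subseteq> continuous_operators X Y"
      using W by (auto simp: operator_open_def)
    fix \<phi> assume "\<phi> \<in> \<Union>\<W>"
    then obtain W where "W \<in> \<W>" "\<phi> \<in> W" by blast
    then show "\<exists>K U. compactin X K \<and> zero_nhd Y U \<and> operator_nhd X Y \<phi> K U \<subseteq> \<Union>\<W>"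
      using W unfolding operator_open_def by (meson Union_upper subset_trans)
  qed
qed

lemma openin_operator_space: "openin (operator_space X Y) W \<longleftrightarrow> operator_open X Y W"
  by (simp add: operator_space_def istopology_operator_open)

definition L_space :: "'v::complex_vector topology \<Rightarrow> ('v \<Rightarrow> 'v) topology" where
  "L_space X = pseudosaturation (operator_space X X)"

definition identity_operator :: "'v::complex_vector topology \<Rightarrow> 'v \<Rightarrow> 'v" where
  "identity_operator X = (\<lambda>x. if x \<in> topspace X then x else 0)"

definition finite_rank_operators ::
  "'v::complex_vector topology \<Rightarrow> 'w::complex_vector topology \<Rightarrow> ('v \<Rightarrow> 'w) set" where
  "finite_rank_operators X Y = {\<phi> \<in> continuous_operators X Y.
     \<exists>B. finite B \<and> \<phi> ` topspace X \<subseteq> complex_vector.span B}"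

definition stereotype_approximation_property :: "'v::complex_vector topology \<Rightarrow> bool" where
  "stereotype_approximation_property X \<longleftrightarrow>
     identity_operator X \<in> L_space X closure_of finite_rank_operators X X"

end

theory Submission
  imports Defs
begin

text \<open>
  On totally bounded sets a locally convex topology \<open>X\<close> and its pseudosaturation agree.  To see this
  without the transfinite construction, let \<open>W\<close> be the finest locally convex topology that
  coincides with \<open>X\<close> on the totally bounded sets of \<open>X\<close>.  It has the same totally bounded sets as
  \<open>X\<close> and is pseudosaturated, so the pseudosaturation lies between \<open>X\<close> and \<open>W\<close>.  Consequently, if
  a set \<open>S\<close> of operators on \<open>C(M)\<close> is totally bounded for uniform convergence on the compact subsets
  of \<open>C(M)\<close> and \<open>\<phi>\<close> lies in its closure for that topology, then \<open>\<phi>\<close> lies in the closure of \<open>S\<close> in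
  \<open>L(C(M))\<close>.

  For a locally finite partition of unity \<open>\<eta>\<close> of mesh \<open>1 / n\<close> with sample points \<open>\<tau>\<close> put
  \<open>P f = (\<Sum>i. f (\<tau> i) * \<eta> i)\<close>.  On a compact subset of \<open>M\<close> only finitely many \<open>\<eta> i\<close> are nonzero, so
  the finite partial sums of \<open>P\<close> form a totally bounded set having \<open>P\<close> in its closure.  As
  \<open>n\<close> grows, the operators \<open>P\<close> converge to the identity, and taking closures twice gives the claim.
\<close>

section \<open>Topologies given by a base of zero neighbourhoods\<close>

text \<open>Neighbourhoods in the pseudosaturation of an operator space have no convenient explicit
  form, so membership in a closure cannot be estimated there directly. What can be controlled is the
  trace of the topology on totally bounded sets, and this dictates that approximating families be
  totally bounded. It also explains the two stages: for one mesh, the partial sums agree on a given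
  compact set with finitely many of them, whereas the partial sums of all meshes taken together need
  not be totally bounded. The reduction is applied at two levels, to operators and to their values,
  because the target \<open>C(M)\<close> is itself a pseudosaturation; what remains to be checked is
  uniform smallness on compact subsets of \<open>M\<close>. A separate obstacle is that the
  operators must be continuous for the pseudosaturated topology on both sides, so functoriality has
  to be derived from minimality alone, without an explicit description of the topology.\<close>

definition absconvex :: "'v::complex_vector set \<Rightarrow> bool" where
  "absconvex U \<longleftrightarrow> convex U \<and> balanced U"

lemma absconvex_scaleC:
  assumes "absconvex U" "x \<in> U" "norm c \<le> 1"
  shows "c *\<^sub>C x \<in> U"
  using assms by (auto simp: absconvex_def balanced_def)

lemma absconvex_uminus:
  assumes "absconvex U" "x \<in> U"
  shows "- x \<in> U"
  using absconvex_scaleC[OF assms, of "-1"] by simp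

lemma absconvex_midpoint:
  assumes "absconvex U" "x \<in> U" "y \<in> U"
  shows "(1 / 2) *\<^sub>C (x + y) \<in> U"
proof -
  have "(1/2) *\<^sub>R x + (1/2) *\<^sub>R y \<in> U"
    using assms by (intro convexD) (auto simp: absconvex_def)
  then show ?thesis
    by (simp add: scaleR_scaleC scaleC_add_right)
qed

lemma half_double: "(1 / 2) *\<^sub>C 2 *\<^sub>C (x::'v::complex_vector) = x"
  by (simp add: scaleC_scaleC scaleC_one)

lemma absconvex_half_add:
  assumes "absconvex U" "2 *\<^sub>C x \<in> U" "2 *\<^sub>C y \<in> U"
  shows "x + y \<in> U"
  using absconvex_midpoint[OF assms] by (metis half_double scaleC_add_right)

lemma absconvex_half_diff:
  assumes "absconvex U" "2 *\<^sub>C x \<in> U" "2 *\<^sub>C y \<in> U"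
  shows "x - y \<in> U"
  using absconvex_half_add[OF assms(1,2), of "- y"] absconvex_uminus[OF assms(1,3)] by simp

lemma absconvex_Int: "absconvex U \<Longrightarrow> absconvex U' \<Longrightarrow> absconvex (U \<inter> U')"
  by (auto simp: absconvex_def balanced_def convex_Int)

text \<open>With complex coefficients a single closure condition carries convexity and balancedness
  together; real coefficients give the former and \<open>b = 0\<close> the latter.\<close>

lemma absconvexI:
  assumes "\<And>x y a b. x \<in> U \<Longrightarrow> y \<in> U \<Longrightarrow> norm a + norm b \<le> 1 \<Longrightarrow> a *\<^sub>C x + b *\<^sub>C y \<in> U"
  shows "absconvex U"
  unfolding absconvex_def
proof
  show "convex U"
    unfolding convex_def
  proof (intro ballI allI impI)
    fix x y and u v :: real assume "x \<in> U" "y \<in> U" "0 \<le> u" "0 \<le> v" "u + v = 1"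
    then show "u *\<^sub>R x + v *\<^sub>R y \<in> U"
      using assms[of x y "complex_of_real u" "complex_of_real v"] by (simp add: scaleR_scaleC)
  qed
  show "balanced U"
    unfolding balanced_def
  proof (intro ballI allI impI)
    fix x and c :: complex assume "x \<in> U" "norm c \<le> 1"
    then show "c *\<^sub>C x \<in> U"
      using assms[of x x c 0] by simp
  qed
qed

text \<open>Balancedness absorbs the phases: \<open>a *\<^sub>C x\<close> becomes
  \<open>norm a *\<^sub>R z\<close> with \<open>z \<in> U\<close>. Dividing the moduli by their sum
  \<open>s\<close> gives a convex combination, and the remaining factor \<open>s \<le> 1\<close> is
  again harmless by balancedness.\<close>

lemma absconvexD:
  assumes U: "absconvex U" and "x \<in> U" "y \<in> U" "norm a + norm b \<le> 1"
  shows "a *\<^sub>C x + b *\<^sub>C y \<in> U"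
proof (cases "norm a + norm b = 0")
  case True
  then have "a = 0" "b = 0"
    by (metis add_nonneg_eq_0_iff norm_ge_zero norm_eq_zero)+
  then show ?thesis
    using absconvex_scaleC[OF U \<open>x \<in> U\<close>, of 0] by simp
next
  case False
  define s where "s = norm a + norm b"
  have s: "0 < s" "s \<le> 1"
    using False assms by (auto simp: s_def order_less_le)
  have *: "\<exists>z\<in>U. a *\<^sub>C x = norm a *\<^sub>R z" if "x \<in> U" for a x
  proof (cases "a = 0")
    case True
    then show ?thesis using that by auto
  next
    case False
    have "norm a *\<^sub>R (a / norm a) *\<^sub>C x = a *\<^sub>C x"
      using False by (simp add: scaleR_scaleC scaleC_scaleC)
    moreover have "(a / norm a) *\<^sub>C x \<in> U"
      using False by (intro absconvex_scaleC[OF U that]) (simp add: norm_divide)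
    ultimately show ?thesis by metis
  qed
  obtain z w where zw: "z \<in> U" "w \<in> U" "a *\<^sub>C x = norm a *\<^sub>R z" "b *\<^sub>C y = norm b *\<^sub>R w"
    using * assms by metis
  have "(norm a / s) *\<^sub>R z + (norm b / s) *\<^sub>R w \<in> U"
    using U zw s add_divide_distrib[of "norm a" "norm b" s]
    by (intro convexD) (auto simp: absconvex_def s_def)
  then have "complex_of_real s *\<^sub>C ((norm a / s) *\<^sub>R z + (norm b / s) *\<^sub>R w) \<in> U"
    using s by (intro absconvex_scaleC[OF U]) auto
  also have "complex_of_real s *\<^sub>C ((norm a / s) *\<^sub>R z + (norm b / s) *\<^sub>R w)
      = s *\<^sub>R ((norm a / s) *\<^sub>R z + (norm b / s) *\<^sub>R w)"
    by (simp only: scaleR_scaleC)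
  also have "\<dots> = a *\<^sub>C x + b *\<^sub>C y"
    using s by (simp add: zw scaleR_add_right)
  finally show ?thesis .
qed

lemma absconvex_double_vimage:
  assumes "absconvex U" "complex_vector.subspace V"
  shows "absconvex {x \<in> V. 2 *\<^sub>C x \<in> U}"
proof (rule absconvexI)
  fix x y and a b :: complex
  assume *: "x \<in> {x \<in> V. 2 *\<^sub>C x \<in> U}" "y \<in> {x \<in> V. 2 *\<^sub>C x \<in> U}" "norm a + norm b \<le> 1"
  have "2 *\<^sub>C (a *\<^sub>C x + b *\<^sub>C y) = a *\<^sub>C 2 *\<^sub>C x + b *\<^sub>C 2 *\<^sub>C y"
    by (simp add: scaleC_add_right scaleC_scaleC mult.commute)
  then show "a *\<^sub>C x + b *\<^sub>C y \<in> {x \<in> V. 2 *\<^sub>C x \<in> U}"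
    using * absconvexD[OF assms(1), of "2 *\<^sub>C x" "2 *\<^sub>C y" a b] assms(2)
    by (simp add: complex_vector.subspace_add complex_vector.subspace_scale)
qed

text \<open>That the predicate satisfies the axioms of a topology comes from downward directedness
  of \<open>B\<close>; facts about this topology are therefore stated inside the locale
  \<open>zero_base\<close>.\<close>

definition nhd_topology :: "'v::complex_vector set \<Rightarrow> 'v set set \<Rightarrow> 'v topology" where
  "nhd_topology V B = topology (\<lambda>S. S \<subseteq> V \<and> (\<forall>x\<in>S. \<exists>U\<in>B. \<forall>u\<in>U. x + u \<in> S))"

text \<open>Absolute convexity keeps the axioms short: one positive multiple suffices for
  absorption, and containment of a doubled set replaces \<open>U' + U' \<subseteq> U\<close>, since
  \<open>x + y\<close> is the midpoint of the doubled vectors. The last axiom yields the Hausdorff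
  property.\<close>

locale zero_base =
  fixes V :: "'v::complex_vector set" and B :: "'v set set"
  assumes subspace: "complex_vector.subspace V"
    and nonempty: "B \<noteq> {}"
    and sub: "U \<in> B \<Longrightarrow> U \<subseteq> V"
    and absc: "U \<in> B \<Longrightarrow> absconvex U"
    and absorb: "U \<in> B \<Longrightarrow> x \<in> V \<Longrightarrow> \<exists>r>0. complex_of_real r *\<^sub>C x \<in> U"
    and int: "U \<in> B \<Longrightarrow> U' \<in> B \<Longrightarrow> \<exists>U''\<in>B. U'' \<subseteq> U \<inter> U'"
    and half: "U \<in> B \<Longrightarrow> \<exists>U'\<in>B. \<forall>x\<in>U'. 2 *\<^sub>C x \<in> U"
    and sep: "x \<in> V \<Longrightarrow> x \<noteq> 0 \<Longrightarrow> \<exists>U\<in>B. x \<notin> U"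
begin

lemma zero_mem: "U \<in> B \<Longrightarrow> 0 \<in> U"
  using absorb[of U 0] complex_vector.subspace_0[OF subspace] by auto

lemma half_add: "U \<in> B \<Longrightarrow> \<exists>U'\<in>B. \<forall>x\<in>U'. \<forall>y\<in>U'. x + y \<in> U"
  using half absconvex_half_add absc by metis

text \<open>Iterating \<open>half\<close> handles the factors \<open>2 ^ n\<close>. A scalar of norm
  at most \<open>m < 2 ^ n\<close> is \<open>2 ^ n\<close> times a scalar of the unit disc, so one
  neighbourhood serves all scalars up to \<open>m\<close> at once.\<close>

lemma scale_base: "U \<in> B \<Longrightarrow> \<exists>U'\<in>B. \<forall>u\<in>U'. \<forall>c. norm c \<le> m \<longrightarrow> c *\<^sub>C u \<in> U"
proof -
  assume U: "U \<in> B"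
  have *: "\<exists>U'\<in>B. \<forall>u\<in>U'. (2 ^ n) *\<^sub>C u \<in> U" for n
  proof (induction n)
    case 0
    then show ?case using U by (auto simp: scaleC_one)
  next
    case (Suc n)
    then obtain U' where "U' \<in> B" "\<forall>u\<in>U'. (2 ^ n) *\<^sub>C u \<in> U" by blast
    moreover obtain U'' where "U'' \<in> B" "\<forall>x\<in>U''. 2 *\<^sub>C x \<in> U'"
      using half calculation by blast
    ultimately have "\<forall>u\<in>U''. (2 ^ Suc n) *\<^sub>C u \<in> U"
      by (metis power_Suc2 scaleC_scaleC)
    then show ?case using \<open>U'' \<in> B\<close> by blast
  qed
  obtain n where n: "m < 2 ^ n"
    using real_arch_pow[of 2 m] by auto
  obtain U' where U': "U' \<in> B" "\<forall>u\<in>U'. (2 ^ n) *\<^sub>C u \<in> U"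
    using * by blast
  have "c *\<^sub>C u \<in> U" if "u \<in> U'" "norm c \<le> m" for c u
  proof -
    have "c *\<^sub>C u = (c / 2 ^ n) *\<^sub>C (2 ^ n) *\<^sub>C u"
      by (simp add: scaleC_scaleC)
    moreover have "norm (c / 2 ^ n) \<le> 1"
      using n that by (simp add: norm_divide norm_power)
    ultimately show ?thesis
      using absconvex_scaleC[OF absc[OF U]] U' that by metis
  qed
  then show ?thesis using U' by blast
qed

lemma openin_nhd: "openin (nhd_topology V B) S \<longleftrightarrow> S \<subseteq> V \<and> (\<forall>x\<in>S. \<exists>U\<in>B. \<forall>u\<in>U. x + u \<in> S)"
proof -
  have "istopology (\<lambda>S. S \<subseteq> V \<and> (\<forall>x\<in>S. \<exists>U\<in>B. \<forall>u\<in>U. x + u \<in> S))"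
    unfolding istopology_def
  proof (intro conjI allI impI)
    fix S T assume S: "S \<subseteq> V \<and> (\<forall>x\<in>S. \<exists>U\<in>B. \<forall>u\<in>U. x + u \<in> S)"
      and T: "T \<subseteq> V \<and> (\<forall>x\<in>T. \<exists>U\<in>B. \<forall>u\<in>U. x + u \<in> T)"
    show "S \<inter> T \<subseteq> V" using S by blast
    show "\<forall>x\<in>S \<inter> T. \<exists>U\<in>B. \<forall>u\<in>U. x + u \<in> S \<inter> T"
    proof
      fix x assume "x \<in> S \<inter> T"
      then have x: "x \<in> S" "x \<in> T" by auto
      obtain U where "U \<in> B" "\<forall>u\<in>U. x + u \<in> S" using S x(1) by blast
      moreover obtain U' where "U' \<in> B" "\<forall>u\<in>U'. x + u \<in> T" using T x(2) by blast
      ultimately show "\<exists>U\<in>B. \<forall>u\<in>U. x + u \<in> S \<inter> T"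
        using int[of U U'] by blast
    qed
  next
    fix \<K> assume *: "\<forall>K\<in>\<K>. K \<subseteq> V \<and> (\<forall>x\<in>K. \<exists>U\<in>B. \<forall>u\<in>U. x + u \<in> K)"
    then show "\<Union>\<K> \<subseteq> V" by blast
    show "\<forall>x\<in>\<Union>\<K>. \<exists>U\<in>B. \<forall>u\<in>U. x + u \<in> \<Union>\<K>"
    proof
      fix x assume "x \<in> \<Union>\<K>"
      then obtain K where "K \<in> \<K>" "x \<in> K" by blast
      moreover from this obtain U where "U \<in> B" "\<forall>u\<in>U. x + u \<in> K"
        using * by meson
      ultimately show "\<exists>U\<in>B. \<forall>u\<in>U. x + u \<in> \<Union>\<K>" by blast
    qed
  qed
  then show ?thesis by (simp add: nhd_topology_def)
qed

lemma topspace_nhd [simp]: "topspace (nhd_topology V B) = V"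
proof
  show "topspace (nhd_topology V B) \<subseteq> V"
    by (metis openin_nhd openin_topspace)
  have "openin (nhd_topology V B) V"
    unfolding openin_nhd using nonempty sub complex_vector.subspace_add[OF subspace] by blast
  then show "V \<subseteq> topspace (nhd_topology V B)"
    by (rule openin_subset)
qed

text \<open>Base sets need not be open. The witness collects the points of \<open>x + U\<close>
  around which a further translate of a base set stays inside \<open>x + U\<close>, and
  \<open>half_add\<close> makes this interior open.\<close>

lemma interior_nhd:
  assumes "U \<in> B" "x \<in> V"
  obtains W where "openin (nhd_topology V B) W" "x \<in> W" "\<And>w. w \<in> W \<Longrightarrow> w - x \<in> U"
proof
  let ?W = "{w\<in>V. \<exists>U'\<in>B. \<forall>u\<in>U'. w - x + u \<in> U}"
  show "openin (nhd_topology V B) ?W"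
    unfolding openin_nhd
  proof (intro conjI ballI)
    fix w assume "w \<in> ?W"
    then obtain U' where w: "w \<in> V" and U': "U' \<in> B" "\<forall>u\<in>U'. w - x + u \<in> U" by auto
    obtain U'' where U'': "U'' \<in> B" "\<forall>x\<in>U''. \<forall>y\<in>U''. x + y \<in> U'"
      using half_add U' by blast
    have "w + u \<in> ?W" if "u \<in> U''" for u
    proof -
      have "w + u \<in> V"
        using w that sub U''(1) complex_vector.subspace_add[OF subspace] by blast
      moreover have "w + u - x + v \<in> U" if "v \<in> U''" for v
        using U' U'' \<open>u \<in> U''\<close> that by (metis add.assoc add_diff_eq add.commute)
      ultimately show ?thesis using U'' by blast
    qed
    then show "\<exists>U\<in>B. \<forall>u\<in>U. w + u \<in> ?W" using U'' by blast
  qed auto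
  show "x \<in> ?W" using assms by auto
  show "w - x \<in> U" if "w \<in> ?W" for w
    using that zero_mem by fastforce
qed

lemma zero_nhd_iff: "zero_nhd (nhd_topology V B) N \<longleftrightarrow> N \<subseteq> V \<and> (\<exists>U\<in>B. U \<subseteq> N)"
proof
  assume "zero_nhd (nhd_topology V B) N"
  then obtain W where W: "N \<subseteq> V" "openin (nhd_topology V B) W" "0 \<in> W" "W \<subseteq> N"
    by (auto simp: zero_nhd_def)
  then obtain U where "U \<in> B" "\<forall>u\<in>U. 0 + u \<in> W"
    using openin_nhd by blast
  then show "N \<subseteq> V \<and> (\<exists>U\<in>B. U \<subseteq> N)" using W by auto
next
  assume *: "N \<subseteq> V \<and> (\<exists>U\<in>B. U \<subseteq> N)"
  then obtain U where U: "U \<in> B" "U \<subseteq> N" by blast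
  obtain W where "openin (nhd_topology V B) W" "0 \<in> W" "\<And>w. w \<in> W \<Longrightarrow> w - 0 \<in> U"
    using interior_nhd[OF U(1)] complex_vector.subspace_0[OF subspace] by blast
  then show "zero_nhd (nhd_topology V B) N"
    using * U by (auto simp: zero_nhd_def)
qed

lemma locally_convex_space_nhd: "locally_convex_space (nhd_topology V B)"
proof -
  let ?X = "nhd_topology V B"
  have "Hausdorff_space ?X"
    unfolding Hausdorff_space_def
  proof (intro allI impI)
    fix x y assume xy: "x \<in> topspace ?X \<and> y \<in> topspace ?X \<and> x \<noteq> y"
    then have "x - y \<in> V" "x - y \<noteq> 0"
      by (auto intro: complex_vector.subspace_diff[OF subspace])
    then obtain U where U: "U \<in> B" "x - y \<notin> U" using sep by blast
    obtain U' where U': "U' \<in> B" "\<forall>x\<in>U'. \<forall>y\<in>U'. x + y \<in> U"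
      using half_add U by blast
    obtain W1 where W1: "openin ?X W1" "x \<in> W1" "\<And>w. w \<in> W1 \<Longrightarrow> w - x \<in> U'"
      using interior_nhd[OF U'(1)] xy by auto
    obtain W2 where W2: "openin ?X W2" "y \<in> W2" "\<And>w. w \<in> W2 \<Longrightarrow> w - y \<in> U'"
      using interior_nhd[OF U'(1)] xy by auto
    have "disjnt W1 W2"
      unfolding disjnt_iff
    proof (intro allI notI)
      fix w assume "w \<in> W1 \<and> w \<in> W2"
      then have "- (w - x) \<in> U'" "w - y \<in> U'"
        using W1 W2 absconvex_uminus[OF absc[OF U'(1)]] by blast+
      then have "- (w - x) + (w - y) \<in> U" using U' by blast
      then show False using U by simp
    qed
    then show "\<exists>U V. openin ?X U \<and> openin ?X V \<and> x \<in> U \<and> y \<in> V \<and> disjnt U V"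
      using W1 W2 by blast
  qed
  moreover have "continuous_map (prod_topology ?X ?X) ?X (\<lambda>(x, y). x + y)"
    unfolding continuous_map_def
  proof (intro conjI allI impI)
    show "(\<lambda>(x, y). x + y) \<in> topspace (prod_topology ?X ?X) \<rightarrow> topspace ?X"
      using complex_vector.subspace_add[OF subspace] by auto
    fix S assume S: "openin ?X S"
    show "openin (prod_topology ?X ?X) {z \<in> topspace (prod_topology ?X ?X). (case z of (x, y) \<Rightarrow> x + y) \<in> S}"
      unfolding openin_prod_topology_alt
    proof (intro allI impI)
      fix x y assume "(x, y) \<in> {z \<in> topspace (prod_topology ?X ?X). (case z of (x, y) \<Rightarrow> x + y) \<in> S}"
      then have xy: "x \<in> V" "y \<in> V" "x + y \<in> S" by auto
      obtain U where U: "U \<in> B" "\<forall>u\<in>U. x + y + u \<in> S"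
        using S xy openin_nhd by blast
      obtain U' where U': "U' \<in> B" "\<forall>x\<in>U'. \<forall>y\<in>U'. x + y \<in> U"
        using half_add U by blast
      obtain W1 where W1: "openin ?X W1" "x \<in> W1" "\<And>w. w \<in> W1 \<Longrightarrow> w - x \<in> U'"
        using interior_nhd[OF U'(1)] xy by auto
      obtain W2 where W2: "openin ?X W2" "y \<in> W2" "\<And>w. w \<in> W2 \<Longrightarrow> w - y \<in> U'"
        using interior_nhd[OF U'(1)] xy by auto
      have "a + b \<in> S" if "a \<in> W1" "b \<in> W2" for a b
      proof -
        have "(a - x) + (b - y) \<in> U" using W1 W2 U' that by blast
        then have "x + y + ((a - x) + (b - y)) \<in> S" using U by blast
        then show ?thesis by (simp add: algebra_simps)
      qed
      then show "\<exists>U Va. openin ?X U \<and> openin ?X Va \<and> x \<in> U \<and> y \<in> Va \<and>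
          U \<times> Va \<subseteq> {z \<in> topspace (prod_topology ?X ?X). (case z of (x, y) \<Rightarrow> x + y) \<in> S}"
        using W1 W2 openin_subset[OF W1(1)] openin_subset[OF W2(1)]
        by (intro exI[of _ W1] exI[of _ W2]) auto
    qed
  qed
  moreover have "continuous_map (prod_topology euclidean ?X) ?X (\<lambda>(c, x). c *\<^sub>C x)"
    unfolding continuous_map_def
  proof (intro conjI allI impI)
    show "(\<lambda>(c, x). c *\<^sub>C x) \<in> topspace (prod_topology euclidean ?X) \<rightarrow> topspace ?X"
      using complex_vector.subspace_scale[OF subspace] by auto
    fix S assume S: "openin ?X S"
    show "openin (prod_topology euclidean ?X) {z \<in> topspace (prod_topology euclidean ?X). (case z of (c, x) \<Rightarrow> c *\<^sub>C x) \<in> S}"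
      unfolding openin_prod_topology_alt
    proof (intro allI impI)
      fix c x assume "(c, x) \<in> {z \<in> topspace (prod_topology euclidean ?X). (case z of (c, x) \<Rightarrow> c *\<^sub>C x) \<in> S}"
      then have cx: "x \<in> V" "c *\<^sub>C x \<in> S" by auto
      obtain U where U: "U \<in> B" "\<forall>u\<in>U. c *\<^sub>C x + u \<in> S"
        using S cx openin_nhd by blast
      obtain U' where U': "U' \<in> B" "\<forall>x\<in>U'. \<forall>y\<in>U'. x + y \<in> U"
        using half_add U by blast
      \<comment> \<open>The estimate splits \<open>d w - c x\<close> into \<open>d (w - x)\<close>
        and \<open>(d - c) x\<close>. Since \<open>r\<close> absorbs \<open>x\<close>, the second
        term is in \<open>U'\<close> once \<open>norm (d - c) < r\<close>; the bound
        \<open>norm c + r\<close> on \<open>norm d\<close> determines \<open>U2\<close> for the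
        first.\<close>
      obtain r where r: "r > 0" "complex_of_real r *\<^sub>C x \<in> U'"
        using absorb U' cx by blast
      obtain U2 where U2: "U2 \<in> B" "\<forall>u\<in>U2. \<forall>d. norm d \<le> norm c + r \<longrightarrow> d *\<^sub>C u \<in> U'"
        using scale_base[OF U'(1)] by blast
      obtain W where W: "openin ?X W" "x \<in> W" "\<And>w. w \<in> W \<Longrightarrow> w - x \<in> U2"
        using interior_nhd[OF U2(1)] cx by auto
      have "d *\<^sub>C w \<in> S" if "d \<in> ball c r" "w \<in> W" for d w
      proof -
        have d: "norm (d - c) < r"
          using that by (simp add: dist_norm norm_minus_commute)
        moreover have "norm d \<le> norm c + norm (d - c)"
          by (metis add.commute diff_add_cancel norm_triangle_ineq)
        ultimately have "norm d \<le> norm c + r" by linarith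
        then have 1: "d *\<^sub>C (w - x) \<in> U'" using U2 W that by blast
        have "(d - c) *\<^sub>C x = ((d - c) / r) *\<^sub>C (complex_of_real r *\<^sub>C x)"
          using r by (simp add: scaleC_scaleC)
        moreover have "norm ((d - c) / r) \<le> 1"
          using d r by (simp add: norm_divide)
        ultimately have 2: "(d - c) *\<^sub>C x \<in> U'"
          using absconvex_scaleC[OF absc[OF U'(1)]] r by metis
        have "c *\<^sub>C x + (d *\<^sub>C (w - x) + (d - c) *\<^sub>C x) \<in> S" using 1 2 U U' by blast
        also have "c *\<^sub>C x + (d *\<^sub>C (w - x) + (d - c) *\<^sub>C x) = d *\<^sub>C w"
          by (simp add: complex_vector.scale_right_diff_distrib complex_vector.scale_left_diff_distrib)
        finally show ?thesis .
      qed
      then show "\<exists>U Va. openin euclidean U \<and> openin ?X Va \<and> c \<in> U \<and> x \<in> Va \<and>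
          U \<times> Va \<subseteq> {z \<in> topspace (prod_topology euclidean ?X). (case z of (c, x) \<Rightarrow> c *\<^sub>C x) \<in> S}"
        using W openin_subset[OF W(1)] r
        by (intro exI[of _ "ball c r"] exI[of _ W]) auto
    qed
  qed
  moreover have "\<exists>N'. zero_nhd ?X N' \<and> convex N' \<and> N' \<subseteq> N" if "zero_nhd ?X N" for N
    using that absc sub unfolding zero_nhd_iff absconvex_def by blast
  ultimately show ?thesis
    unfolding locally_convex_space_def by (simp add: subspace)
qed

end

section \<open>Locally convex spaces\<close>

lemma zero_nhd_mem: "zero_nhd X U \<Longrightarrow> 0 \<in> U"
  by (auto simp: zero_nhd_def)

lemma zero_nhd_mono:
  assumes "zero_nhd X U" "U \<subseteq> U'" "U' \<subseteq> topspace X"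
  shows "zero_nhd X U'"
  using assms unfolding zero_nhd_def by (meson order_trans)

context
  fixes X :: "'v::complex_vector topology"
  assumes X: "locally_convex_space X"
begin

lemma lcs_subspace: "complex_vector.subspace (topspace X)"
  using X by (simp add: locally_convex_space_def)

lemma lcs_Hausdorff: "Hausdorff_space X"
  using X by (simp add: locally_convex_space_def)

lemma lcs_continuous_add:
  "continuous_map Y X f \<Longrightarrow> continuous_map Y X g \<Longrightarrow> continuous_map Y X (\<lambda>y. f y + g y)"
  using continuous_map_compose[OF continuous_map_pairedI, of Y X f X g X "\<lambda>(x, y). x + y"] X
  by (simp add: locally_convex_space_def o_def)

lemma lcs_continuous_scale:
  "continuous_map Y euclidean c \<Longrightarrow> continuous_map Y X g \<Longrightarrow> continuous_map Y X (\<lambda>y. c y *\<^sub>C g y)"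
  using continuous_map_compose[OF continuous_map_pairedI, of Y euclidean c X g X "\<lambda>(x, y). x *\<^sub>C y"] X
  by (simp add: locally_convex_space_def o_def)

lemma openin_lcs_translation:
  assumes "openin X S" "x \<in> topspace X"
  shows "openin X {y \<in> topspace X. x + y \<in> S}"
proof (rule openin_continuous_map_preimage[OF _ assms(1)])
  show "continuous_map X X ((+) x)"
    using assms by (intro lcs_continuous_add) auto
qed

lemma openin_lcs_scale:
  assumes "openin X S"
  shows "openin X {y \<in> topspace X. c *\<^sub>C y \<in> S}"
  by (rule openin_continuous_map_preimage[OF _ assms]) (intro lcs_continuous_scale; auto)

lemma zero_nhd_double_vimage:
  assumes "zero_nhd X U"
  shows "zero_nhd X {x \<in> topspace X. 2 *\<^sub>C x \<in> U}"
proof -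
  obtain W where "openin X W" "0 \<in> W" "W \<subseteq> U"
    using assms by (auto simp: zero_nhd_def)
  then show ?thesis
    unfolding zero_nhd_def using openin_lcs_scale[of W 2] complex_vector.subspace_0[OF lcs_subspace]
    by (intro conjI exI[of _ "{x \<in> topspace X. 2 *\<^sub>C x \<in> W}"]) auto
qed

lemma zero_nhd_absorbing:
  assumes "zero_nhd X U" "x \<in> topspace X"
  shows "\<exists>r>0. complex_of_real r *\<^sub>C x \<in> U"
proof -
  obtain W where W: "openin X W" "0 \<in> W" "W \<subseteq> U"
    using assms by (auto simp: zero_nhd_def)
  have "continuous_map euclidean X (\<lambda>c::complex. c *\<^sub>C x)"
    by (intro lcs_continuous_scale) (use assms in auto)
  then have "open {c. c *\<^sub>C x \<in> W}"
    using openin_continuous_map_preimage[OF _ W(1)] by fastforce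
  moreover have "0 \<in> {c. c *\<^sub>C x \<in> W}"
    using W by simp
  ultimately obtain r where r: "r > 0" "ball 0 r \<subseteq> {c. c *\<^sub>C x \<in> W}"
    using open_contains_ball by blast
  then have "complex_of_real (r / 2) \<in> ball 0 r" by simp
  then have "complex_of_real (r / 2) *\<^sub>C x \<in> U"
    using r W by blast
  then show ?thesis using r by (intro exI[of _ "r / 2"]) auto
qed

text \<open>\<open>locally_convex_space\<close> provides convex neighbourhoods only. The balanced
  core \<open>U\<close> of a convex \<open>C\<close> remains convex, and continuity of scalar
  multiplication at \<open>(0, 0)\<close> makes it a neighbourhood of zero.\<close>

lemma zero_nhd_absconvex:
  assumes "zero_nhd X N"
  obtains U where "zero_nhd X U" "absconvex U" "U \<subseteq> N"
proof -
  obtain C where C: "zero_nhd X C" "convex C" "C \<subseteq> N"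
    using assms X by (auto simp: locally_convex_space_def)
  then obtain W where W: "openin X W" "0 \<in> W" "W \<subseteq> C"
    by (auto simp: zero_nhd_def)
  define U where "U = {x \<in> topspace X. \<forall>c. norm c \<le> 1 \<longrightarrow> c *\<^sub>C x \<in> C}"
  let ?P = "prod_topology euclidean X :: (complex \<times> 'v) topology"
  define G where "G = {z \<in> topspace ?P. (case z of (c, x) \<Rightarrow> c *\<^sub>C x) \<in> W}"
  have "continuous_map ?P X (\<lambda>(c, x). c *\<^sub>C x)"
    using X by (simp add: locally_convex_space_def)
  then have "openin ?P G"
    unfolding G_def by (rule openin_continuous_map_preimage) (rule W)
  moreover have "(0, 0) \<in> G"
    using W complex_vector.subspace_0[OF lcs_subspace] by (auto simp: G_def)
  moreover have G: "c *\<^sub>C x \<in> W" if "(c, x) \<in> G" for c x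
    using that by (simp add: G_def)
  ultimately have "\<exists>S T. openin euclidean S \<and> openin X T \<and> 0 \<in> S \<and> 0 \<in> T \<and> S \<times> T \<subseteq> G"
    using openin_prod_topology_alt[THEN iffD1, rule_format, of euclidean X G 0 0] by simp
  then obtain S T where S: "open S" and ST: "openin X T" "0 \<in> S" "0 \<in> T" "S \<times> T \<subseteq> G"
    by auto
  obtain r where r: "r > 0" "ball 0 r \<subseteq> S"
    using openE[OF S ST(2)] by blast
  \<comment> \<open>For \<open>norm c \<le> 1\<close> write
    \<open>c = (c * r / 2) * (2 / r)\<close>: the first factor has norm at most
    \<open>r / 2 < r\<close> and so lies in \<open>S\<close>, while the second carries
    \<open>y\<close> into \<open>T\<close>.\<close>
  have "{y \<in> topspace X. complex_of_real (2 / r) *\<^sub>C y \<in> T} \<subseteq> U"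
  proof
    fix y assume y: "y \<in> {y \<in> topspace X. complex_of_real (2 / r) *\<^sub>C y \<in> T}"
    have "c *\<^sub>C y \<in> C" if "norm c \<le> 1" for c
    proof -
      have "norm (c * complex_of_real (r / 2)) < r"
        using that r mult_right_mono[of "norm c" 1 "r / 2"] by (simp add: norm_mult)
      then have "c * complex_of_real (r / 2) \<in> S" using r by auto
      then have "(c * complex_of_real (r / 2)) *\<^sub>C (complex_of_real (2 / r) *\<^sub>C y) \<in> W"
        using ST(4) y by (intro G) auto
      moreover have "(c * complex_of_real (r / 2)) * complex_of_real (2 / r) = c"
        using r by simp
      ultimately show ?thesis
        using W(3) by (metis scaleC_scaleC subsetD)
    qed
    then show "y \<in> U" using y by (simp add: U_def)
  qed
  moreover have "openin X {y \<in> topspace X. complex_of_real (2 / r) *\<^sub>C y \<in> T}"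
    by (rule openin_lcs_scale[OF ST(1)])
  moreover have "0 \<in> {y \<in> topspace X. complex_of_real (2 / r) *\<^sub>C y \<in> T}"
    using ST complex_vector.subspace_0[OF lcs_subspace] by auto
  ultimately have "zero_nhd X U"
    unfolding zero_nhd_def by (intro conjI exI[of _ "{y \<in> topspace X. complex_of_real (2 / r) *\<^sub>C y \<in> T}"]) (auto simp: U_def)
  moreover have "absconvex U"
    unfolding absconvex_def
  proof
    show "convex U"
      unfolding convex_def
    proof (intro ballI allI impI)
      fix x y and u v :: real
      assume *: "x \<in> U" "y \<in> U" "0 \<le> u" "0 \<le> v" "u + v = 1"
      then have "u *\<^sub>R x + v *\<^sub>R y \<in> topspace X"
        using lcs_subspace
        by (simp add: U_def scaleR_scaleC complex_vector.subspace_add complex_vector.subspace_scale)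
      moreover have "c *\<^sub>C (u *\<^sub>R x + v *\<^sub>R y) \<in> C" if "norm c \<le> 1" for c
      proof -
        have "c *\<^sub>C (u *\<^sub>R x + v *\<^sub>R y) = u *\<^sub>R (c *\<^sub>C x) + v *\<^sub>R (c *\<^sub>C y)"
          by (simp add: scaleR_scaleC scaleC_add_right scaleC_scaleC mult.commute)
        moreover have "c *\<^sub>C x \<in> C" "c *\<^sub>C y \<in> C"
          using * that by (auto simp: U_def)
        ultimately show ?thesis
          using convexD[OF C(2)] * by metis
      qed
      ultimately show "u *\<^sub>R x + v *\<^sub>R y \<in> U" by (simp add: U_def)
    qed
    show "balanced U"
      unfolding balanced_def U_def
      using complex_vector.subspace_scale[OF lcs_subspace]
      by (auto simp: scaleC_scaleC norm_mult mult_le_one)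
  qed
  moreover have "U \<subseteq> N"
  proof
    fix x assume "x \<in> U"
    then have "norm (1::complex) \<le> 1 \<longrightarrow> 1 *\<^sub>C x \<in> C"
      unfolding U_def by blast
    then show "x \<in> N" using C(3) by (auto simp: scaleC_one)
  qed
  ultimately show ?thesis using that by blast
qed

text \<open>Allows facts proved for \<open>nhd_topology\<close>, notably
  \<open>interior_nhd\<close>, to be applied to a given locally convex space.\<close>

lemma zero_base_lcs: "zero_base (topspace X) {U. zero_nhd X U \<and> absconvex U}"
proof
  show "complex_vector.subspace (topspace X)" by (rule lcs_subspace)
  have "zero_nhd X (topspace X)"
    using complex_vector.subspace_0[OF lcs_subspace] by (auto simp: zero_nhd_def)
  then show "{U. zero_nhd X U \<and> absconvex U} \<noteq> {}"
    using zero_nhd_absconvex by blast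
  fix U assume U: "U \<in> {U. zero_nhd X U \<and> absconvex U}"
  show "U \<subseteq> topspace X" "absconvex U"
    using U by (auto simp: zero_nhd_def)
  show "\<exists>r>0. complex_of_real r *\<^sub>C x \<in> U" if "x \<in> topspace X" for x
    using zero_nhd_absorbing that U by blast
  show "\<exists>U''\<in>{U. zero_nhd X U \<and> absconvex U}. U'' \<subseteq> U \<inter> U'" if "U' \<in> {U. zero_nhd X U \<and> absconvex U}" for U'
    using U that zero_nhd_Int absconvex_Int by blast
  show "\<exists>U'\<in>{U. zero_nhd X U \<and> absconvex U}. \<forall>x\<in>U'. 2 *\<^sub>C x \<in> U"
    using U zero_nhd_double_vimage[of U] absconvex_double_vimage[OF _ lcs_subspace, of U]
    by (intro bexI[of _ "{x \<in> topspace X. 2 *\<^sub>C x \<in> U}"]) auto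
next
  fix x assume x: "x \<in> topspace X" "x \<noteq> 0"
  then obtain W where "openin X W" "0 \<in> W" "x \<notin> W"
    using lcs_Hausdorff complex_vector.subspace_0[OF lcs_subspace]
    unfolding Hausdorff_space_def disjnt_iff by metis
  then have "zero_nhd X W"
    by (auto simp: zero_nhd_def openin_subset)
  then obtain U where "zero_nhd X U" "absconvex U" "U \<subseteq> W"
    using zero_nhd_absconvex by blast
  then show "\<exists>U\<in>{U. zero_nhd X U \<and> absconvex U}. x \<notin> U"
    using \<open>x \<notin> W\<close> by blast
qed

lemma openin_lcs:
  "openin X S \<longleftrightarrow> S \<subseteq> topspace X \<and> (\<forall>x\<in>S. \<exists>U. zero_nhd X U \<and> absconvex U \<and> (\<forall>u\<in>U. x + u \<in> S))"
proof safe
  fix x assume "openin X S" "x \<in> S"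
  show "x \<in> topspace X" using \<open>openin X S\<close> \<open>x \<in> S\<close> openin_subset by blast
next
  fix x assume S: "openin X S" "x \<in> S"
  then have x: "x \<in> topspace X" using openin_subset by blast
  then have "zero_nhd X {y \<in> topspace X. x + y \<in> S}"
    using openin_lcs_translation[OF S(1)] complex_vector.subspace_0[OF lcs_subspace] S
    unfolding zero_nhd_def by fastforce
  then obtain U where "zero_nhd X U" "absconvex U" "U \<subseteq> {y \<in> topspace X. x + y \<in> S}"
    by (rule zero_nhd_absconvex)
  then show "\<exists>U. zero_nhd X U \<and> absconvex U \<and> (\<forall>u\<in>U. x + u \<in> S)" by blast
next
  assume S: "S \<subseteq> topspace X" "\<forall>x\<in>S. \<exists>U. zero_nhd X U \<and> absconvex U \<and> (\<forall>u\<in>U. x + u \<in> S)"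
  have "\<exists>T. openin X T \<and> x \<in> T \<and> T \<subseteq> S" if x: "x \<in> S" for x
  proof -
    obtain U where U: "zero_nhd X U" "\<forall>u\<in>U. x + u \<in> S" using S x by blast
    then obtain W where W: "openin X W" "0 \<in> W" "W \<subseteq> U"
      by (auto simp: zero_nhd_def)
    have "- x \<in> topspace X" "x \<in> topspace X"
      using x S complex_vector.subspace_neg[OF lcs_subspace] by blast+
    moreover have "{y \<in> topspace X. - x + y \<in> W} \<subseteq> S"
    proof
      fix y assume "y \<in> {y \<in> topspace X. - x + y \<in> W}"
      then have "x + (- x + y) \<in> S" using U W by blast
      then show "y \<in> S" by simp
    qed
    ultimately show ?thesis
      using openin_lcs_translation[OF W(1), of "- x"] W
      by (intro exI[of _ "{y \<in> topspace X. - x + y \<in> W}"]) auto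
  qed
  then show "openin X S"
    by (subst openin_subopen) blast
qed

lemma zero_nhd_add:
  assumes "zero_nhd X N"
  obtains U where "zero_nhd X U" "absconvex U" "\<And>x y. x \<in> U \<Longrightarrow> y \<in> U \<Longrightarrow> x + y \<in> N"
    "\<And>x y. x \<in> U \<Longrightarrow> y \<in> U \<Longrightarrow> x - y \<in> N"
proof -
  obtain N' where N': "zero_nhd X N'" "absconvex N'" "N' \<subseteq> N"
    using zero_nhd_absconvex assms by blast
  show ?thesis
  proof (rule that)
    show "zero_nhd X {x \<in> topspace X. 2 *\<^sub>C x \<in> N'}"
      by (rule zero_nhd_double_vimage[OF N'(1)])
    show "absconvex {x \<in> topspace X. 2 *\<^sub>C x \<in> N'}"
      by (rule absconvex_double_vimage[OF N'(2) lcs_subspace])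
  qed (use N' absconvex_half_add absconvex_half_diff in blast)+
qed

lemma closedin_lcs_avoid:
  assumes "closedin X D" "x \<in> topspace X" "x \<notin> D"
  obtains U where "zero_nhd X U" "\<And>u. u \<in> U \<Longrightarrow> x + u \<notin> D"
proof -
  have "openin X (topspace X - D)" "x \<in> topspace X - D"
    using assms by auto
  then obtain U where "zero_nhd X U" "\<forall>u\<in>U. x + u \<in> topspace X - D"
    unfolding openin_lcs by meson
  then show ?thesis using that by blast
qed

lemma closure_of_lcs:
  "x \<in> X closure_of S \<longleftrightarrow> x \<in> topspace X \<and> (\<forall>U. zero_nhd X U \<longrightarrow> (\<exists>s\<in>S. s \<in> topspace X \<and> s - x \<in> U))"
proof safe
  assume x: "x \<in> X closure_of S"
  then show "x \<in> topspace X" by (simp add: in_closure_of)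
  fix U assume U: "zero_nhd X U"
  interpret zero_base "topspace X" "{U. zero_nhd X U \<and> absconvex U}"
    by (rule zero_base_lcs)
  \<comment> \<open>By \<open>openin_lcs\<close> the space is recovered from its own absolutely
    convex zero neighbourhoods, so \<open>interior_nhd\<close> provides an open set around
    \<open>x\<close> inside \<open>x + U'\<close>.\<close>
  have eq: "nhd_topology (topspace X) {U. zero_nhd X U \<and> absconvex U} = X"
    unfolding topology_eq openin_nhd openin_lcs by blast
  obtain U' where U': "zero_nhd X U'" "absconvex U'" "U' \<subseteq> U"
    using U zero_nhd_absconvex by blast
  then obtain W where W: "openin X W" "x \<in> W" "\<And>w. w \<in> W \<Longrightarrow> w - x \<in> U'"
    using interior_nhd[of U' x] \<open>x \<in> topspace X\<close> unfolding eq by blast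
  then obtain s where "s \<in> S" "s \<in> W"
    using x by (auto simp: in_closure_of)
  then show "\<exists>s\<in>S. s \<in> topspace X \<and> s - x \<in> U"
    using W U' openin_subset by blast
next
  assume x: "x \<in> topspace X" and *: "\<forall>U. zero_nhd X U \<longrightarrow> (\<exists>s\<in>S. s \<in> topspace X \<and> s - x \<in> U)"
  have "\<exists>s\<in>S. s \<in> T" if T: "openin X T" "x \<in> T" for T
  proof -
    obtain U where U: "zero_nhd X U" "\<forall>u\<in>U. x + u \<in> T"
      using T by (auto simp: openin_lcs)
    then obtain s where "s \<in> S" "s - x \<in> U" using * by blast
    then have "x + (s - x) \<in> T" using U by blast
    then show ?thesis using \<open>s \<in> S\<close> by auto
  qed
  then show "x \<in> X closure_of S"
    using x by (auto simp: in_closure_of)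
qed

lemma linear_continuous_mapD:
  assumes "linear_on (topspace X) \<phi>" "continuous_map X X' \<phi>" "zero_nhd X' U"
  shows "zero_nhd X {x \<in> topspace X. \<phi> x \<in> U}"
proof -
  obtain W where W: "openin X' W" "0 \<in> W" "W \<subseteq> U"
    using assms by (auto simp: zero_nhd_def)
  have "\<phi> 0 = 0"
    using assms(1) complex_vector.subspace_0[OF lcs_subspace]
    unfolding linear_on_def by (metis complex_vector.scale_zero_left)
  then show ?thesis
    unfolding zero_nhd_def
    using openin_continuous_map_preimage[OF assms(2) W(1)] W complex_vector.subspace_0[OF lcs_subspace]
    by (intro conjI exI[of _ "{x \<in> topspace X. \<phi> x \<in> W}"]) auto
qed

end

lemma linear_continuous_mapI:
  assumes X: "locally_convex_space X" and X': "locally_convex_space X'"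
    and \<phi>: "linear_on (topspace X) \<phi>" "\<And>x. x \<in> topspace X \<Longrightarrow> \<phi> x \<in> topspace X'"
    and nhd: "\<And>U. zero_nhd X' U \<Longrightarrow> absconvex U \<Longrightarrow> zero_nhd X {x \<in> topspace X. \<phi> x \<in> U}"
  shows "continuous_map X X' \<phi>"
  unfolding continuous_map_def
proof (intro conjI allI impI)
  show "\<phi> \<in> topspace X \<rightarrow> topspace X'" using \<phi> by auto
  fix S assume S: "openin X' S"
  show "openin X {x \<in> topspace X. \<phi> x \<in> S}"
    unfolding openin_lcs[OF X]
  proof (intro conjI ballI)
    fix x assume x: "x \<in> {x \<in> topspace X. \<phi> x \<in> S}"
    then have "\<phi> x \<in> S" by simp
    then obtain U where U: "zero_nhd X' U" "absconvex U" "\<forall>u\<in>U. \<phi> x + u \<in> S"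
      using S unfolding openin_lcs[OF X'] by meson
    obtain U' where U': "zero_nhd X U'" "absconvex U'" "U' \<subseteq> {x \<in> topspace X. \<phi> x \<in> U}"
      using zero_nhd_absconvex[OF X nhd[OF U(1,2)]] by blast
    have "x + u \<in> {x \<in> topspace X. \<phi> x \<in> S}" if "u \<in> U'" for u
    proof -
      have "u \<in> topspace X" "\<phi> u \<in> U" using that U' by auto
      then show ?thesis
        using x U \<phi> complex_vector.subspace_add[OF lcs_subspace[OF X]] by (auto simp: linear_on_def)
    qed
    then show "\<exists>U. zero_nhd X U \<and> absconvex U \<and> (\<forall>u\<in>U. x + u \<in> {x \<in> topspace X. \<phi> x \<in> S})"
      using U' by blast
  qed auto
qed

section \<open>Comparison and refinement of locally convex topologies\<close>

lemma finer_topology_lcsI: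
  assumes "locally_convex_space X" "locally_convex_space Y" "topspace X = topspace Y"
    and "\<And>U. zero_nhd Y U \<Longrightarrow> absconvex U \<Longrightarrow> zero_nhd X U"
  shows "finer_topology X Y"
  using assms unfolding finer_topology_def by (simp add: openin_lcs) blast

lemma finer_topology_zero_nhd:
  "finer_topology X Y \<Longrightarrow> zero_nhd Y U \<Longrightarrow> zero_nhd X U"
  by (auto simp: finer_topology_def zero_nhd_def)

lemma finer_topology_antisym: "finer_topology X Y \<Longrightarrow> finer_topology Y X \<Longrightarrow> X = Y"
  by (auto simp: finer_topology_def topology_eq)

lemma finer_topology_closedin: "finer_topology X Y \<Longrightarrow> closedin Y D \<Longrightarrow> closedin X D"
  by (simp add: finer_topology_def closedin_def)

text \<open>Common scheme for the topologies constructed below: the bounded refinement, the infimum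
  of pseudosaturated refinements, and the final topology used for functoriality differ only in
  \<open>\<Phi>\<close>. Separation is inherited from \<open>X\<close>, whose absolutely convex zero
  neighbourhoods all belong to \<open>B\<close>.\<close>

lemma finer_topology_zero_base:
  fixes X :: "'v::complex_vector topology"
  assumes X: "locally_convex_space X"
    and Int: "\<And>U U'. \<Phi> U \<Longrightarrow> \<Phi> U' \<Longrightarrow> \<Phi> (U \<inter> U')"
    and half: "\<And>U. \<Phi> U \<Longrightarrow> \<Phi> {x \<in> topspace X. 2 *\<^sub>C x \<in> U}"
    and absorb: "\<And>U x. \<Phi> U \<Longrightarrow> absconvex U \<Longrightarrow> U \<subseteq> topspace X \<Longrightarrow> x \<in> topspace X \<Longrightarrow>
        \<exists>r>0. complex_of_real r *\<^sub>C x \<in> U"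
    and nhd: "\<And>U. zero_nhd X U \<Longrightarrow> absconvex U \<Longrightarrow> \<Phi> U"
  defines "B \<equiv> {U. U \<subseteq> topspace X \<and> absconvex U \<and> \<Phi> U}"
  shows "zero_base (topspace X) B" and "finer_topology (nhd_topology (topspace X) B) X"
proof -
  interpret X: zero_base "topspace X" "{U. zero_nhd X U \<and> absconvex U}"
    by (rule zero_base_lcs[OF X])
  have sub: "{U. zero_nhd X U \<and> absconvex U} \<subseteq> B"
    using nhd by (auto simp: B_def zero_nhd_def)
  interpret B: zero_base "topspace X" B
  proof
    show "complex_vector.subspace (topspace X)" by (rule lcs_subspace[OF X])
    show "B \<noteq> {}" using sub X.nonempty by blast
    fix U assume U: "U \<in> B"
    show "U \<subseteq> topspace X" "absconvex U" using U by (auto simp: B_def)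
    show "\<exists>r>0. complex_of_real r *\<^sub>C x \<in> U" if "x \<in> topspace X" for x
      using absorb U that by (auto simp: B_def)
    show "\<exists>U''\<in>B. U'' \<subseteq> U \<inter> U'" if "U' \<in> B" for U'
      using U that Int absconvex_Int by (intro bexI[of _ "U \<inter> U'"]) (auto simp: B_def)
    show "\<exists>U'\<in>B. \<forall>x\<in>U'. 2 *\<^sub>C x \<in> U"
      using U half absconvex_double_vimage[OF _ lcs_subspace[OF X]]
      by (intro bexI[of _ "{x \<in> topspace X. 2 *\<^sub>C x \<in> U}"]) (auto simp: B_def)
  next
    fix x assume "x \<in> topspace X" "x \<noteq> 0"
    then show "\<exists>U\<in>B. x \<notin> U" using X.sep sub by blast
  qed
  show "zero_base (topspace X) B" by (rule B.zero_base_axioms)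
  show "finer_topology (nhd_topology (topspace X) B) X"
  proof (rule finer_topology_lcsI[OF B.locally_convex_space_nhd X])
    show "topspace (nhd_topology (topspace X) B) = topspace X" by simp
    fix U assume "zero_nhd X U" "absconvex U"
    then show "zero_nhd (nhd_topology (topspace X) B) U"
      using sub unfolding B.zero_nhd_iff by (auto simp: zero_nhd_def)
  qed
qed

section \<open>Totally bounded sets\<close>

lemma totally_bounded_in_topspace: "totally_bounded_in X A \<Longrightarrow> A \<subseteq> topspace X"
  unfolding totally_bounded_in_def by (rule conjunct1)

text \<open>Each cell that meets \<open>A\<close> contributes one of its points, and every
  \<open>a\<close> shares a cell with the point so chosen. \<open>P\<close> is left abstract because
  the cells are translates of a zero neighbourhood, preimages of translates of a capacious set, or
  families of operators close to each other on a compact set.\<close>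

lemma finite_inner_cover:
  assumes F: "finite F" and cover: "\<And>a. a \<in> A \<Longrightarrow> \<exists>f\<in>F. P a f"
  shows "\<exists>G. finite G \<and> G \<subseteq> A \<and> (\<forall>a\<in>A. \<exists>g\<in>G. \<exists>f\<in>F. P a f \<and> P g f)"
proof -
  define h where "h f = (SOME a. a \<in> A \<and> P a f)" for f
  have h: "h f \<in> A" "P (h f) f" if "a \<in> A" "P a f" for a f
    unfolding h_def using someI[of "\<lambda>a. a \<in> A \<and> P a f" a] that by simp_all
  define G where "G = h ` {f \<in> F. \<exists>a\<in>A. P a f}"
  have "finite G" using F by (simp add: G_def)
  moreover have "G \<subseteq> A"
      unfolding G_def by (safe, erule (1) h(1))
  moreover have "\<exists>g\<in>G. \<exists>f\<in>F. P a f \<and> P g f" if a: "a \<in> A" for a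
  proof -
    obtain f where f: "f \<in> F" "P a f" using cover[OF a] by (rule bexE)
    have 1: "h f \<in> G" unfolding G_def using f a by (intro imageI CollectI conjI bexI)
    show "\<exists>g\<in>G. \<exists>f\<in>F. P a f \<and> P g f"
      by (rule bexI[OF _ 1], rule bexI[OF _ f(1)], rule conjI[OF f(2) h(2)[OF a f(2)]])
  qed
  ultimately show ?thesis by meson
qed

context
  fixes X :: "'v::complex_vector topology"
  assumes X: "locally_convex_space X"
begin

lemma totally_bounded_inI:
  assumes "A \<subseteq> topspace X"
    and "\<And>N. zero_nhd X N \<Longrightarrow> \<exists>F. finite F \<and> F \<subseteq> topspace X \<and> (\<forall>a\<in>A. \<exists>f\<in>F. a - f \<in> N)"
  shows "totally_bounded_in X A"
  unfolding totally_bounded_in_def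
proof (intro conjI allI impI)
  fix U assume "zero_nhd X U"
  from assms(2)[OF this]
  obtain F where F: "finite F" "F \<subseteq> topspace X" "\<forall>a\<in>A. \<exists>f\<in>F. a - f \<in> U"
    by (elim exE conjE)
  have "A \<subseteq> {u + f |u f. u \<in> U \<and> f \<in> F}"
  proof
    fix a assume "a \<in> A"
    then obtain f where "f \<in> F" "a - f \<in> U" using F(3) by blast
    then show "a \<in> {u + f |u f. u \<in> U \<and> f \<in> F}"
      by (intro CollectI exI[of _ "a - f"] exI[of _ f]) simp
  qed
  then show "\<exists>F. finite F \<and> F \<subseteq> topspace X \<and> A \<subseteq> {u + f |u f. u \<in> U \<and> f \<in> F}"
    using F(1,2) by blast
qed (rule assms(1))

text \<open>Two points in the same translate of \<open>U\<close> differ by an element of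
  \<open>U - U\<close>, which is contained in \<open>N\<close>; this is the price for centres inside
  \<open>A\<close>. Such centres keep the differences \<open>a - f\<close> in
  \<open>A - A\<close>.\<close>

lemma totally_bounded_inD:
  assumes A: "totally_bounded_in X A" and N: "zero_nhd X N"
  shows "\<exists>F. finite F \<and> F \<subseteq> A \<and> (\<forall>a\<in>A. \<exists>f\<in>F. a - f \<in> N)"
proof -
  obtain U where U: "zero_nhd X U" "\<And>x y. x \<in> U \<Longrightarrow> y \<in> U \<Longrightarrow> x - y \<in> N"
    using zero_nhd_add[OF X N] by metis
  obtain F where F: "finite F" "A \<subseteq> {u + f |u f. u \<in> U \<and> f \<in> F}"
    using A U(1) unfolding totally_bounded_in_def by blast
  have "\<exists>f\<in>F. a - f \<in> U" if a: "a \<in> A" for a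
  proof -
    obtain u f where "a = u + f" "u \<in> U" "f \<in> F" using F(2) a by blast
    then show ?thesis by (intro bexI[of _ f]) auto
  qed
  then obtain G where G: "finite G" "G \<subseteq> A" "\<forall>a\<in>A. \<exists>g\<in>G. \<exists>f\<in>F. a - f \<in> U \<and> g - f \<in> U"
    using finite_inner_cover[OF F(1), of A "\<lambda>a f. a - f \<in> U"] by auto
  have "\<exists>g\<in>G. a - g \<in> N" if a: "a \<in> A" for a
  proof -
    obtain g f where "g \<in> G" "a - f \<in> U" "g - f \<in> U" using G(3) a by blast
    then have "(a - f) - (g - f) \<in> N" using U by blast
    then show ?thesis using \<open>g \<in> G\<close> by auto
  qed
  then show ?thesis using G(1,2) by auto
qed

lemma totally_bounded_in_finite:
  assumes "finite A" "A \<subseteq> topspace X"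
  shows "totally_bounded_in X A"
proof (rule totally_bounded_inI[OF assms(2)])
  fix N assume "zero_nhd X N"
  then have "0 \<in> N" by (rule zero_nhd_mem)
  then show "\<exists>F. finite F \<and> F \<subseteq> topspace X \<and> (\<forall>a\<in>A. \<exists>f\<in>F. a - f \<in> N)"
    using assms by (intro exI[of _ A]) force
qed

lemma totally_bounded_in_Un:
  assumes "totally_bounded_in X A" "totally_bounded_in X A'"
  shows "totally_bounded_in X (A \<union> A')"
proof (rule totally_bounded_inI)
  show "A \<union> A' \<subseteq> topspace X" using assms[THEN totally_bounded_in_topspace] by (rule Un_least)
  fix N assume N: "zero_nhd X N"
  obtain F where "finite F" "F \<subseteq> A" "\<forall>a\<in>A. \<exists>f\<in>F. a - f \<in> N"
    using totally_bounded_inD[OF assms(1) N] by (elim exE conjE)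
  moreover obtain F' where "finite F'" "F' \<subseteq> A'" "\<forall>a\<in>A'. \<exists>f\<in>F'. a - f \<in> N"
    using totally_bounded_inD[OF assms(2) N] by (elim exE conjE)
  ultimately show "\<exists>F. finite F \<and> F \<subseteq> topspace X \<and> (\<forall>a\<in>A \<union> A'. \<exists>f\<in>F. a - f \<in> N)"
    using assms[THEN totally_bounded_in_topspace]
    by (intro exI[of _ "F \<union> F'"] conjI) blast+
qed

lemma totally_bounded_in_diff:
  assumes "totally_bounded_in X A"
  shows "totally_bounded_in X {a - b |a b. a \<in> A \<and> b \<in> A}"
proof (rule totally_bounded_inI)
  have A: "A \<subseteq> topspace X" using assms by (rule totally_bounded_in_topspace)
  then show "{a - b |a b. a \<in> A \<and> b \<in> A} \<subseteq> topspace X"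
    using complex_vector.subspace_diff[OF lcs_subspace[OF X]] by blast
  fix N assume N: "zero_nhd X N"
  obtain U where U: "zero_nhd X U" "\<And>x y. x \<in> U \<Longrightarrow> y \<in> U \<Longrightarrow> x - y \<in> N"
    using zero_nhd_add[OF X N] by metis
  obtain F where F: "finite F" "F \<subseteq> A" "\<forall>a\<in>A. \<exists>f\<in>F. a - f \<in> U"
    using totally_bounded_inD[OF assms U(1)] by (elim exE conjE)
  let ?G = "(\<lambda>(f, g). f - g) ` (F \<times> F)"
  have "\<exists>h\<in>?G. x - h \<in> N" if x: "x \<in> {a - b |a b. a \<in> A \<and> b \<in> A}" for x
  proof -
    obtain a b where ab: "x = a - b" "a \<in> A" "b \<in> A" using x by blast
    obtain f where f: "f \<in> F" "a - f \<in> U" using F(3) ab(2) by blast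
    obtain g where g: "g \<in> F" "b - g \<in> U" using F(3) ab(3) by blast
    have "(a - f) - (b - g) \<in> N" using U(2) f g by blast
    then have "x - (f - g) \<in> N" by (simp add: ab algebra_simps)
    then show ?thesis using f g by force
  qed
  moreover have "?G \<subseteq> topspace X"
  proof
    fix x assume "x \<in> ?G"
    then obtain f g where "x = f - g" "f \<in> F" "g \<in> F" by auto
    then show "x \<in> topspace X"
      using F(2) A complex_vector.subspace_diff[OF lcs_subspace[OF X], of f g] by auto
  qed
  ultimately show "\<exists>F. finite F \<and> F \<subseteq> topspace X \<and> (\<forall>a\<in>{a - b |a b. a \<in> A \<and> b \<in> A}. \<exists>f\<in>F. a - f \<in> N)"
    using F(1) by (intro exI[of _ ?G] conjI ballI) simp_all
qed

lemma totally_bounded_in_compactin: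
  assumes K: "compactin X K"
  shows "totally_bounded_in X K"
proof (rule totally_bounded_inI)
  show KX: "K \<subseteq> topspace X" using K by (rule compactin_subset_topspace)
  fix N assume N: "zero_nhd X N"
  interpret zero_base "topspace X" "{U. zero_nhd X U \<and> absconvex U}"
    by (rule zero_base_lcs[OF X])
  have eq: "nhd_topology (topspace X) {U. zero_nhd X U \<and> absconvex U} = X"
    unfolding topology_eq openin_nhd openin_lcs[OF X] by blast
  obtain U where U: "zero_nhd X U" "absconvex U" "U \<subseteq> N"
    using zero_nhd_absconvex[OF X N] by blast
  have "\<exists>W. openin X W \<and> x \<in> W \<and> (\<forall>w\<in>W. w - x \<in> U)" if "x \<in> K" for x
  proof (rule interior_nhd)
    show "U \<in> {U. zero_nhd X U \<and> absconvex U}" "x \<in> topspace X"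
      using U that KX by auto
  qed (metis eq)
  then obtain W where W: "\<And>x. x \<in> K \<Longrightarrow> openin X (W x) \<and> x \<in> W x \<and> (\<forall>w\<in>W x. w - x \<in> U)"
    by metis
  have "\<exists>\<F>. finite \<F> \<and> \<F> \<subseteq> W ` K \<and> K \<subseteq> \<Union>\<F>"
    by (rule compactinD[OF K]) (use W in blast)+
  then obtain F where F: "F \<subseteq> K" "finite F" "K \<subseteq> \<Union>(W ` F)"
    by (metis finite_subset_image)
  have "\<exists>f\<in>F. a - f \<in> N" if a: "a \<in> K" for a
  proof -
    obtain f where "f \<in> F" "a \<in> W f" using F a by blast
    then show ?thesis using W U F by blast
  qed
  then show "\<exists>F. finite F \<and> F \<subseteq> topspace X \<and> (\<forall>a\<in>K. \<exists>f\<in>F. a - f \<in> N)"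
    using F KX by (intro exI[of _ F]) auto
qed

end

lemma totally_bounded_in_image:
  assumes X: "locally_convex_space X" and X': "locally_convex_space X'"
    and \<phi>: "linear_on (topspace X) \<phi>" "continuous_map X X' \<phi>"
    and A: "totally_bounded_in X A"
  shows "totally_bounded_in X' (\<phi> ` A)"
proof (rule totally_bounded_inI[OF X'])
  have AX: "A \<subseteq> topspace X" using A by (rule totally_bounded_in_topspace)
  then show sub: "\<phi> ` A \<subseteq> topspace X'"
    using continuous_map_image_subset_topspace[OF \<phi>(2)] by blast
  fix N assume N: "zero_nhd X' N"
  obtain F where F: "finite F" "F \<subseteq> A" "\<forall>a\<in>A. \<exists>f\<in>F. a - f \<in> {x \<in> topspace X. \<phi> x \<in> N}"
    using totally_bounded_inD[OF X A linear_continuous_mapD[OF X \<phi> N]] by (elim exE conjE)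
  have diff: "\<phi> (a - f) = \<phi> a - \<phi> f" if "a \<in> topspace X" "f \<in> topspace X" for a f
  proof -
    have "a - f \<in> topspace X" using that complex_vector.subspace_diff[OF lcs_subspace[OF X]] by blast
    then have "\<phi> (a - f + f) = \<phi> (a - f) + \<phi> f"
      using that \<phi>(1) unfolding linear_on_def by blast
    then show ?thesis by simp
  qed
  then have "\<exists>f\<in>\<phi> ` F. \<phi> a - f \<in> N" if a: "a \<in> A" for a
  proof -
    obtain f where "f \<in> F" "\<phi> (a - f) \<in> N" using F(3) a by blast
    moreover have "a \<in> topspace X" "f \<in> topspace X" using AX F(2) a calculation by auto
    ultimately show ?thesis using diff by (intro bexI[of _ "\<phi> f"]) auto
  qed
  then show "\<exists>F. finite F \<and> F \<subseteq> topspace X' \<and> (\<forall>a\<in>\<phi> ` A. \<exists>f\<in>F. a - f \<in> N)"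
    using F(1,2) sub by (intro exI[of _ "\<phi> ` F"]) (simp; blast)
qed

lemma totally_bounded_in_double:
  assumes X: "locally_convex_space X" and A: "totally_bounded_in X A"
  shows "totally_bounded_in X ((\<lambda>x. 2 *\<^sub>C x) ` A)"
proof (rule totally_bounded_in_image[OF X X _ _ A])
  show "linear_on (topspace X) ((*\<^sub>C) 2)"
    by (simp add: linear_on_def scaleC_add_right)
  show "continuous_map X X ((*\<^sub>C) 2)"
    by (rule lcs_continuous_scale[OF X]) simp_all
qed

lemma finer_topology_topspace: "finer_topology Z X \<Longrightarrow> topspace Z = topspace X"
  unfolding finer_topology_def by (rule conjunct1)

lemma totally_bounded_in_coarser:
  assumes ZX: "finer_topology Z X" and A: "totally_bounded_in Z A"
  shows "totally_bounded_in X A"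
proof -
  have "topspace Z = topspace X" using ZX by (rule finer_topology_topspace)
  show ?thesis
    unfolding totally_bounded_in_def
  proof (intro conjI allI impI)
    show "A \<subseteq> topspace X"
      using A \<open>topspace Z = topspace X\<close> by (simp add: totally_bounded_in_def)
    fix U assume "zero_nhd X U"
    then have "zero_nhd Z U" by (rule finer_topology_zero_nhd[OF ZX])
    then show "\<exists>F. finite F \<and> F \<subseteq> topspace X \<and> A \<subseteq> {u + f |u f. u \<in> U \<and> f \<in> F}"
      using A unfolding totally_bounded_in_def \<open>topspace Z = topspace X\<close> by blast
  qed
qed

text \<open>A finer topology has fewer totally bounded sets, hence fewer sets that have to be
  covered.\<close>

lemma capacious_finer:
  assumes "finer_topology Z Y" "capacious Y D"
  shows "capacious Z D"
proof -
  have "topspace Z = topspace Y" using assms(1) by (rule finer_topology_topspace)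
  then show ?thesis
    using assms(2) unfolding capacious_def
    by (auto intro!: totally_bounded_in_coarser[OF assms(1)])
qed

section \<open>The pseudosaturation\<close>

text \<open>This is only an upper bound for the pseudosaturation: a convex set that is a zero neighbourhood
  here need not contain a closed capacious one.\<close>

definition bounded_refinement :: "'v::complex_vector topology \<Rightarrow> 'v topology" where
  "bounded_refinement X = nhd_topology (topspace X) {U. U \<subseteq> topspace X \<and> absconvex U \<and>
     (\<forall>A. totally_bounded_in X A \<longrightarrow> (\<exists>N. zero_nhd X N \<and> N \<inter> A \<subseteq> U))}"

context
  fixes X :: "'v::complex_vector topology"
  assumes X: "locally_convex_space X"
begin

lemma
  defines "B \<equiv> {U. U \<subseteq> topspace X \<and> absconvex U \<and>
     (\<forall>A. totally_bounded_in X A \<longrightarrow> (\<exists>N. zero_nhd X N \<and> N \<inter> A \<subseteq> U))}"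
  shows zero_base_bounded_refinement: "zero_base (topspace X) B"
    and finer_bounded_refinement: "finer_topology (bounded_refinement X) X"
proof -
  define \<Phi> where "\<Phi> U \<longleftrightarrow> (\<forall>A. totally_bounded_in X A \<longrightarrow> (\<exists>N. zero_nhd X N \<and> N \<inter> A \<subseteq> U))" for U
  have 1: "\<Phi> (U \<inter> U')" if U: "\<Phi> U" and U': "\<Phi> U'" for U U'
    unfolding \<Phi>_def
  proof (intro allI impI)
    fix A assume A: "totally_bounded_in X A"
    obtain N where "zero_nhd X N" "N \<inter> A \<subseteq> U" using U A by (auto simp: \<Phi>_def)
    moreover obtain N' where "zero_nhd X N'" "N' \<inter> A \<subseteq> U'" using U' A by (auto simp: \<Phi>_def)
    ultimately show "\<exists>N. zero_nhd X N \<and> N \<inter> A \<subseteq> U \<inter> U'"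
      by (intro exI[of _ "N \<inter> N'"]) (auto simp: zero_nhd_Int)
  qed
  have 2: "\<Phi> {x \<in> topspace X. 2 *\<^sub>C x \<in> U}" if U: "\<Phi> U" for U
    unfolding \<Phi>_def
  proof (intro allI impI)
    fix A assume A: "totally_bounded_in X A"
    obtain N where N: "zero_nhd X N" "N \<inter> (*\<^sub>C) 2 ` A \<subseteq> U"
      using U totally_bounded_in_double[OF X A] by (auto simp: \<Phi>_def)
    then have "{x \<in> topspace X. 2 *\<^sub>C x \<in> N} \<inter> A \<subseteq> {x \<in> topspace X. 2 *\<^sub>C x \<in> U}" by blast
    then show "\<exists>N. zero_nhd X N \<and> N \<inter> A \<subseteq> {x \<in> topspace X. 2 *\<^sub>C x \<in> U}"
      using zero_nhd_double_vimage[OF X N(1)] by blast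
  qed
  have 3: "\<exists>r>0. complex_of_real r *\<^sub>C x \<in> U"
    if U: "\<Phi> U" "absconvex U" "U \<subseteq> topspace X" and x: "x \<in> topspace X" for U x
  proof -
    \<comment> \<open>Absorption is tested on the compact disc of multiples of \<open>x\<close>:
      some neighbourhood of zero in \<open>X\<close> meets this disc only inside \<open>U\<close>,
      and it contains small multiples of \<open>x\<close>.\<close>
    let ?A = "(\<lambda>c. c *\<^sub>C x) ` cball 0 1"
    have "continuous_map euclidean X (\<lambda>c. c *\<^sub>C x)"
      by (intro lcs_continuous_scale[OF X]) (use x in auto)
    then have "compactin X ?A"
      by (intro image_compactin[of euclidean]) auto
    then have "totally_bounded_in X ?A"
      by (rule totally_bounded_in_compactin[OF X])
    then obtain N where N: "zero_nhd X N" "N \<inter> ?A \<subseteq> U" using U by (auto simp: \<Phi>_def)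
    obtain N' where N': "zero_nhd X N'" "absconvex N'" "N' \<subseteq> N"
      using zero_nhd_absconvex[OF X N(1)] by blast
    obtain r where r: "r > 0" "complex_of_real r *\<^sub>C x \<in> N'"
      using zero_nhd_absorbing[OF X N'(1) x] by blast
    \<comment> \<open>\<open>s \<le> 1\<close> keeps the multiple in \<open>N'\<close>, and
      \<open>s * r \<le> 1\<close> keeps it on the disc \<open>?A\<close>.\<close>
    define s where "s = min 1 (1 / r)"
    have s: "0 < s" "s \<le> 1" "s * r \<le> 1"
      using r by (auto simp: s_def min_def field_simps)
    have "complex_of_real s *\<^sub>C complex_of_real r *\<^sub>C x \<in> N'"
      by (rule absconvex_scaleC[OF N'(2)]) (use r s in auto)
    then have "complex_of_real (s * r) *\<^sub>C x \<in> N'"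
      by (simp add: scaleC_scaleC)
    moreover have "complex_of_real (s * r) \<in> cball 0 1"
      unfolding mem_cball_0 norm_of_real using r s by simp
    ultimately have "complex_of_real (s * r) *\<^sub>C x \<in> N \<inter> ?A"
      using N' by (intro IntI imageI) auto
    then have "complex_of_real (s * r) *\<^sub>C x \<in> U"
      using N(2) by (rule rev_subsetD)
    then show ?thesis using r s by (intro exI[of _ "s * r"]) simp
  qed
  have 4: "\<Phi> U" if "zero_nhd X U" "absconvex U" for U
    using that by (auto simp: \<Phi>_def)
  have B: "B = {U. U \<subseteq> topspace X \<and> absconvex U \<and> \<Phi> U}"
    by (simp add: B_def \<Phi>_def)
  have W: "bounded_refinement X = nhd_topology (topspace X) B"
    by (simp add: bounded_refinement_def B_def)
  show "zero_base (topspace X) B"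
    unfolding B by (rule finer_topology_zero_base(1)[where \<Phi> = \<Phi>, OF X 1 2 3 4])
  show "finer_topology (bounded_refinement X) X"
    unfolding W B by (rule finer_topology_zero_base(2)[where \<Phi> = \<Phi>, OF X 1 2 3 4])
qed

lemma lcs_bounded_refinement: "locally_convex_space (bounded_refinement X)"
  using zero_base.locally_convex_space_nhd[OF zero_base_bounded_refinement]
  by (simp add: bounded_refinement_def)

lemma topspace_bounded_refinement: "topspace (bounded_refinement X) = topspace X"
  using finer_bounded_refinement by (rule finer_topology_topspace)

lemma zero_nhd_bounded_refinement:
  "zero_nhd (bounded_refinement X) N \<longleftrightarrow> N \<subseteq> topspace X \<and> (\<exists>U\<subseteq>N. absconvex U \<and>
     (\<forall>A. totally_bounded_in X A \<longrightarrow> (\<exists>N. zero_nhd X N \<and> N \<inter> A \<subseteq> U)))"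
proof -
  define P where "P U \<longleftrightarrow> (\<forall>A. totally_bounded_in X A \<longrightarrow> (\<exists>N. zero_nhd X N \<and> N \<inter> A \<subseteq> U))" for U
  show ?thesis
    unfolding bounded_refinement_def zero_base.zero_nhd_iff[OF zero_base_bounded_refinement]
    unfolding P_def[symmetric] by blast
qed

lemma zero_nhd_bounded_refinement_Int:
  assumes "zero_nhd (bounded_refinement X) U" "totally_bounded_in X A"
  shows "\<exists>N. zero_nhd X N \<and> N \<inter> A \<subseteq> U"
proof -
  obtain U' where "U' \<subseteq> U" "\<forall>A. totally_bounded_in X A \<longrightarrow> (\<exists>N. zero_nhd X N \<and> N \<inter> A \<subseteq> U')"
    using assms(1) unfolding zero_nhd_bounded_refinement by blast
  moreover from this(2) obtain N where "zero_nhd X N" "N \<inter> A \<subseteq> U'"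
    using assms(2) by blast
  ultimately show ?thesis by blast
qed

text \<open>The defining condition compares the two topologies at zero only. Testing it on
  \<open>A - A\<close>, which is totally bounded as well, transfers the comparison to the points of
  \<open>A\<close>, because the centres are taken in \<open>A\<close>.\<close>

lemma totally_bounded_in_bounded_refinement:
  assumes A: "totally_bounded_in X A"
  shows "totally_bounded_in (bounded_refinement X) A"
proof (rule totally_bounded_inI[OF lcs_bounded_refinement])
  have AX: "A \<subseteq> topspace X" using A by (rule totally_bounded_in_topspace)
  then show "A \<subseteq> topspace (bounded_refinement X)" by (simp add: topspace_bounded_refinement)
  fix U assume "zero_nhd (bounded_refinement X) U"
  then obtain N where N: "zero_nhd X N" "N \<inter> {a - b |a b. a \<in> A \<and> b \<in> A} \<subseteq> U"
    using zero_nhd_bounded_refinement_Int[OF _ totally_bounded_in_diff[OF X A]] by meson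
  obtain F where F: "finite F" "F \<subseteq> A" "\<forall>a\<in>A. \<exists>f\<in>F. a - f \<in> N"
    using totally_bounded_inD[OF X A N(1)] by (elim exE conjE)
  have "\<exists>f\<in>F. a - f \<in> U" if a: "a \<in> A" for a
  proof -
    obtain f where f: "f \<in> F" "a - f \<in> N" using F(3) a by blast
    then have "a - f \<in> N \<inter> {a - b |a b. a \<in> A \<and> b \<in> A}" using F(2) a by blast
    then show ?thesis using N(2) f(1) by blast
  qed
  then show "\<exists>F. finite F \<and> F \<subseteq> topspace (bounded_refinement X) \<and> (\<forall>a\<in>A. \<exists>f\<in>F. a - f \<in> U)"
    using F(1,2) AX unfolding topspace_bounded_refinement by (intro exI[of _ F]) simp
qed

text \<open>Finitely many translates \<open>d + f\<close> of \<open>D\<close> cover the doubled set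
  \<open>2 A\<close>. If \<open>- f \<notin> D\<close>, closedness of \<open>D\<close> prevents
  points near zero from lying in the translate by \<open>f\<close>, and on \<open>2 A\<close> a
  neighbourhood from \<open>X\<close> is enough to exclude all such \<open>f\<close>. For the
  remaining \<open>f\<close>, both \<open>d\<close> and \<open>f\<close> lie in \<open>D\<close>, so
  \<open>a\<close> is in \<open>D\<close> as their midpoint; this is why \<open>A\<close> is
  doubled.\<close>

lemma pseudosaturated_bounded_refinement: "pseudosaturated (bounded_refinement X)"
  unfolding pseudosaturated_def
proof (intro conjI allI impI lcs_bounded_refinement)
  let ?W = "bounded_refinement X"
  fix D assume "closedin ?W D \<and> convex D \<and> balanced D \<and> capacious ?W D"
  then have D: "closedin ?W D" "absconvex D" "capacious ?W D" by (auto simp: absconvex_def)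
  have "\<exists>N. zero_nhd X N \<and> N \<inter> A \<subseteq> D" if A: "totally_bounded_in X A" for A
  proof -
    let ?A = "(*\<^sub>C) 2 ` A"
    have A2: "totally_bounded_in X ?A" by (rule totally_bounded_in_double[OF X A])
    have "totally_bounded_in ?W ?A" by (rule totally_bounded_in_bounded_refinement[OF A2])
    then obtain F where F: "finite F" "F \<subseteq> topspace X" "?A \<subseteq> {d + f |d f. d \<in> D \<and> f \<in> F}"
      using D(3) unfolding capacious_def topspace_bounded_refinement by blast
    have "\<exists>U. zero_nhd ?W U \<and> (\<forall>u\<in>U. - f + u \<notin> D)" if f: "f \<in> F" "- f \<notin> D" for f
    proof -
      have "- f \<in> topspace ?W"
        using f F(2) complex_vector.subspace_neg[OF lcs_subspace[OF X]]
        by (auto simp: topspace_bounded_refinement)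
      then show ?thesis
        using closedin_lcs_avoid[OF lcs_bounded_refinement D(1) _ f(2)] by metis
    qed
    then obtain U where U: "\<And>f. f \<in> F \<Longrightarrow> - f \<notin> D \<Longrightarrow> zero_nhd ?W (U f)"
        "\<And>f u. f \<in> F \<Longrightarrow> - f \<notin> D \<Longrightarrow> u \<in> U f \<Longrightarrow> - f + u \<notin> D"
      by metis
    \<comment> \<open>The factor \<open>topspace ?W\<close> covers the empty family, whose bare
      intersection would be the whole ambient type.\<close>
    have "zero_nhd ?W (topspace ?W \<inter> \<Inter>(U ` F'))" if "finite F'" "F' \<subseteq> {f \<in> F. - f \<notin> D}" for F'
      using that
    proof (induction F' rule: finite_induct)
      case empty
      show ?case
        using complex_vector.subspace_0[OF lcs_subspace[OF lcs_bounded_refinement]]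
        by (auto simp: zero_nhd_def)
    next
      case (insert f F')
      then have "zero_nhd ?W (U f \<inter> (topspace ?W \<inter> \<Inter>(U ` F')))"
        by (intro zero_nhd_Int[of _ "U f"] U(1)) auto
      then show ?case by (simp add: Int_left_commute Int_assoc)
    qed
    then have "zero_nhd ?W (topspace ?W \<inter> \<Inter>(U ` {f \<in> F. - f \<notin> D}))"
      using F(1) by simp
    then obtain N where N: "zero_nhd X N" "N \<inter> ?A \<subseteq> topspace ?W \<inter> \<Inter>(U ` {f \<in> F. - f \<notin> D})"
      using zero_nhd_bounded_refinement_Int[OF _ A2] by meson
    have "{x \<in> topspace X. 2 *\<^sub>C x \<in> N} \<inter> A \<subseteq> D"
    proof
      fix a assume a: "a \<in> {x \<in> topspace X. 2 *\<^sub>C x \<in> N} \<inter> A"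
      then obtain d f where df: "2 *\<^sub>C a = d + f" "d \<in> D" "f \<in> F" using F(3) by blast
      have "- f \<in> D"
      proof (rule ccontr)
        assume f: "- f \<notin> D"
        then have "2 *\<^sub>C a \<in> U f" using N a df by blast
        then have "- f + 2 *\<^sub>C a \<notin> D" using U(2) f df by blast
        then show False using df by simp
      qed
      then have "f \<in> D" using absconvex_uminus[OF D(2)] by fastforce
      then have "(1 / 2) *\<^sub>C 2 *\<^sub>C a \<in> D"
        unfolding df by (intro absconvex_midpoint D df)
      then show "a \<in> D" by (simp only: half_double)
    qed
    then show ?thesis using zero_nhd_double_vimage[OF X N(1)] by blast
  qed
  moreover have "D \<subseteq> topspace X"
    using closedin_subset[OF D(1)] by (simp add: topspace_bounded_refinement)
  ultimately show "zero_nhd ?W D"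
    unfolding zero_nhd_bounded_refinement using D(2) by (intro conjI exI[of _ D]) simp_all
qed

text \<open>The coarsest pseudosaturated refinement is the infimum of all of them.\<close>

lemma coarsest_pseudosaturated:
  "\<exists>Y. pseudosaturated Y \<and> finer_topology Y X \<and>
     (\<forall>Z. pseudosaturated Z \<and> finer_topology Z X \<longrightarrow> finer_topology Z Y)"
proof -
  define \<Phi> where "\<Phi> U \<longleftrightarrow> (\<forall>Z. pseudosaturated Z \<and> finer_topology Z X \<longrightarrow> zero_nhd Z U)" for U
  define B where "B = {U. U \<subseteq> topspace X \<and> absconvex U \<and> \<Phi> U}"
  let ?Y = "nhd_topology (topspace X) B"
  note W = pseudosaturated_bounded_refinement finer_bounded_refinement
  have top: "topspace Z = topspace X" if "finer_topology Z X" for Z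
    using that by (rule finer_topology_topspace)
  have 1: "\<Phi> (U \<inter> U')" if "\<Phi> U" "\<Phi> U'" for U U'
    using that by (simp add: \<Phi>_def zero_nhd_Int)
  have 2: "\<Phi> {x \<in> topspace X. 2 *\<^sub>C x \<in> U}" if U: "\<Phi> U" for U
    unfolding \<Phi>_def
  proof (intro allI impI)
    fix Z assume Z: "pseudosaturated Z \<and> finer_topology Z X"
    then have "zero_nhd Z {x \<in> topspace Z. 2 *\<^sub>C x \<in> U}"
      using U by (intro zero_nhd_double_vimage) (simp_all add: \<Phi>_def pseudosaturated_def)
    then show "zero_nhd Z {x \<in> topspace X. 2 *\<^sub>C x \<in> U}"
      using top Z by simp
  qed
  \<comment> \<open>The bounded refinement is itself one of the \<open>Z\<close> quantified over in
    \<open>\<Phi>\<close>. Thus \<open>\<Phi>\<close> is not vacuous, and absorption is inherited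
    from that space.\<close>
  have 3: "\<exists>r>0. complex_of_real r *\<^sub>C x \<in> U"
    if "\<Phi> U" "absconvex U" "U \<subseteq> topspace X" and x: "x \<in> topspace X" for U x
  proof (rule zero_nhd_absorbing[OF lcs_bounded_refinement])
    show "zero_nhd (bounded_refinement X) U" using that W by (auto simp: \<Phi>_def)
  qed (use x in \<open>simp add: topspace_bounded_refinement\<close>)
  have 4: "\<Phi> U" if "zero_nhd X U" "absconvex U" for U
    using that by (auto simp: \<Phi>_def finer_topology_zero_nhd)
  interpret zero_base "topspace X" B
    unfolding B_def by (rule finer_topology_zero_base(1)[where \<Phi> = \<Phi>, OF X 1 2 3 4])
  have YX: "finer_topology ?Y X"
    unfolding B_def by (rule finer_topology_zero_base(2)[where \<Phi> = \<Phi>, OF X 1 2 3 4])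
  have ZY: "finer_topology Z ?Y" if Z: "pseudosaturated Z" "finer_topology Z X" for Z
  proof (rule finer_topology_lcsI[OF _ locally_convex_space_nhd])
    show lZ: "locally_convex_space Z" using Z by (simp add: pseudosaturated_def)
    show "topspace Z = topspace ?Y" using top Z by simp
    fix U assume "zero_nhd ?Y U"
    then obtain U' where U': "U' \<in> B" "U' \<subseteq> U" "U \<subseteq> topspace X" by (auto simp: zero_nhd_iff)
    then have "zero_nhd Z U'" using Z by (auto simp: B_def \<Phi>_def)
    then show "zero_nhd Z U"
      using U'(2,3) top[OF Z(2)] unfolding zero_nhd_def by (metis order_trans)
  qed
  have "pseudosaturated ?Y"
    unfolding pseudosaturated_def
  proof (intro conjI allI impI locally_convex_space_nhd)
    fix D assume D: "closedin ?Y D \<and> convex D \<and> balanced D \<and> capacious ?Y D"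
    \<comment> \<open>Closedness and capaciousness pass from \<open>?Y\<close> to every finer
      \<open>Z\<close>, so the pseudosaturation of each \<open>Z\<close> applies to the same
      \<open>D\<close>.\<close>
    have "zero_nhd Z D" if Z: "pseudosaturated Z" "finer_topology Z X" for Z
      using Z D finer_topology_closedin[OF ZY[OF Z]] capacious_finer[OF ZY[OF Z]]
      by (auto simp: pseudosaturated_def)
    then have "D \<in> B"
      using D closedin_subset[of ?Y D, unfolded topspace_nhd]
      by (simp add: B_def \<Phi>_def absconvex_def)
    then show "zero_nhd ?Y D" unfolding zero_nhd_iff using sub by blast
  qed
  then show ?thesis using YX ZY by blast
qed

text \<open>Two coarsest refinements refine each other and hence coincide, so the definite
  description denotes the space found in \<open>coarsest_pseudosaturated\<close>.\<close>

lemma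
  shows pseudosaturated_pseudosaturation: "pseudosaturated (pseudosaturation X)"
    and finer_pseudosaturation: "finer_topology (pseudosaturation X) X"
    and finer_than_pseudosaturation:
      "\<And>Z. pseudosaturated Z \<Longrightarrow> finer_topology Z X \<Longrightarrow> finer_topology Z (pseudosaturation X)"
proof -
  define P where "P Y \<longleftrightarrow> pseudosaturated Y \<and> finer_topology Y X \<and>
     (\<forall>Z. pseudosaturated Z \<and> finer_topology Z X \<longrightarrow> finer_topology Z Y)" for Y
  obtain Y where Y: "P Y"
    using coarsest_pseudosaturated unfolding P_def by blast
  have "pseudosaturation X = (THE Y. P Y)"
    by (simp add: pseudosaturation_def P_def)
  also have "\<dots> = Y"
  proof (rule the_equality)
    show "P Y" by (rule Y)
    fix Z assume "P Z"
    then show "Z = Y" using Y by (intro finer_topology_antisym) (simp_all add: P_def)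
  qed
  finally have "P (pseudosaturation X)" using Y by simp
  then show "pseudosaturated (pseudosaturation X)" "finer_topology (pseudosaturation X) X"
    "\<And>Z. pseudosaturated Z \<Longrightarrow> finer_topology Z X \<Longrightarrow> finer_topology Z (pseudosaturation X)"
    by (simp_all add: P_def)
qed

lemma lcs_pseudosaturation: "locally_convex_space (pseudosaturation X)"
  using pseudosaturated_pseudosaturation by (simp add: pseudosaturated_def)

lemma topspace_pseudosaturation: "topspace (pseudosaturation X) = topspace X"
  using finer_pseudosaturation by (rule finer_topology_topspace)

lemma bounded_refinement_finer_pseudosaturation:
  "finer_topology (bounded_refinement X) (pseudosaturation X)"
  by (rule finer_than_pseudosaturation[OF pseudosaturated_bounded_refinement finer_bounded_refinement])

end

text \<open>The finest locally convex topology on the target that is coarser than the bounded refinement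
  and keeps the map continuous turns out to be pseudosaturated, so minimality of the
  pseudosaturation applies to it.\<close>

lemma continuous_map_pseudosaturation:
  assumes X: "locally_convex_space X" and X': "locally_convex_space X'"
    and \<phi>: "linear_on (topspace X) \<phi>" "continuous_map X X' \<phi>"
  shows "continuous_map (pseudosaturation X) (pseudosaturation X') \<phi>"
proof -
  let ?Y = "pseudosaturation X" and ?W = "bounded_refinement X'"
  note Y = lcs_pseudosaturation[OF X] and W = lcs_bounded_refinement[OF X']
  note topY = topspace_pseudosaturation[OF X] and topW = topspace_bounded_refinement[OF X']
  note V = lcs_subspace[OF X]
  have \<phi>_in: "\<phi> x \<in> topspace X'" if "x \<in> topspace X" for x
    using continuous_map_image_subset_topspace[OF \<phi>(2)] that by auto
  have \<phi>_scale: "\<phi> (c *\<^sub>C x) = c *\<^sub>C \<phi> x" if "x \<in> topspace X" for c x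
    using \<phi>(1) that by (simp add: linear_on_def)
  have \<phi>_add: "\<phi> (x + y) = \<phi> x + \<phi> y" if "x \<in> topspace X" "y \<in> topspace X" for x y
    using \<phi>(1) that by (simp add: linear_on_def)
  have \<phi>_diff: "\<phi> (x - y) = \<phi> x - \<phi> y" if "x \<in> topspace X" "y \<in> topspace X" for x y
    using \<phi>_add[of "x - y" y] that complex_vector.subspace_diff[OF V] by simp
  \<comment> \<open>The clause on \<open>?W\<close> makes the sets absorbing and keeps the new
    topology coarser than the bounded refinement; the clause on \<open>?Y\<close> is continuity of
    \<open>\<phi>\<close> at zero.\<close>
  define \<Phi> where "\<Phi> U \<longleftrightarrow> zero_nhd ?W U \<and> zero_nhd ?Y {x \<in> topspace X. \<phi> x \<in> U}" for U
  define B where "B = {U. U \<subseteq> topspace X' \<and> absconvex U \<and> \<Phi> U}"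
  let ?N = "nhd_topology (topspace X') B"
  have 1: "\<Phi> (U \<inter> U')" if "\<Phi> U" "\<Phi> U'" for U U'
  proof -
    have "{x \<in> topspace X. \<phi> x \<in> U \<inter> U'} = {x \<in> topspace X. \<phi> x \<in> U} \<inter> {x \<in> topspace X. \<phi> x \<in> U'}"
      by auto
    then show ?thesis using that unfolding \<Phi>_def by (simp add: zero_nhd_Int)
  qed
  have 2: "\<Phi> {x \<in> topspace X'. 2 *\<^sub>C x \<in> U}" if "\<Phi> U" for U
  proof -
    have "{x \<in> topspace X. \<phi> x \<in> {x \<in> topspace X'. 2 *\<^sub>C x \<in> U}}
        = {x \<in> topspace ?Y. 2 *\<^sub>C x \<in> {x \<in> topspace X. \<phi> x \<in> U}}"
      using \<phi>_in \<phi>_scale complex_vector.subspace_scale[OF V] by (auto simp: topY)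
    then show ?thesis
      using that zero_nhd_double_vimage[OF Y, of "{x \<in> topspace X. \<phi> x \<in> U}"]
        zero_nhd_double_vimage[OF W, of U]
      unfolding \<Phi>_def topW by simp
  qed
  have 3: "\<exists>r>0. complex_of_real r *\<^sub>C x \<in> U"
    if "\<Phi> U" "absconvex U" "U \<subseteq> topspace X'" "x \<in> topspace X'" for U x
    using zero_nhd_absorbing[OF W] that unfolding \<Phi>_def topW by simp
  have 4: "\<Phi> U" if "zero_nhd X' U" "absconvex U" for U
    unfolding \<Phi>_def
    using finer_topology_zero_nhd[OF finer_bounded_refinement[OF X'] that(1)]
      finer_topology_zero_nhd[OF finer_pseudosaturation[OF X] linear_continuous_mapD[OF X \<phi> that(1)]]
    by (rule conjI)
  interpret N: zero_base "topspace X'" B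
    unfolding B_def by (rule finer_topology_zero_base(1)[where \<Phi> = \<Phi>, OF X' 1 2 3 4])
  have NX': "finer_topology ?N X'"
    unfolding B_def by (rule finer_topology_zero_base(2)[where \<Phi> = \<Phi>, OF X' 1 2 3 4])
  note lN = N.locally_convex_space_nhd
  have nhd: "zero_nhd ?W U \<and> zero_nhd ?Y {x \<in> topspace X. \<phi> x \<in> U}" if U: "zero_nhd ?N U" for U
  proof -
    obtain U' where U': "U' \<in> B" "U' \<subseteq> U" "U \<subseteq> topspace X'"
      using U unfolding N.zero_nhd_iff by blast
    then have "\<Phi> U'" by (simp add: B_def)
    moreover have "{x \<in> topspace X. \<phi> x \<in> U'} \<subseteq> {x \<in> topspace X. \<phi> x \<in> U}"
      using U' by blast
    ultimately show ?thesis
      using U'(2,3) zero_nhd_mono[of ?W U' U]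
        zero_nhd_mono[of ?Y "{x \<in> topspace X. \<phi> x \<in> U'}" "{x \<in> topspace X. \<phi> x \<in> U}"]
      unfolding \<Phi>_def topY topW by simp
  qed
  have WN: "finer_topology ?W ?N"
    by (rule finer_topology_lcsI[OF W lN]) (simp_all add: topW nhd)
  have cont: "continuous_map ?Y ?N \<phi>"
  proof (rule linear_continuous_mapI[OF Y lN])
    show "linear_on (topspace ?Y) \<phi>" using \<phi>(1) by (simp add: topY)
    show "\<phi> x \<in> topspace ?N" if "x \<in> topspace ?Y" for x
      using that \<phi>_in by (simp add: topY)
    show "zero_nhd ?Y {x \<in> topspace ?Y. \<phi> x \<in> U}" if "zero_nhd ?N U" for U
      using nhd[OF that] by (simp add: topY)
  qed
  have "pseudosaturated ?N"
    unfolding pseudosaturated_def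
  proof (intro conjI allI impI lN)
    fix D assume D: "closedin ?N D \<and> convex D \<and> balanced D \<and> capacious ?N D"
    then have D': "closedin ?N D" "absconvex D" "capacious ?N D" by (auto simp: absconvex_def)
    have "zero_nhd ?W D"
      using pseudosaturated_bounded_refinement[OF X'] D finer_topology_closedin[OF WN D'(1)]
        capacious_finer[OF WN D'(3)]
      by (simp add: pseudosaturated_def)
    \<comment> \<open>\<open>E\<close> is the preimage of \<open>2 D\<close> rather than of
      \<open>D\<close>: points whose images lie in one translate of \<open>D\<close> have images
      differing by an element of \<open>D - D\<close>, which is contained in
      \<open>2 D\<close>.\<close>
    moreover define E where "E = {x \<in> topspace ?Y. \<phi> ((1 / 2) *\<^sub>C x) \<in> D}"
    have half_in: "(1 / 2) *\<^sub>C x \<in> topspace X" if "x \<in> topspace X" for x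
      using that by (rule complex_vector.subspace_scale[OF V])
    have "closedin ?Y E"
      unfolding E_def
    proof (rule closedin_continuous_map_preimage[OF _ D'(1)])
      have "continuous_map ?Y ?Y (\<lambda>x. (1 / 2) *\<^sub>C x)"
        by (rule lcs_continuous_scale[OF Y]) simp_all
      from continuous_map_compose[OF this cont]
      show "continuous_map ?Y ?N (\<lambda>x. \<phi> ((1 / 2) *\<^sub>C x))" by (simp add: o_def)
    qed
    moreover have "absconvex E"
    proof (rule absconvexI)
      fix x y and a b :: complex
      assume *: "x \<in> E" "y \<in> E" "norm a + norm b \<le> 1"
      then have xy: "x \<in> topspace X" "y \<in> topspace X" by (simp_all add: E_def topY)
      have "\<phi> ((1 / 2) *\<^sub>C (a *\<^sub>C x + b *\<^sub>C y)) = a *\<^sub>C \<phi> ((1 / 2) *\<^sub>C x) + b *\<^sub>C \<phi> ((1 / 2) *\<^sub>C y)"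
        using xy complex_vector.subspace_scale[OF V] complex_vector.subspace_add[OF V]
        by (simp add: \<phi>_scale \<phi>_add scaleC_add_right)
      also have "\<dots> \<in> D"
        using * by (intro absconvexD[OF D'(2)]) (simp_all add: E_def)
      finally show "a *\<^sub>C x + b *\<^sub>C y \<in> E"
        using xy complex_vector.subspace_scale[OF V] complex_vector.subspace_add[OF V]
        by (simp add: E_def topY)
    qed
    moreover have "capacious ?Y E"
      unfolding capacious_def
    proof (intro conjI allI impI)
      show "E \<subseteq> topspace ?Y" by (auto simp: E_def)
      fix A assume A: "totally_bounded_in ?Y A"
      then have AX: "A \<subseteq> topspace X" unfolding topY[symmetric] by (rule totally_bounded_in_topspace)
      have "linear_on (topspace ?Y) \<phi>" using \<phi>(1) by (simp add: topY)
      then have "totally_bounded_in ?N (\<phi> ` A)"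
        by (rule totally_bounded_in_image[OF Y lN _ cont A])
      then obtain F where F: "finite F" "\<phi> ` A \<subseteq> {d + f |d f. d \<in> D \<and> f \<in> F}"
        using D'(3) unfolding capacious_def by blast
      have "\<exists>f\<in>F. \<phi> a - f \<in> D" if a: "a \<in> A" for a
      proof -
        have "\<phi> a \<in> {d + f |d f. d \<in> D \<and> f \<in> F}" using a F(2) by (intro subsetD[OF F(2)] imageI)
        then obtain d f where "\<phi> a = d + f" "d \<in> D" "f \<in> F" by auto
        then show ?thesis by (intro bexI[of _ f]) simp_all
      qed
      \<comment> \<open>The elements of \<open>F\<close> live in \<open>X'\<close> and may lie
        outside the image of \<open>\<phi>\<close>, so they cannot be pulled back. One point of
        \<open>A\<close> per cell serves as centre instead.\<close>
      then obtain G where G: "finite G" "G \<subseteq> A" "\<forall>a\<in>A. \<exists>g\<in>G. \<exists>f\<in>F. \<phi> a - f \<in> D \<and> \<phi> g - f \<in> D"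
        using finite_inner_cover[OF F(1), of A "\<lambda>a f. \<phi> a - f \<in> D"] by auto
      have "A \<subseteq> {e + g |e g. e \<in> E \<and> g \<in> G}"
      proof
        fix a assume a: "a \<in> A"
        obtain g f where g: "g \<in> G" "\<phi> a - f \<in> D" "\<phi> g - f \<in> D" using G(3) a by auto
        have ag: "a \<in> topspace X" "g \<in> topspace X" using a g(1) G(2) AX by auto
        have "(1 / 2) *\<^sub>C ((\<phi> a - f) + - (\<phi> g - f)) \<in> D"
          by (intro absconvex_midpoint[OF D'(2)] g absconvex_uminus[OF D'(2)])
        then have "\<phi> ((1 / 2) *\<^sub>C (a - g)) \<in> D"
          using ag complex_vector.subspace_diff[OF V] by (simp add: \<phi>_scale \<phi>_diff)
        then have "a - g \<in> E"
          using ag complex_vector.subspace_diff[OF V] by (simp add: E_def topY)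
        then show "a \<in> {e + g |e g. e \<in> E \<and> g \<in> G}"
          using g(1) by (intro CollectI exI[of _ "a - g"] exI[of _ g]) simp
      qed
      then show "\<exists>F. finite F \<and> F \<subseteq> topspace ?Y \<and> A \<subseteq> {d + f |d f. d \<in> E \<and> f \<in> F}"
        using G AX by (intro exI[of _ G]) (simp add: topY)
    qed
    ultimately have "zero_nhd ?Y E"
      using pseudosaturated_pseudosaturation[OF X] by (simp add: pseudosaturated_def absconvex_def)
    \<comment> \<open>Halving a zero neighbourhood undoes the factor 2 built into
      \<open>E\<close>.\<close>
    from zero_nhd_double_vimage[OF Y this]
    have "zero_nhd ?Y {x \<in> topspace ?Y. 2 *\<^sub>C x \<in> E}" .
    moreover have "{x \<in> topspace ?Y. 2 *\<^sub>C x \<in> E} = {x \<in> topspace X. \<phi> x \<in> D}"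
      unfolding E_def topY using complex_vector.subspace_scale[OF V] by (auto simp: half_double)
    ultimately have "\<Phi> D"
      using \<open>zero_nhd ?W D\<close> by (simp add: \<Phi>_def)
    then have "D \<in> B"
      using D'(2) closedin_subset[OF D'(1), unfolded N.topspace_nhd] by (simp add: B_def)
    then show "zero_nhd ?N D" unfolding N.zero_nhd_iff using N.sub[of D] by auto
  qed
  then have NY': "finer_topology ?N (pseudosaturation X')"
    using NX' by (rule finer_than_pseudosaturation[OF X'])
  show ?thesis
  proof (rule linear_continuous_mapI[OF Y lcs_pseudosaturation[OF X']])
    show "linear_on (topspace ?Y) \<phi>" using \<phi>(1) by (simp add: topY)
    show "\<phi> x \<in> topspace (pseudosaturation X')" if "x \<in> topspace ?Y" for x
      using that \<phi>_in by (simp add: topY topspace_pseudosaturation[OF X'])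
    show "zero_nhd ?Y {x \<in> topspace ?Y. \<phi> x \<in> U}" if "zero_nhd (pseudosaturation X') U" for U
      using nhd[OF finer_topology_zero_nhd[OF NY' that]] by (simp add: topY)
  qed
qed

section \<open>Operator spaces\<close>

text \<open>Finitely many centres are absorbed at one common scale \<open>r\<close>, and
  \<open>r \<le> 1\<close> keeps the scaled remainders \<open>a - f\<close> in \<open>U'\<close>.
  Both terms have their doubles in \<open>U\<close>, so their sum is in \<open>U\<close>.\<close>

lemma totally_bounded_in_absorbed:
  assumes X: "locally_convex_space X" and A: "totally_bounded_in X A"
    and U: "zero_nhd X U" "absconvex U"
  shows "\<exists>r>0. \<forall>a\<in>A. complex_of_real r *\<^sub>C a \<in> U"
proof -
  define U' where "U' = {x \<in> topspace X. 2 *\<^sub>C x \<in> U}"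
  have U': "zero_nhd X U'" "absconvex U'"
    unfolding U'_def
    by (rule zero_nhd_double_vimage[OF X U(1)], rule absconvex_double_vimage[OF U(2) lcs_subspace[OF X]])
  obtain F where F: "finite F" "F \<subseteq> A" "\<forall>a\<in>A. \<exists>f\<in>F. a - f \<in> U'"
    using totally_bounded_inD[OF X A U'(1)] by (elim exE conjE)
  have FX: "F \<subseteq> topspace X"
    using F(2) totally_bounded_in_topspace[OF A] by (rule subset_trans)
  have "\<exists>r>0. r \<le> 1 \<and> (\<forall>f\<in>F. complex_of_real r *\<^sub>C f \<in> U')"
    using F(1) FX
  proof (induction F rule: finite_induct)
    case empty
    show ?case by (intro exI[of _ 1]) simp
  next
    case (insert f F)
    then obtain r where r: "r > 0" "r \<le> 1" "\<forall>f\<in>F. complex_of_real r *\<^sub>C f \<in> U'" by auto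
    obtain s where s: "s > 0" "complex_of_real s *\<^sub>C f \<in> U'"
      using zero_nhd_absorbing[OF X U'(1), of f] insert by auto
    define m where "m = min r s"
    have m: "0 < m" "m \<le> r" "m \<le> s" using r s by (simp_all add: m_def)
    have scale: "complex_of_real m *\<^sub>C x \<in> U'" if "complex_of_real t *\<^sub>C x \<in> U'" "m \<le> t" for t x
    proof -
      have t: "0 < t" using that(2) m by linarith
      have "norm (complex_of_real (m / t)) \<le> 1"
        unfolding norm_of_real using m t that(2) by simp
      from absconvex_scaleC[OF U'(2) that(1) this] show ?thesis
        using t by (simp add: scaleC_scaleC)
    qed
    have "complex_of_real m *\<^sub>C f \<in> U'" using s(2) m(3) by (rule scale)
    moreover have "\<forall>f\<in>F. complex_of_real m *\<^sub>C f \<in> U'"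
    proof
      fix f assume "f \<in> F"
      with r(3) have "complex_of_real r *\<^sub>C f \<in> U'" by blast
      then show "complex_of_real m *\<^sub>C f \<in> U'" using m(2) by (rule scale)
    qed
    moreover have "m \<le> 1" using m r by linarith
    ultimately show ?case using m(1) by (intro exI[of _ m]) simp
  qed
  then obtain r where r: "r > 0" "r \<le> 1" "\<forall>f\<in>F. complex_of_real r *\<^sub>C f \<in> U'" by auto
  have "complex_of_real r *\<^sub>C a \<in> U" if a: "a \<in> A" for a
  proof -
    obtain f where f: "f \<in> F" "a - f \<in> U'" using F(3) a by auto
    have "complex_of_real r *\<^sub>C (a - f) \<in> U'"
      by (rule absconvex_scaleC[OF U'(2) f(2)]) (use r in simp)
    then have "complex_of_real r *\<^sub>C (a - f) + complex_of_real r *\<^sub>C f \<in> U"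
      using r(3) f(1) by (intro absconvex_half_add[OF U(2)]) (auto simp: U'_def)
    then show ?thesis by (simp flip: scaleC_add_right)
  qed
  then show ?thesis using r(1) by auto
qed

lemma zero_in_continuous_operators:
  assumes "locally_convex_space Y"
  shows "0 \<in> continuous_operators X Y"
  using complex_vector.subspace_0[OF lcs_subspace[OF assms]]
  by (simp add: continuous_operators_def linear_on_def zero_fun_def)

lemma subspace_continuous_operators:
  assumes Y: "locally_convex_space Y"
  shows "complex_vector.subspace (continuous_operators X Y)"
  unfolding complex_vector.subspace_def
proof (intro conjI ballI allI)
  show "0 \<in> continuous_operators X Y" by (rule zero_in_continuous_operators[OF Y])
next
  fix \<phi> \<psi> assume "\<phi> \<in> continuous_operators X Y" "\<psi> \<in> continuous_operators X Y"
  then show "\<phi> + \<psi> \<in> continuous_operators X Y"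
    using lcs_continuous_add[OF Y, of X \<phi> \<psi>]
    by (simp add: continuous_operators_def linear_on_def plus_fun_def scaleC_add_right algebra_simps)
next
  fix c \<phi> assume \<phi>: "\<phi> \<in> continuous_operators X Y"
  have "continuous_map X Y (\<lambda>x. c *\<^sub>C \<phi> x)"
    by (rule lcs_continuous_scale[OF Y]) (use \<phi> in \<open>simp_all add: continuous_operators_def\<close>)
  then show "c *\<^sub>C \<phi> \<in> continuous_operators X Y"
    using \<phi> by (simp add: continuous_operators_def linear_on_def scaleC_fun_def scaleC_add_right)
qed

lemma operator_nhd_zero:
  "operator_nhd X Y 0 K U = {\<psi> \<in> continuous_operators X Y. \<forall>x\<in>K. \<psi> x \<in> U}"
  by (simp add: operator_nhd_def)

context
  fixes X :: "'v::complex_vector topology" and Y :: "'w::complex_vector topology"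
  assumes Y: "locally_convex_space Y"
begin

text \<open>Absorption rests on the image of \<open>K\<close> under a continuous operator being
  compact and therefore absorbed by \<open>U\<close>. Separation uses one-point sets: owing to the
  extension by zero, a nonzero operator is nonzero at some point of
  \<open>topspace X\<close>.\<close>

lemma zero_base_operators:
  "zero_base (continuous_operators X Y)
     {operator_nhd X Y 0 K U |K U. compactin X K \<and> zero_nhd Y U \<and> absconvex U}"
  (is "zero_base ?C ?B")
proof
  interpret Y: zero_base "topspace Y" "{U. zero_nhd Y U \<and> absconvex U}"
    by (rule zero_base_lcs[OF Y])
  show "complex_vector.subspace ?C" by (rule subspace_continuous_operators[OF Y])
  show "?B \<noteq> {}" using Y.nonempty compactin_empty[of X] by blast
  fix N assume "N \<in> ?B"
  then obtain K U where KU: "N = operator_nhd X Y 0 K U" "compactin X K" "zero_nhd Y U" "absconvex U"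
    by auto
  show "N \<subseteq> ?C" by (auto simp: KU operator_nhd_def)
  show "absconvex N"
  proof (rule absconvexI)
    fix \<phi> \<psi> and a b :: complex
    assume *: "\<phi> \<in> N" "\<psi> \<in> N" "norm a + norm b \<le> 1"
    then have "a *\<^sub>C \<phi> + b *\<^sub>C \<psi> \<in> ?C"
      using subspace_continuous_operators[OF Y, of X]
      by (simp add: KU operator_nhd_def complex_vector.subspace_add complex_vector.subspace_scale)
    moreover have "a *\<^sub>C \<phi> x + b *\<^sub>C \<psi> x \<in> U" if "x \<in> K" for x
      by (rule absconvexD[OF KU(4)]) (use * that in \<open>simp_all add: KU operator_nhd_zero\<close>)
    ultimately show "a *\<^sub>C \<phi> + b *\<^sub>C \<psi> \<in> N"
      by (simp add: KU(1) operator_nhd_zero scaleC_fun_def plus_fun_def)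
  qed
  show "\<exists>r>0. complex_of_real r *\<^sub>C \<phi> \<in> N" if \<phi>: "\<phi> \<in> ?C" for \<phi>
  proof -
    have "compactin Y (\<phi> ` K)"
      by (rule image_compactin[OF KU(2)]) (use \<phi> in \<open>simp add: continuous_operators_def\<close>)
    from totally_bounded_in_absorbed[OF Y totally_bounded_in_compactin[OF Y this] KU(3,4)]
    obtain r where r: "r > 0" "\<forall>x\<in>K. complex_of_real r *\<^sub>C \<phi> x \<in> U" by auto
    moreover have "complex_of_real r *\<^sub>C \<phi> \<in> ?C"
      using \<phi> subspace_continuous_operators[OF Y, of X] by (simp add: complex_vector.subspace_scale)
    ultimately show ?thesis
      by (intro exI[of _ r]) (simp add: KU(1) operator_nhd_zero scaleC_fun_def)
  qed
  show "\<exists>N''\<in>?B. N'' \<subseteq> N \<inter> N'" if "N' \<in> ?B" for N'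
  proof -
    obtain K' U' where KU': "N' = operator_nhd X Y 0 K' U'" "compactin X K'" "zero_nhd Y U'" "absconvex U'"
      using \<open>N' \<in> ?B\<close> by auto
    have "operator_nhd X Y 0 (K \<union> K') (U \<inter> U') \<in> ?B"
      using KU KU' compactin_Un[of X K K'] zero_nhd_Int[of Y U U'] absconvex_Int[of U U'] by blast
    moreover have "operator_nhd X Y 0 (K \<union> K') (U \<inter> U') \<subseteq> N \<inter> N'"
      by (auto simp: KU KU' operator_nhd_def)
    ultimately show ?thesis by (rule bexI[rotated])
  qed
  show "\<exists>N'\<in>?B. \<forall>\<phi>\<in>N'. 2 *\<^sub>C \<phi> \<in> N"
  proof (intro bexI ballI)
    show "operator_nhd X Y 0 K {y \<in> topspace Y. 2 *\<^sub>C y \<in> U} \<in> ?B"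
      using KU(2) zero_nhd_double_vimage[OF Y KU(3)] absconvex_double_vimage[OF KU(4) lcs_subspace[OF Y]]
      by blast
    fix \<phi> assume \<phi>: "\<phi> \<in> operator_nhd X Y 0 K {y \<in> topspace Y. 2 *\<^sub>C y \<in> U}"
    have "2 *\<^sub>C \<phi> \<in> ?C"
      using complex_vector.subspace_scale[OF subspace_continuous_operators[OF Y, of X]] \<phi>
      by (simp add: operator_nhd_zero)
    moreover have "(2 *\<^sub>C \<phi>) x \<in> U" if "x \<in> K" for x
      using \<phi> that by (simp add: operator_nhd_zero scaleC_fun_def)
    ultimately show "2 *\<^sub>C \<phi> \<in> N"
      by (simp add: KU(1) operator_nhd_zero)
  qed
next
  fix \<phi> assume \<phi>: "\<phi> \<in> ?C" "\<phi> \<noteq> 0"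
  then obtain x where x: "\<phi> x \<noteq> 0" by (auto simp: fun_eq_iff)
  then have "x \<in> topspace X" using \<phi> by (auto simp: continuous_operators_def)
  then have "\<phi> x \<in> topspace Y"
    using \<phi> continuous_map_image_subset_topspace[of X Y \<phi>] by (auto simp: continuous_operators_def)
  then obtain U where U: "zero_nhd Y U" "absconvex U" "\<phi> x \<notin> U"
    using zero_base.sep[OF zero_base_lcs[OF Y] _ x] by auto
  have "operator_nhd X Y 0 {x} U \<in> ?B"
    using U \<open>x \<in> topspace X\<close> by (intro CollectI exI[of _ "{x}"] exI[of _ U]) simp
  moreover have "\<phi> \<notin> operator_nhd X Y 0 {x} U"
    using U by (simp add: operator_nhd_zero)
  ultimately show "\<exists>N\<in>?B. \<phi> \<notin> N" by (rule bexI[rotated])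
qed

text \<open>Translation by \<open>\<phi>\<close> identifies the neighbourhoods of
  \<open>\<phi>\<close> in \<open>operator_open\<close> with those of zero, and each
  \<open>U\<close> can be shrunk to an absolutely convex one.\<close>

lemma operator_space_eq_nhd_topology:
  "operator_space X Y = nhd_topology (continuous_operators X Y)
     {operator_nhd X Y 0 K U |K U. compactin X K \<and> zero_nhd Y U \<and> absconvex U}"
  (is "_ = nhd_topology ?C ?B")
  unfolding topology_eq
proof (intro allI iffI)
  interpret zero_base ?C ?B by (rule zero_base_operators)
  note C = subspace_continuous_operators[OF Y, of X]
  fix W
  {
    assume "openin (operator_space X Y) W"
    then have W: "operator_open X Y W" by (simp add: openin_operator_space)
    show "openin (nhd_topology ?C ?B) W"
      unfolding openin_nhd
    proof (intro conjI ballI)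
      show "W \<subseteq> ?C" using W by (simp add: operator_open_def)
      fix \<phi> assume \<phi>: "\<phi> \<in> W"
      then obtain K U where KU: "compactin X K" "zero_nhd Y U" "operator_nhd X Y \<phi> K U \<subseteq> W"
        using W unfolding operator_open_def by blast
      obtain U' where U': "zero_nhd Y U'" "absconvex U'" "U' \<subseteq> U"
        using zero_nhd_absconvex[OF Y KU(2)] by blast
      have "\<phi> + u \<in> W" if u: "u \<in> operator_nhd X Y 0 K U'" for u
      proof (rule subsetD[OF KU(3)])
        have "\<phi> \<in> ?C" using \<phi> \<open>W \<subseteq> ?C\<close> by blast
        then show "\<phi> + u \<in> operator_nhd X Y \<phi> K U"
          using u U'(3) complex_vector.subspace_add[OF C] by (auto simp: operator_nhd_def)
      qed
      then show "\<exists>N\<in>?B. \<forall>u\<in>N. \<phi> + u \<in> W"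
        using KU(1) U'(1,2) by (intro bexI[of _ "operator_nhd X Y 0 K U'"]) auto
    qed
  next
    assume "openin (nhd_topology ?C ?B) W"
    then have W: "W \<subseteq> ?C" "\<forall>\<phi>\<in>W. \<exists>N\<in>?B. \<forall>u\<in>N. \<phi> + u \<in> W" unfolding openin_nhd by blast+
    show "openin (operator_space X Y) W"
      unfolding openin_operator_space operator_open_def
    proof (intro conjI ballI W(1))
      fix \<phi> assume \<phi>: "\<phi> \<in> W"
      then obtain K U where KU: "compactin X K" "zero_nhd Y U" "\<forall>u\<in>operator_nhd X Y 0 K U. \<phi> + u \<in> W"
        using W(2) by blast
      have "operator_nhd X Y \<phi> K U \<subseteq> W"
      proof
        fix \<psi> assume \<psi>: "\<psi> \<in> operator_nhd X Y \<phi> K U"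
        have "\<phi> \<in> ?C" using \<phi> W(1) by blast
        then have "\<psi> - \<phi> \<in> operator_nhd X Y 0 K U"
          using \<psi> complex_vector.subspace_diff[OF C] by (simp add: operator_nhd_def)
        then have "\<phi> + (\<psi> - \<phi>) \<in> W" using KU(3) by blast
        then show "\<psi> \<in> W" by simp
      qed
      then show "\<exists>K U. compactin X K \<and> zero_nhd Y U \<and> operator_nhd X Y \<phi> K U \<subseteq> W"
        using KU(1,2) by blast
    qed
  }
qed

lemma lcs_operator_space: "locally_convex_space (operator_space X Y)"
  unfolding operator_space_eq_nhd_topology
  by (rule zero_base.locally_convex_space_nhd[OF zero_base_operators])

lemma topspace_operator_space: "topspace (operator_space X Y) = continuous_operators X Y"
  unfolding operator_space_eq_nhd_topology by (rule zero_base.topspace_nhd[OF zero_base_operators])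

lemma zero_nhd_operator_space:
  assumes "zero_nhd (operator_space X Y) N"
  obtains K U where "compactin X K" "zero_nhd Y U" "operator_nhd X Y 0 K U \<subseteq> N"
  using assms unfolding operator_space_eq_nhd_topology zero_base.zero_nhd_iff[OF zero_base_operators]
  by auto

end

section \<open>Total boundedness in operator spaces over a pseudosaturation\<close>

text \<open>For operators on the pseudosaturation of \<open>X\<close>, precompactness and convergence can be tested in
  the coarser topology of \<open>X\<close>: the values on a compact set form a totally bounded set, on which
  both topologies have the same neighbourhoods of zero.\<close>

context
  fixes X :: "'v::complex_vector topology" and Q :: "('v \<Rightarrow> 'v) set"
  assumes X: "locally_convex_space X"
    and Q: "Q \<subseteq> continuous_operators (pseudosaturation X) (pseudosaturation X)"
    and finite_approx: "\<And>K V. compactin (pseudosaturation X) K \<Longrightarrow> zero_nhd X V \<Longrightarrow>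
      \<exists>Q'. finite Q' \<and> Q' \<subseteq> continuous_operators (pseudosaturation X) (pseudosaturation X) \<and>
        (\<forall>q\<in>Q. \<exists>q'\<in>Q'. \<forall>f\<in>K. q f - q' f \<in> V)"
begin

text \<open>Up to an error in \<open>U\<close>, all values lie in the union of the images of
  \<open>K\<close> under the finitely many operators in \<open>Q'\<close>. These images are compact
  in the pseudosaturation, hence totally bounded in the coarser \<open>X\<close>.\<close>

lemma totally_bounded_in_values:
  assumes K: "compactin (pseudosaturation X) K"
  shows "totally_bounded_in X {q f |q f. q \<in> Q \<and> f \<in> K}" (is "totally_bounded_in X ?A")
proof (rule totally_bounded_inI[OF X])
  let ?Y = "pseudosaturation X"
  note topY = topspace_pseudosaturation[OF X] and Y = lcs_pseudosaturation[OF X]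
  have KX: "K \<subseteq> topspace X"
    using compactin_subset_topspace[OF K] by (simp add: topY)
  have mem: "q f \<in> topspace X" if "q \<in> continuous_operators ?Y ?Y" "f \<in> K" for q f
    using that KX continuous_map_image_subset_topspace[of ?Y ?Y q]
    by (auto simp: continuous_operators_def topY)
  show "?A \<subseteq> topspace X" using mem Q by blast
  fix N assume N: "zero_nhd X N"
  obtain U where U: "zero_nhd X U" "\<And>x y. x \<in> U \<Longrightarrow> y \<in> U \<Longrightarrow> x + y \<in> N"
    using zero_nhd_add[OF X N] by metis
  obtain Q' where Q': "finite Q'" "Q' \<subseteq> continuous_operators ?Y ?Y"
      "\<forall>q\<in>Q. \<exists>q'\<in>Q'. \<forall>f\<in>K. q f - q' f \<in> U"
    using finite_approx[OF K U(1)] by (elim exE conjE)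
  have "totally_bounded_in X (\<Union>q'\<in>Q''. q' ` K)" if "finite Q''" "Q'' \<subseteq> Q'" for Q''
    using that
  proof (induction Q'' rule: finite_induct)
    case empty
    show ?case by (rule totally_bounded_in_finite[OF X]) simp_all
  next
    case (insert q Q'')
    then have "continuous_map ?Y ?Y q" using Q'(2) by (auto simp: continuous_operators_def)
    then have "compactin ?Y (q ` K)" by (rule image_compactin[OF K])
    then have "totally_bounded_in X (q ` K)"
      by (intro totally_bounded_in_coarser[OF finer_pseudosaturation[OF X]]
          totally_bounded_in_compactin[OF Y])
    moreover have "totally_bounded_in X (\<Union>q'\<in>Q''. q' ` K)" using insert by simp
    ultimately show ?case unfolding UN_insert by (rule totally_bounded_in_Un[OF X])
  qed
  then have "totally_bounded_in X (\<Union>q'\<in>Q'. q' ` K)" using Q'(1) by simp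
  from totally_bounded_inD[OF X this U(1)]
  obtain F where F: "finite F" "F \<subseteq> (\<Union>q'\<in>Q'. q' ` K)" "\<forall>a\<in>(\<Union>q'\<in>Q'. q' ` K). \<exists>f\<in>F. a - f \<in> U"
    by (elim exE conjE)
  have "F \<subseteq> topspace X"
    using F(2) mem Q'(2) by blast
  moreover have "\<exists>g\<in>F. a - g \<in> N" if a: "a \<in> ?A" for a
  proof -
    obtain q f where qf: "a = q f" "q \<in> Q" "f \<in> K" using a by auto
    then obtain q' where q': "q' \<in> Q'" "q f - q' f \<in> U" using Q'(3) by blast
    then have "q' f \<in> (\<Union>q'\<in>Q'. q' ` K)" using qf by blast
    then obtain g where g: "g \<in> F" "q' f - g \<in> U" using F(3) by blast
    have "(q f - q' f) + (q' f - g) \<in> N" using q'(2) g(2) by (rule U(2))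
    then show ?thesis using g(1) qf(1) by (intro bexI[of _ g]) simp_all
  qed
  ultimately show "\<exists>F. finite F \<and> F \<subseteq> topspace X \<and> (\<forall>a\<in>?A. \<exists>f\<in>F. a - f \<in> N)"
    using F(1) by (intro exI[of _ F] conjI ballI)
qed

text \<open>Zero neighbourhoods of the pseudosaturation are zero neighbourhoods of the finer bounded
  refinement, whose definition supplies \<open>N\<close>.\<close>

lemma zero_nhd_pseudosaturation_Int:
  assumes "zero_nhd (pseudosaturation X) U" "totally_bounded_in X A"
  shows "\<exists>N. zero_nhd X N \<and> N \<inter> A \<subseteq> U"
  by (rule zero_nhd_bounded_refinement_Int[OF X finer_topology_zero_nhd[OF
        bounded_refinement_finer_pseudosaturation[OF X] assms(1)] assms(2)])

text \<open>On differences of values of \<open>Q\<close> a neighbourhood \<open>V\<close> from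
  \<open>X\<close> can replace \<open>U\<close>. The operators in \<open>Q'\<close> may have values
  outside \<open>?A\<close>, so \<open>finite_inner_cover\<close> first exchanges them for centres
  in \<open>Q\<close>; then \<open>q f - g f\<close> is such a difference.\<close>

lemma totally_bounded_in_operator_space:
  "totally_bounded_in (operator_space (pseudosaturation X) (pseudosaturation X)) Q"
proof -
  let ?Y = "pseudosaturation X"
  let ?O = "operator_space ?Y ?Y"
  note Y = lcs_pseudosaturation[OF X]
  note C = subspace_continuous_operators[OF Y, of ?Y]
  show ?thesis
  proof (rule totally_bounded_inI[OF lcs_operator_space[OF Y]])
    show "Q \<subseteq> topspace ?O" using Q by (simp add: topspace_operator_space[OF Y])
    fix N assume N: "zero_nhd ?O N"
    obtain K U where KU: "compactin ?Y K" "zero_nhd ?Y U" "operator_nhd ?Y ?Y 0 K U \<subseteq> N"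
      by (rule zero_nhd_operator_space[OF Y N])
    let ?A = "{q f |q f. q \<in> Q \<and> f \<in> K}"
    from zero_nhd_pseudosaturation_Int[OF KU(2) totally_bounded_in_diff[OF X totally_bounded_in_values[OF KU(1)]]]
    obtain V where V: "zero_nhd X V" "V \<inter> {a - b |a b. a \<in> ?A \<and> b \<in> ?A} \<subseteq> U"
      by (elim exE conjE)
    obtain V' where V': "zero_nhd X V'" "\<And>x y. x \<in> V' \<Longrightarrow> y \<in> V' \<Longrightarrow> x - y \<in> V"
      using zero_nhd_add[OF X V(1)] by metis
    obtain Q' where Q': "finite Q'" "\<forall>q\<in>Q. \<exists>q'\<in>Q'. \<forall>f\<in>K. q f - q' f \<in> V'"
      using finite_approx[OF KU(1) V'(1)] by (elim exE conjE)
    obtain G where G: "finite G" "G \<subseteq> Q"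
        "\<forall>q\<in>Q. \<exists>g\<in>G. \<exists>q'\<in>Q'. (\<forall>f\<in>K. q f - q' f \<in> V') \<and> (\<forall>f\<in>K. g f - q' f \<in> V')"
      using finite_inner_cover[OF Q'(1), of Q "\<lambda>q q'. \<forall>f\<in>K. q f - q' f \<in> V'"] Q'(2) by auto
    have "\<exists>g\<in>G. q - g \<in> N" if q: "q \<in> Q" for q
    proof -
      obtain g q' where g: "g \<in> G" "\<forall>f\<in>K. q f - q' f \<in> V'" "\<forall>f\<in>K. g f - q' f \<in> V'"
        using G(3) q by auto
      have gQ: "g \<in> Q" using g(1) G(2) by auto
      have "q f - g f \<in> U" if f: "f \<in> K" for f
      proof (rule subsetD[OF V(2)], rule IntI)
        have "(q f - q' f) - (g f - q' f) \<in> V" using g(2,3) f by (intro V'(2)) auto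
        then show "q f - g f \<in> V" by simp
        have "a - b \<in> {a - b |a b. a \<in> A \<and> b \<in> A}" if "a \<in> A" "b \<in> A" for a b and A :: "'v set"
          using that by auto
        then show "q f - g f \<in> {a - b |a b. a \<in> ?A \<and> b \<in> ?A}"
          using q gQ f by auto
      qed
      moreover have "q - g \<in> continuous_operators ?Y ?Y"
        using q gQ Q by (intro complex_vector.subspace_diff[OF C]) auto
      ultimately have "q - g \<in> operator_nhd ?Y ?Y 0 K U"
        by (simp add: operator_nhd_zero)
      then show ?thesis using g(1) KU(3) by blast
    qed
    then show "\<exists>F. finite F \<and> F \<subseteq> topspace ?O \<and> (\<forall>a\<in>Q. \<exists>f\<in>F. a - f \<in> N)"
      using G(1,2) Q unfolding topspace_operator_space[OF Y]
      by (intro exI[of _ G] conjI ballI) (simp_all add: subset_trans[OF G(2) Q])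
  qed
qed

text \<open>The replacement is made twice: \<open>M\<close> stands in for \<open>N\<close> on the
  totally bounded set \<open>Q\<close> of operators, and \<open>V\<close> stands in for
  \<open>U\<close> on the totally bounded set of their values on \<open>K\<close>. An operator of
  \<open>Q\<close> that is small on \<open>K\<close> in the sense of \<open>X\<close> then lies in
  \<open>N\<close>.\<close>

lemma small_operator_exists:
  assumes small: "\<And>K V. compactin (pseudosaturation X) K \<Longrightarrow> zero_nhd X V \<Longrightarrow> \<exists>q\<in>Q. \<forall>f\<in>K. q f \<in> V"
    and N: "zero_nhd (bounded_refinement (operator_space (pseudosaturation X) (pseudosaturation X))) N"
  shows "\<exists>q\<in>Q. q \<in> N"
proof -
  let ?Y = "pseudosaturation X"
  let ?O = "operator_space ?Y ?Y"
  note Y = lcs_pseudosaturation[OF X]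
  from zero_nhd_bounded_refinement_Int[OF lcs_operator_space[OF Y] N totally_bounded_in_operator_space]
  obtain M where M: "zero_nhd ?O M" "M \<inter> Q \<subseteq> N" by (elim exE conjE)
  obtain K U where KU: "compactin ?Y K" "zero_nhd ?Y U" "operator_nhd ?Y ?Y 0 K U \<subseteq> M"
    by (rule zero_nhd_operator_space[OF Y M(1)])
  let ?A = "{q f |q f. q \<in> Q \<and> f \<in> K}"
  from zero_nhd_pseudosaturation_Int[OF KU(2) totally_bounded_in_values[OF KU(1)]]
  obtain V where V: "zero_nhd X V" "V \<inter> ?A \<subseteq> U" by (elim exE conjE)
  obtain q where q: "q \<in> Q" "\<forall>f\<in>K. q f \<in> V" using small[OF KU(1) V(1)] by (elim bexE)
  have "q f \<in> U" if "f \<in> K" for f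
    using q that by (intro subsetD[OF V(2)]) auto
  then have "q \<in> operator_nhd ?Y ?Y 0 K U"
    using q(1) Q by (auto simp: operator_nhd_zero)
  then have "q \<in> N" using KU(3) M(2) q(1) by auto
  then show ?thesis using q(1) by (rule bexI)
qed

end

lemma closure_of_coarser:
  assumes "finer_topology Z Y"
  shows "Z closure_of S \<subseteq> Y closure_of S"
  using assms unfolding finer_topology_def closure_of_def by auto

text \<open>The comparison of topologies is available at zero, so everything is shifted by
  \<open>\<phi>\<close>; the differences \<open>s - \<phi>\<close> and their approximating families
  are again continuous operators. Closure for the bounded refinement of the operator space implies
  closure for its pseudosaturation.\<close>

lemma in_closure_L_space:
  fixes X :: "'v::complex_vector topology"
  defines "C \<equiv> continuous_operators (pseudosaturation X) (pseudosaturation X)"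
  assumes X: "locally_convex_space X"
    and \<phi>: "\<phi> \<in> C" and S: "S \<subseteq> C"
    and finite_approx: "\<And>K V. compactin (pseudosaturation X) K \<Longrightarrow> zero_nhd X V \<Longrightarrow>
      \<exists>Q'. finite Q' \<and> Q' \<subseteq> C \<and> (\<forall>s\<in>S. \<exists>q\<in>Q'. \<forall>f\<in>K. s f - q f \<in> V)"
    and approx: "\<And>K V. compactin (pseudosaturation X) K \<Longrightarrow> zero_nhd X V \<Longrightarrow>
      \<exists>s\<in>S. \<forall>f\<in>K. s f - \<phi> f \<in> V"
  shows "\<phi> \<in> L_space (pseudosaturation X) closure_of S"
proof -
  let ?Y = "pseudosaturation X"
  let ?O = "operator_space ?Y ?Y"
  let ?Q = "(\<lambda>s. s - \<phi>) ` S"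
  note Y = lcs_pseudosaturation[OF X]
  note O = lcs_operator_space[OF Y]
  note C = subspace_continuous_operators[OF Y, of ?Y, folded C_def]
  have QC: "?Q \<subseteq> C"
    using complex_vector.subspace_diff[OF C _ \<phi>] S by auto
  have fin: "\<exists>Q'. finite Q' \<and> Q' \<subseteq> C \<and> (\<forall>q\<in>?Q. \<exists>q'\<in>Q'. \<forall>f\<in>K. q f - q' f \<in> V)"
    if KV: "compactin ?Y K" "zero_nhd X V" for K V
  proof -
    obtain Q' where Q': "finite Q'" "Q' \<subseteq> C" "\<forall>s\<in>S. \<exists>q\<in>Q'. \<forall>f\<in>K. s f - q f \<in> V"
      using finite_approx[OF KV] by (elim exE conjE)
    have "\<forall>q\<in>?Q. \<exists>q'\<in>(\<lambda>s. s - \<phi>) ` Q'. \<forall>f\<in>K. q f - q' f \<in> V"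
      using Q'(3) by simp
    moreover have "(\<lambda>s. s - \<phi>) ` Q' \<subseteq> C"
      using complex_vector.subspace_diff[OF C _ \<phi>] Q'(2) by auto
    ultimately show ?thesis using Q'(1) by (intro exI[of _ "(\<lambda>s. s - \<phi>) ` Q'"] conjI finite_imageI)
  qed
  have small: "\<exists>q\<in>?Q. \<forall>f\<in>K. q f \<in> V" if "compactin ?Y K" "zero_nhd X V" for K V
    using approx[OF that] by simp
  note OO = topspace_bounded_refinement[OF O, unfolded topspace_operator_space[OF Y]]
  have "\<phi> \<in> bounded_refinement ?O closure_of S"
    unfolding closure_of_lcs[OF lcs_bounded_refinement[OF O]] OO
  proof (intro conjI allI impI)
    show "\<phi> \<in> continuous_operators ?Y ?Y" using \<phi> by (simp add: C_def)
    fix N assume "zero_nhd (bounded_refinement ?O) N"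
    from small_operator_exists[OF X QC[unfolded C_def] fin[unfolded C_def] small this]
    show "\<exists>s\<in>S. s \<in> continuous_operators ?Y ?Y \<and> s - \<phi> \<in> N"
      using S unfolding C_def by auto
  qed
  then show ?thesis
    using closure_of_coarser[OF bounded_refinement_finer_pseudosaturation[OF O]]
    unfolding L_space_def by auto
qed

section \<open>Fine partitions of unity\<close>

text \<open>Well-order the points and let \<open>f s x = max 0 (e - dist x s)\<close>.  The increments \<open>g s x\<close> of the
  running supremum of \<open>f\<close> are uniformly Lipschitz, and at each \<open>x\<close> only finitely many of them exceed
  a given positive bound.  Hence the sets where \<open>g s\<close> exceeds half of \<open>SUP s. g s\<close> form a locally
  finite cover.\<close>

lemma locally_finite_refinement:
  fixes e :: real
  assumes e: "e > 0"
  obtains \<C> :: "'m::metric_space set set"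
  where "\<And>U. U \<in> \<C> \<Longrightarrow> open U" "\<Union>\<C> = UNIV" "\<And>U. U \<in> \<C> \<Longrightarrow> \<exists>c. U \<subseteq> ball c e"
    "\<And>x. \<exists>V. open V \<and> x \<in> V \<and> finite {U \<in> \<C>. U \<inter> V \<noteq> {}}"
proof -
  obtain R :: "'m rel" where R: "well_order_on UNIV R"
    using well_order_on by blast
  define less where "less s t \<longleftrightarrow> (s, t) \<in> R - Id" for s t
  have "{(s, t). less s t} = R - Id" by (auto simp: less_def)
  then have wf: "wfp less"
    using R unfolding well_order_on_def wfp_def by simp
  have total: "less s t \<or> less t s" if "s \<noteq> t" for s t
    using R that unfolding well_order_on_def linear_order_on_def total_on_def less_def by auto
  define f where "f s x = max 0 (e - dist x s)" for s x :: 'm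
  have f: "0 \<le> f s x" "f s x \<le> e" "f s x \<le> f s y + dist x y" for s x y
    using e dist_triangle[of y s x] by (auto simp: f_def dist_commute)
  \<comment> \<open>The inserted 0 makes the set nonempty for the least index, where there is no
    earlier \<open>r\<close>, and makes the running supremum nonnegative.\<close>
  define F where "F s x = insert 0 ((\<lambda>r. f r x) ` {r. less r s})" for s x
  define h where "h s x = Sup (F s x)" for s x
  have bdd: "bdd_above (F s x)" for s x
    unfolding bdd_above_def F_def using f e by (intro exI[of _ e]) auto
  have h_ge: "z \<le> h s x" if "z \<in> F s x" for s x z
    unfolding h_def using that bdd by (rule cSup_upper)
  have h_le: "h s x \<le> b" if "\<And>z. z \<in> F s x \<Longrightarrow> z \<le> b" for s x b
    unfolding h_def by (rule cSup_least) (use that in \<open>auto simp: F_def\<close>)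
  have h0: "0 \<le> h s x" for s x
    by (rule h_ge) (simp add: F_def)
  have h_lip: "h s x \<le> h s y + dist x y" for s x y
  proof (rule h_le)
    fix z assume "z \<in> F s x"
    then consider "z = 0" | r where "z = f r x" "less r s" by (auto simp: F_def)
    then show "z \<le> h s y + dist x y"
    proof cases
      case 1
      then show ?thesis using h0[of s y] by simp
    next
      case 2
      have "f r y \<le> h s y" using 2 by (intro h_ge) (simp add: F_def)
      then show ?thesis using f(3)[of r x y] 2 by simp
    qed
  qed
  define g where "g s x = max 0 (f s x - h s x)" for s x
  have g: "0 \<le> g s x" "g s x \<le> e" for s x
    using e f(2)[of s x] h0[of s x] by (auto simp: g_def)
  \<comment> \<open>The constant 2 arises because \<open>g\<close> is built from the difference of
    \<open>f\<close> and \<open>h\<close>, each of which is 1-Lipschitz.\<close>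
  have g_lip: "g s x \<le> g s y + 2 * dist x y" for s x y
    using f(3)[of s x y] h_lip[of s y x] zero_le_dist[of x y] by (auto simp: g_def dist_commute)
  define q where "q x = (SUP s. g s x)" for x
  have bddg: "bdd_above (range (\<lambda>s. g s x))" for x
    using g(2) by (intro bdd_aboveI[of _ e]) auto
  have q_ge: "g s x \<le> q x" for s x
    unfolding q_def by (rule cSUP_upper[OF _ bddg]) simp
  have q_lip: "q x \<le> q y + 2 * dist x y" for x y
    unfolding q_def[of x]
  proof (rule cSUP_least)
    show "g s x \<le> q y + 2 * dist x y" for s
      using g_lip[of s x y] q_ge[of s y] by linarith
  qed simp
  have q_pos: "0 < q x" for x
  proof -
    have "f x x > 0" using e by (simp add: f_def)
    \<comment> \<open>At the least index with \<open>f s x > 0\<close> the running supremum of the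
      earlier values is still 0, so the increment there is positive.\<close>
    then obtain s where s: "f s x > 0" "\<forall>r. less r s \<longrightarrow> \<not> f r x > 0"
      using wf[unfolded wfp_eq_minimal, rule_format, of x "{s. f s x > 0}"] by auto
    have "h s x \<le> 0"
      by (rule h_le) (use s(2) in \<open>auto simp: F_def not_less\<close>)
    then have "g s x > 0" using s(1) by (simp add: g_def)
    then show ?thesis using q_ge[of s x] by linarith
  qed
  have fin: "finite {s. g s x > c}" if c: "c > 0" for c x
  proof (rule inj_on_finite)
    \<comment> \<open>For \<open>s\<close> before \<open>t\<close> one has
      \<open>f s x + c \<le> h t x + c < f t x\<close>, so the integer parts of
      \<open>f s x / c\<close> increase strictly along the indices with \<open>g s x > c\<close>.
      They all lie between 0 and the integer part of \<open>e / c\<close>.\<close>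
    have step: "\<lfloor>f s x / c\<rfloor> < \<lfloor>f t x / c\<rfloor>" if "g t x > c" "less s t" for s t
    proof -
      have "f s x \<le> h t x" by (rule h_ge) (use that in \<open>simp add: F_def\<close>)
      moreover have "c < f t x - h t x" using that(1) c by (simp add: g_def)
      ultimately have "(f s x + c) / c < f t x / c"
        using c by (intro divide_strict_right_mono) linarith+
      then have "f s x / c + 1 < f t x / c" using c by (simp add: add_divide_distrib)
      then show ?thesis by linarith
    qed
    show "inj_on (\<lambda>s. \<lfloor>f s x / c\<rfloor>) {s. g s x > c}"
    proof (rule inj_onI)
      fix s t assume *: "s \<in> {s. g s x > c}" "t \<in> {s. g s x > c}" "\<lfloor>f s x / c\<rfloor> = \<lfloor>f t x / c\<rfloor>"
      show "s = t"
      proof (rule ccontr)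
        assume "s \<noteq> t"
        then show False using total[of s t] step[of t s] step[of s t] * by auto
      qed
    qed
    show "(\<lambda>s. \<lfloor>f s x / c\<rfloor>) ` {s. g s x > c} \<subseteq> {0..\<lfloor>e / c\<rfloor>}"
      using f c by (auto intro!: floor_mono divide_right_mono)
  qed simp
  define U where "U s = {x. q x / 2 < g s x}" for s
  have cont: "continuous_on UNIV k" if k: "\<And>x y. k x \<le> k y + 2 * dist x y" for k :: "'m \<Rightarrow> real"
    unfolding continuous_on_iff
  proof (intro ballI allI impI)
    fix x and d :: real assume "0 < d"
    show "\<exists>d'>0. \<forall>y\<in>UNIV. dist y x < d' \<longrightarrow> dist (k y) (k x) < d"
    proof (intro exI[of _ "d / 3"] conjI ballI impI)
      fix y assume "dist y x < d / 3"
      then show "dist (k y) (k x) < d"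
        using k[of x y] k[of y x] \<open>0 < d\<close> by (auto simp: dist_real_def dist_commute abs_if)
    qed (use \<open>0 < d\<close> in simp)
  qed
  show ?thesis
  proof (rule that[of "range U"])
    have "open (U s)" for s
      unfolding U_def by (intro open_Collect_less continuous_intros cont g_lip q_lip) simp
    then show "\<And>V. V \<in> range U \<Longrightarrow> open V" by auto
    show "\<Union>(range U) = UNIV"
    proof (intro set_eqI iffI UNIV_I)
      fix x
      have "q x / 2 < (SUP s. g s x)" using q_pos[of x] by (simp add: q_def)
      then obtain s where "q x / 2 < g s x"
        by (subst (asm) less_cSUP_iff[OF _ bddg]) auto
      then show "x \<in> \<Union>(range U)" by (auto simp: U_def)
    qed
    have "U s \<subseteq> ball s e" for s
    proof
      fix x assume "x \<in> U s"
      then have "g s x > 0" using q_pos[of x] by (simp add: U_def)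
      then have "f s x > 0" using h0[of s x] by (simp add: g_def)
      then show "x \<in> ball s e" by (simp add: f_def dist_commute)
    qed
    then show "\<And>V. V \<in> range U \<Longrightarrow> \<exists>c. V \<subseteq> ball c e" by auto
    show "\<exists>V. open V \<and> x \<in> V \<and> finite {W \<in> range U. W \<inter> V \<noteq> {}}" for x
    proof (intro exI conjI)
      \<comment> \<open>Moving from \<open>y\<close> to \<open>x\<close> changes \<open>g\<close>
        and \<open>q\<close> by at most \<open>q x / 6\<close>. Hence \<open>q y / 2 < g s y\<close>
        gives \<open>g s x > (5 / 12 - 2 / 12) * q x = q x / 4\<close>, which only finitely many
        \<open>s\<close> satisfy.\<close>
      show "open (ball x (q x / 12))" "x \<in> ball x (q x / 12)" using q_pos[of x] by auto
      have "s \<in> {s. g s x > q x / 4}" if "y \<in> U s" "y \<in> ball x (q x / 12)" for s y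
        using that g_lip[of s y x] q_lip[of x y] by (simp add: U_def dist_commute)
      then have "{W \<in> range U. W \<inter> ball x (q x / 12) \<noteq> {}} \<subseteq> U ` {s. g s x > q x / 4}"
        by auto
      then show "finite {W \<in> range U. W \<inter> ball x (q x / 12) \<noteq> {}}"
        by (rule finite_subset) (intro finite_imageI fin, use q_pos[of x] in simp)
    qed
  qed
qed

locale partition_of_unity =
  fixes \<eta> :: "'i \<Rightarrow> 'm::metric_space \<Rightarrow> real"
  assumes cont: "continuous_on UNIV (\<eta> i)"
    and nonneg: "0 \<le> \<eta> i x"
    and locally_finite: "\<exists>V. open V \<and> x \<in> V \<and> finite {i. \<exists>y\<in>V. \<eta> i y \<noteq> 0}"
    and sum_eq_1: "(\<Sum>i | \<eta> i x \<noteq> 0. \<eta> i x) = 1"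

text \<open>Indexing by all sets, with zero functions off the cover, lets one index type serve every
  mesh. The sample point for \<open>U\<close> is the centre of a ball of radius \<open>e\<close>
  containing \<open>U\<close>; it may lie outside \<open>U\<close>.\<close>

lemma fine_partition_of_unity:
  fixes e :: real
  assumes e: "e > 0"
  shows "\<exists>(\<eta> :: 'm::metric_space set \<Rightarrow> 'm \<Rightarrow> real) \<tau>.
    partition_of_unity \<eta> \<and> (\<forall>i x. \<eta> i x \<noteq> 0 \<longrightarrow> dist x (\<tau> i) < e)"
proof (rule locally_finite_refinement[OF e])
  fix \<C> :: "'m set set" assume \<C>: "\<And>U. U \<in> \<C> \<Longrightarrow> open U" "\<Union>\<C> = UNIV"
      "\<And>U. U \<in> \<C> \<Longrightarrow> \<exists>c. U \<subseteq> ball c e" "\<And>x. \<exists>V. open V \<and> x \<in> V \<and> finite {U \<in> \<C>. U \<inter> V \<noteq> {}}"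
  obtain \<tau> where \<tau>: "\<And>U. U \<in> \<C> \<Longrightarrow> U \<subseteq> ball (\<tau> U) e"
    using \<C>(3) by metis
  show ?thesis
  proof (rule subordinate_partition_of_unity[of UNIV \<C>])
    show "UNIV \<subseteq> \<Union>\<C>" using \<C>(2) by simp
    show "open U" if "U \<in> \<C>" for U using \<C>(1) that by blast
    show "\<exists>V. open V \<and> x \<in> V \<and> finite {U \<in> \<C>. U \<inter> V \<noteq> {}}" for x by (rule \<C>(4))
    fix F :: "'m set \<Rightarrow> 'm \<Rightarrow> real" assume F:
        "\<And>U. U \<in> \<C> \<Longrightarrow> continuous_on UNIV (F U) \<and> (\<forall>x\<in>UNIV. 0 \<le> F U x)"
        "\<And>x U. \<lbrakk>U \<in> \<C>; x \<in> UNIV; x \<notin> U\<rbrakk> \<Longrightarrow> F U x = 0"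
        "\<And>x. x \<in> UNIV \<Longrightarrow> supp_sum (\<lambda>W. F W x) \<C> = 1"
        "\<And>x. x \<in> UNIV \<Longrightarrow> \<exists>V. open V \<and> x \<in> V \<and> finite {U \<in> \<C>. \<exists>x\<in>V. F U x \<noteq> 0}"
    define \<eta> where "\<eta> U x = (if U \<in> \<C> then F U x else 0)" for U x
    have supp: "{U. \<exists>x\<in>V. \<eta> U x \<noteq> 0} = {U \<in> \<C>. \<exists>x\<in>V. F U x \<noteq> 0}" for V
      by (auto simp: \<eta>_def)
    have "partition_of_unity \<eta>"
    proof
      fix U x
      show "continuous_on UNIV (\<eta> U)"
        using F(1)[of U] by (cases "U \<in> \<C>") (simp_all add: \<eta>_def[abs_def])
      show "0 \<le> \<eta> U x" using F(1) by (simp add: \<eta>_def)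
      show "\<exists>V. open V \<and> x \<in> V \<and> finite {i. \<exists>y\<in>V. \<eta> i y \<noteq> 0}"
        unfolding supp using F(4) by simp
      have "(\<Sum>i | \<eta> i x \<noteq> 0. \<eta> i x) = (\<Sum>i\<in>{U \<in> \<C>. F U x \<noteq> 0}. F i x)"
        by (rule sum.cong) (auto simp: \<eta>_def)
      also have "\<dots> = 1" using F(3)[of x] by (simp add: supp_sum_def support_on_def)
      finally show "(\<Sum>i | \<eta> i x \<noteq> 0. \<eta> i x) = 1" .
    qed
    moreover have "dist x (\<tau> U) < e" if "\<eta> U x \<noteq> 0" for U x
    proof -
      have "U \<in> \<C>" "x \<in> U" using that F(2)[of U x] by (auto simp: \<eta>_def split: if_splits)
      then show ?thesis using \<tau>[of U] by (auto simp: dist_commute)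
    qed
    ultimately show ?thesis by blast
  qed
qed

section \<open>Uniform convergence on compact sets\<close>

text \<open>A pointwise bound instead of a supremum, so that \<open>T = {}\<close> is admissible.
  For nonempty compact \<open>T\<close> the two forms agree by
  \<open>SUP_norm_less_iff\<close>.\<close>

definition uniform_nhd :: "'m::metric_space set \<Rightarrow> real \<Rightarrow> ('m \<Rightarrow> complex) set" where
  "uniform_nhd T e = {f. continuous_on UNIV f \<and> (\<forall>t\<in>T. norm (f t) < e)}"

lemma compact_imp_norm_bounded:
  fixes f :: "'m::metric_space \<Rightarrow> complex"
  assumes "continuous_on UNIV f" "compact T"
  obtains b where "b > 0" "\<forall>t\<in>T. norm (f t) \<le> b"
proof -
  have "bounded (f ` T)"
    using assms by (intro compact_imp_bounded compact_continuous_image) (auto intro: continuous_on_subset)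
  then show ?thesis using that unfolding bounded_pos by auto
qed

text \<open>The strict inequality survives the supremum because a continuous function attains it on
  a nonempty compact set.\<close>

lemma SUP_norm_less_iff:
  fixes f :: "'m::metric_space \<Rightarrow> complex"
  assumes f: "continuous_on UNIV f" and K: "compact K" "K \<noteq> {}"
  shows "(SUP t\<in>K. norm (f t)) < e \<longleftrightarrow> (\<forall>t\<in>K. norm (f t) < e)"
proof -
  have "continuous_on K (\<lambda>t. norm (f t))"
    using f by (intro continuous_intros) (auto intro: continuous_on_subset)
  from continuous_attains_sup[OF K this]
  obtain s where s: "s \<in> K" "\<forall>t\<in>K. norm (f t) \<le> norm (f s)" by auto
  then have "(SUP t\<in>K. norm (f t)) = norm (f s)"
    by (intro cSup_eq_maximum) auto
  then show ?thesis using s by fastforce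
qed

lemma zero_base_uniform_nhd:
  "zero_base {f :: 'm::metric_space \<Rightarrow> complex. continuous_on UNIV f}
     {uniform_nhd T e |T e. compact T \<and> e > 0}" (is "zero_base ?V ?B")
proof
  show V: "complex_vector.subspace ?V"
    unfolding complex_vector.subspace_def
    by (auto simp: zero_fun_def plus_fun_def scaleC_fun_def scaleC_complex_def
        intro!: continuous_intros)
  have "uniform_nhd {} 1 \<in> ?B" by (intro CollectI exI[of _ "{}"] exI[of _ 1]) simp
  then show "?B \<noteq> {}" by blast
  fix U :: "('m \<Rightarrow> complex) set" assume "U \<in> ?B"
  then obtain T e where U: "U = uniform_nhd T e" "compact T" "e > 0" by auto
  show "U \<subseteq> ?V" by (auto simp: U uniform_nhd_def)
  show "absconvex U"
  proof (rule absconvexI)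
    fix f g and a b :: complex
    assume fg: "f \<in> U" "g \<in> U" "norm a + norm b \<le> 1"
    have "a *\<^sub>C f + b *\<^sub>C g \<in> ?V"
      using fg by (intro complex_vector.subspace_add[OF V] complex_vector.subspace_scale[OF V])
        (simp_all add: U uniform_nhd_def)
    moreover have "norm ((a *\<^sub>C f + b *\<^sub>C g) t) < e" if "t \<in> T" for t
    proof -
      have ft: "norm (f t) < e" "norm (g t) < e" using fg that by (simp_all add: U uniform_nhd_def)
      \<comment> \<open>The larger of the two norms is still strictly below \<open>e\<close>, so
        weak estimates suffice for the combination even when both coefficients vanish.\<close>
      define m where "m = max (norm (f t)) (norm (g t))"
      have m: "0 \<le> m" "m < e" using ft by (simp_all add: m_def le_max_iff_disj)
      have "norm ((a *\<^sub>C f + b *\<^sub>C g) t) \<le> norm a * norm (f t) + norm b * norm (g t)"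
        using norm_triangle_ineq[of "a * f t" "b * g t"]
        by (simp add: plus_fun_def scaleC_fun_def scaleC_complex_def norm_mult)
      also have "\<dots> \<le> norm a * m + norm b * m"
        by (intro add_mono mult_left_mono) (simp_all add: m_def)
      also have "\<dots> \<le> 1 * m"
        unfolding distrib_right[symmetric] using fg(3) m(1) by (rule mult_right_mono)
      finally show ?thesis using m(2) by simp
    qed
    ultimately show "a *\<^sub>C f + b *\<^sub>C g \<in> U" by (simp add: U uniform_nhd_def)
  qed
  show "\<exists>r>0. complex_of_real r *\<^sub>C f \<in> U" if f: "f \<in> ?V" for f
  proof -
    obtain b where b: "b > 0" "\<forall>t\<in>T. norm (f t) \<le> b"
      using compact_imp_norm_bounded[of f T] f U(2) by auto
    \<comment> \<open>The factor 2 turns the weak bound \<open>b\<close> into the strict inequality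
      required by \<open>uniform_nhd\<close>.\<close>
    define r where "r = e / (2 * b)"
    have r: "r > 0" "r * b = e / 2" using b U(3) by (simp_all add: r_def)
    have "norm ((complex_of_real r *\<^sub>C f) t) < e" if "t \<in> T" for t
    proof -
      have "r * norm (f t) \<le> r * b" using b that r by (intro mult_left_mono) auto
      then show ?thesis
        using r U(3) by (simp add: scaleC_fun_def scaleC_complex_def norm_mult)
    qed
    moreover have "complex_of_real r *\<^sub>C f \<in> ?V"
      using f V by (intro complex_vector.subspace_scale) auto
    ultimately show ?thesis using r(1) by (intro exI[of _ r]) (simp add: U uniform_nhd_def)
  qed
  show "\<exists>U''\<in>?B. U'' \<subseteq> U \<inter> U'" if "U' \<in> ?B" for U'
  proof -
    obtain T' e' where U': "U' = uniform_nhd T' e'" "compact T'" "e' > 0" using \<open>U' \<in> ?B\<close> by auto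
    have "uniform_nhd (T \<union> T') (min e e') \<in> ?B"
      using U U' by (intro CollectI exI[of _ "T \<union> T'"] exI[of _ "min e e'"]) (simp add: compact_Un)
    moreover have "uniform_nhd (T \<union> T') (min e e') \<subseteq> U \<inter> U'"
      by (auto simp: U U' uniform_nhd_def)
    ultimately show ?thesis by (rule bexI[rotated])
  qed
  show "\<exists>U'\<in>?B. \<forall>f\<in>U'. 2 *\<^sub>C f \<in> U"
  proof (intro bexI ballI)
    show "uniform_nhd T (e / 2) \<in> ?B"
      using U by (intro CollectI exI[of _ T] exI[of _ "e / 2"]) simp
    fix f :: "'m \<Rightarrow> complex" assume f: "f \<in> uniform_nhd T (e / 2)"
    then have "2 *\<^sub>C f \<in> ?V"
      by (intro complex_vector.subspace_scale[OF V]) (simp add: uniform_nhd_def)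
    then show "2 *\<^sub>C f \<in> U"
      using f by (auto simp: U uniform_nhd_def scaleC_fun_def scaleC_complex_def norm_mult)
  qed
next
  fix f :: "'m \<Rightarrow> complex" assume f: "f \<in> ?V" "f \<noteq> 0"
  then obtain t where t: "f t \<noteq> 0" by (auto simp: fun_eq_iff)
  have "uniform_nhd {t} (norm (f t)) \<in> ?B"
    using t by (intro CollectI exI[of _ "{t}"] exI[of _ "norm (f t)"]) simp
  moreover have "f \<notin> uniform_nhd {t} (norm (f t))" by (simp add: uniform_nhd_def)
  ultimately show "\<exists>U\<in>?B. f \<notin> U" by (rule bexI[rotated])
qed

text \<open>The generating sets are balls about arbitrary functions, whereas the base consists of
  balls about zero. Compactness leaves room for a small ball around each point of a generating set;
  conversely, each translated base set contains a generating set with the same centre.\<close>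

lemma C_natural_eq_nhd_topology:
  "(C_natural :: ('m::metric_space \<Rightarrow> complex) topology) =
     nhd_topology {f. continuous_on UNIV f} {uniform_nhd T e |T e. compact T \<and> e > 0}"
  (is "_ = nhd_topology ?V ?B")
proof -
  interpret zero_base ?V ?B by (rule zero_base_uniform_nhd)
  note V = complex_vector.subspace_diff[OF subspace] complex_vector.subspace_add[OF subspace]
  define P :: "(('m \<Rightarrow> complex) \<Rightarrow> real) set" where "P = {(\<lambda>f. SUP t\<in>K. norm (f t)) |K. compact K \<and> K \<noteq> {}}"
  define \<G> where "\<G> = {{g \<in> ?V. p (g - f) < e} |f p e. f \<in> ?V \<and> p \<in> P \<and> 0 < e}"
  have top: "C_natural = topology_generated_by \<G>"
    by (simp add: C_natural_def seminorm_topology_def \<G>_def P_def)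
  have gen: "G \<in> \<G> \<longleftrightarrow> (\<exists>f K e. f \<in> ?V \<and> compact K \<and> K \<noteq> {} \<and> 0 < e \<and>
      G = {g \<in> ?V. \<forall>t\<in>K. norm (g t - f t) < e})" for G
  proof -
    have eq: "{g \<in> ?V. (SUP t\<in>K. norm ((g - f) t)) < e} = {g \<in> ?V. \<forall>t\<in>K. norm (g t - f t) < e}"
      if f: "f \<in> ?V" and K: "compact K" "K \<noteq> {}" for f K e
    proof (rule Collect_cong)
      fix g
      show "g \<in> ?V \<and> (SUP t\<in>K. norm ((g - f) t)) < e \<longleftrightarrow> g \<in> ?V \<and> (\<forall>t\<in>K. norm (g t - f t) < e)"
      proof (rule conj_cong[OF refl])
        assume "g \<in> ?V"
        then have "continuous_on UNIV (g - f)" using V(1)[OF _ f, of g] by simp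
        from SUP_norm_less_iff[OF this K, of e]
        show "(SUP t\<in>K. norm ((g - f) t)) < e \<longleftrightarrow> (\<forall>t\<in>K. norm (g t - f t) < e)" by simp
      qed
    qed
    show ?thesis
    proof
      assume "G \<in> \<G>"
      then have "\<exists>f p e. G = {g \<in> ?V. p (g - f) < e} \<and> f \<in> ?V \<and> p \<in> P \<and> 0 < e"
        unfolding \<G>_def by (rule CollectD)
      then obtain f p e where f: "G = {g \<in> ?V. p (g - f) < e}" "f \<in> ?V" "p \<in> P" "0 < e"
        by (elim exE conjE)
      moreover have "\<exists>K. p = (\<lambda>f. SUP t\<in>K. norm (f t)) \<and> compact K \<and> K \<noteq> {}"
        using f(3) unfolding P_def by (rule CollectD)
      moreover from this obtain K where K: "p = (\<lambda>f. SUP t\<in>K. norm (f t))" "compact K" "K \<noteq> {}"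
        by (elim exE conjE)
      ultimately have "G = {g \<in> ?V. (SUP t\<in>K. norm ((g - f) t)) < e}" by simp
      then show "\<exists>f K e. f \<in> ?V \<and> compact K \<and> K \<noteq> {} \<and> 0 < e \<and> G = {g \<in> ?V. \<forall>t\<in>K. norm (g t - f t) < e}"
        unfolding eq[OF f(2) K(2,3)] using f(2,4) K(2,3) by (intro exI[of _ f] exI[of _ K] exI[of _ e] conjI)
    next
      assume "\<exists>f K e. f \<in> ?V \<and> compact K \<and> K \<noteq> {} \<and> 0 < e \<and> G = {g \<in> ?V. \<forall>t\<in>K. norm (g t - f t) < e}"
      then obtain f K e where G: "f \<in> ?V" "compact K" "K \<noteq> {}" "0 < e"
          "G = {g \<in> ?V. \<forall>t\<in>K. norm (g t - f t) < e}"
        by (elim exE conjE)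
      then have "G = {g \<in> ?V. (SUP t\<in>K. norm ((g - f) t)) < e}"
        using eq[OF G(1-3), of e] by simp
      moreover have "(\<lambda>f. SUP t\<in>K. norm (f t)) \<in> P"
        unfolding P_def using G(2,3) by (intro CollectI exI[of _ K]) simp
      ultimately show "G \<in> \<G>"
        unfolding \<G>_def using G(1,4)
        by (intro CollectI exI[of _ f] exI[of _ "\<lambda>f. SUP t\<in>K. norm (f t)"] exI[of _ e]) simp
    qed
  qed
  have gen_open: "openin (nhd_topology ?V ?B) G" if "G \<in> \<G>" for G
  proof -
    obtain f K e where G: "f \<in> ?V" "compact K" "K \<noteq> {}" "0 < e"
        "G = {g \<in> ?V. \<forall>t\<in>K. norm (g t - f t) < e}"
      using \<open>G \<in> \<G>\<close> unfolding gen by (elim exE conjE)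
    show ?thesis
      unfolding openin_nhd
    proof (intro conjI ballI)
      show "G \<subseteq> ?V" by (auto simp: G)
      fix g assume g: "g \<in> G"
      then have gV: "g \<in> ?V" by (simp add: G)
      have "continuous_on K (\<lambda>t. norm (g t - f t))"
        using G(1) gV by (intro continuous_intros) (auto intro: continuous_on_subset)
      from continuous_attains_sup[OF G(2,3) this]
      obtain s where s: "s \<in> K" "\<forall>t\<in>K. norm (g t - f t) \<le> norm (g s - f s)" by auto
      \<comment> \<open>The maximum over \<open>K\<close> is attained at \<open>s\<close>, so the
        slack \<open>d\<close> is positive uniformly on \<open>K\<close>.\<close>
      define d where "d = e - norm (g s - f s)"
      have d: "d > 0" using g s(1) by (simp add: G d_def)
      have "g + u \<in> G" if u: "u \<in> uniform_nhd K d" for u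
      proof -
        have "norm (g t + u t - f t) < e" if t: "t \<in> K" for t
        proof -
          have "norm (g t + u t - f t) \<le> norm (g t - f t) + norm (u t)"
            using norm_triangle_ineq[of "g t - f t" "u t"] by (simp add: algebra_simps)
          moreover have "norm (g t - f t) \<le> norm (g s - f s)" using s t by blast
          moreover have "norm (u t) < d" using u t by (simp add: uniform_nhd_def)
          ultimately show ?thesis by (simp add: d_def)
        qed
        moreover have "g + u \<in> ?V" using gV u by (intro V(2)) (simp_all add: uniform_nhd_def)
        ultimately show ?thesis by (simp add: G(5) plus_fun_def)
      qed
      then show "\<exists>U\<in>?B. \<forall>u\<in>U. g + u \<in> G"
        using G(2) d by (intro bexI[of _ "uniform_nhd K d"]) auto
    qed
  qed
  show ?thesis
    unfolding topology_eq
  proof (intro allI iffI)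
    fix W :: "('m \<Rightarrow> complex) set"
    assume "openin C_natural W"
    then have "generate_topology_on \<G> W"
      by (simp add: top openin_topology_generated_by_iff)
    then show "openin (nhd_topology ?V ?B) W"
      using generate_topology_on_coarsest[of "openin (nhd_topology ?V ?B)" \<G> W,
          OF istopology_openin gen_open] by simp
  next
    fix W :: "('m \<Rightarrow> complex) set"
    assume W: "openin (nhd_topology ?V ?B) W"
    have "\<exists>G. openin C_natural G \<and> f \<in> G \<and> G \<subseteq> W" if f: "f \<in> W" for f
    proof -
      have fV: "f \<in> ?V" using W f unfolding openin_nhd by blast
      obtain T e where T: "compact T" "e > 0" "\<forall>u\<in>uniform_nhd T e. f + u \<in> W"
        using W f unfolding openin_nhd by blast
      \<comment> \<open>The seminorms are indexed by nonempty compact sets; an arbitrary extra point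
        guards against \<open>T = {}\<close> and only shrinks the neighbourhood.\<close>
      define T' where "T' = insert undefined T"
      define G where "G = {g \<in> ?V. \<forall>t\<in>T'. norm (g t - f t) < e}"
      have "G \<in> \<G>"
        unfolding gen G_def using fV T(1,2)
        by (intro exI[of _ f] exI[of _ T'] exI[of _ e]) (simp add: T'_def)
      then have "openin C_natural G"
        unfolding top by (rule topology_generated_by_Basis)
      moreover have "f \<in> G" using fV T(2) by (simp add: G_def)
      moreover have "G \<subseteq> W"
      proof
        fix g assume g: "g \<in> G"
        then have "g - f \<in> uniform_nhd T e"
          using V(1)[OF _ fV, of g] by (simp add: G_def T'_def uniform_nhd_def)
        then have "f + (g - f) \<in> W" using T(3) by blast
        then show "g \<in> W" by simp
      qed
      ultimately show ?thesis by blast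
    qed
    then show "openin C_natural W" by (subst openin_subopen) blast
  qed
qed

lemma lcs_C_natural: "locally_convex_space C_natural"
  unfolding C_natural_eq_nhd_topology by (rule zero_base.locally_convex_space_nhd[OF zero_base_uniform_nhd])

lemma topspace_C_natural: "topspace C_natural = {f. continuous_on UNIV f}"
  unfolding C_natural_eq_nhd_topology by (rule zero_base.topspace_nhd[OF zero_base_uniform_nhd])

lemma zero_nhd_C_natural:
  "zero_nhd C_natural N \<longleftrightarrow> N \<subseteq> {f. continuous_on UNIV f} \<and> (\<exists>T e. compact T \<and> e > 0 \<and> uniform_nhd T e \<subseteq> N)"
  unfolding C_natural_eq_nhd_topology zero_base.zero_nhd_iff[OF zero_base_uniform_nhd] by auto

section \<open>Sampling operators\<close>

text \<open>Restricting to the indices active at \<open>x\<close> makes the sum finite for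
  partitions of unity even when \<open>J\<close> is infinite; a HOL sum over an infinite index set
  would be 0.\<close>

definition sampling :: "('i \<Rightarrow> 'm \<Rightarrow> real) \<Rightarrow> ('i \<Rightarrow> 'm) \<Rightarrow> 'i set \<Rightarrow> ('m \<Rightarrow> complex) \<Rightarrow> 'm \<Rightarrow> complex" where
  "sampling \<eta> \<tau> J f x = (\<Sum>i | i \<in> J \<and> \<eta> i x \<noteq> 0. complex_of_real (\<eta> i x) * f (\<tau> i))"

text \<open>Off the continuous functions the value is zero, following the encoding in
  \<open>continuous_operators\<close>.\<close>

definition sampling_operator ::
  "('i \<Rightarrow> 'm::metric_space \<Rightarrow> real) \<Rightarrow> ('i \<Rightarrow> 'm) \<Rightarrow> 'i set \<Rightarrow> ('m \<Rightarrow> complex) \<Rightarrow> 'm \<Rightarrow> complex" where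
  "sampling_operator \<eta> \<tau> J f = (if continuous_on UNIV f then sampling \<eta> \<tau> J f else 0)"

context partition_of_unity
begin

lemma finite_supp: "finite {i. \<eta> i x \<noteq> 0}"
proof -
  obtain V where V: "x \<in> V" "finite {i. \<exists>y\<in>V. \<eta> i y \<noteq> 0}"
    using locally_finite[of x] by (elim exE conjE)
  show ?thesis by (rule finite_subset[OF _ V(2)]) (use V(1) in auto)
qed

lemma finite_supp_compact:
  assumes T: "compact T"
  shows "finite {i. \<exists>y\<in>T. \<eta> i y \<noteq> 0}"
proof -
  have "\<forall>x. \<exists>V. open V \<and> x \<in> V \<and> finite {i. \<exists>y\<in>V. \<eta> i y \<noteq> 0}"
    by (rule allI) (rule locally_finite)
  then have "\<exists>V. \<forall>x. open (V x) \<and> x \<in> V x \<and> finite {i. \<exists>y\<in>V x. \<eta> i y \<noteq> 0}"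
    by (rule choice)
  then obtain V where V: "\<forall>x. open (V x) \<and> x \<in> V x \<and> finite {i. \<exists>y\<in>V x. \<eta> i y \<noteq> 0}"
    by (elim exE)
  show ?thesis
  proof (rule compactE_image[OF T])
    show "open (V x)" for x using V by blast
    show "T \<subseteq> (\<Union>x\<in>T. V x)" using V by auto
    fix F assume F: "F \<subseteq> T" "finite F" "T \<subseteq> (\<Union>x\<in>F. V x)"
    have "{i. \<exists>y\<in>T. \<eta> i y \<noteq> 0} \<subseteq> (\<Union>x\<in>F. {i. \<exists>y\<in>V x. \<eta> i y \<noteq> 0})"
    proof
      fix i assume "i \<in> {i. \<exists>y\<in>T. \<eta> i y \<noteq> 0}"
      then obtain y where y: "y \<in> T" "\<eta> i y \<noteq> 0" by auto
      then obtain x where "x \<in> F" "y \<in> V x" using F(3) by auto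
      then show "i \<in> (\<Union>x\<in>F. {i. \<exists>y\<in>V x. \<eta> i y \<noteq> 0})" using y(2) by auto
    qed
    then show ?thesis by (rule finite_subset) (use F(2) V in simp)
  qed
qed

text \<open>Trades the index set depending on \<open>x\<close> for a fixed finite one, so that a
  single sum represents the function near a point.\<close>

lemma sampling_eq_sum:
  assumes "finite S" "{i. \<eta> i x \<noteq> 0} \<subseteq> S"
  shows "sampling \<eta> \<tau> J f x = (\<Sum>i\<in>J \<inter> S. complex_of_real (\<eta> i x) * f (\<tau> i))"
  unfolding sampling_def
  by (rule sum.mono_neutral_left) (use assms in auto)

lemma sampling_cong:
  assumes "\<And>i. \<eta> i x \<noteq> 0 \<Longrightarrow> i \<in> J \<longleftrightarrow> i \<in> J'"
  shows "sampling \<eta> \<tau> J f x = sampling \<eta> \<tau> J' f x"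
  unfolding sampling_def by (rule sum.cong) (use assms in auto)

lemma continuous_on_sampling: "continuous_on UNIV (sampling \<eta> \<tau> J f)"
proof (rule continuous_at_imp_continuous_on, rule ballI)
  fix x
  obtain V where V: "open V" "x \<in> V" "finite {i. \<exists>y\<in>V. \<eta> i y \<noteq> 0}"
    using locally_finite[of x] by (elim exE conjE)
  let ?g = "\<lambda>y. \<Sum>i\<in>J \<inter> {i. \<exists>y\<in>V. \<eta> i y \<noteq> 0}. complex_of_real (\<eta> i y) * f (\<tau> i)"
  have "continuous_on V ?g"
    by (intro continuous_intros continuous_on_subset[OF cont]) simp
  moreover have "sampling \<eta> \<tau> J f y = ?g y" if "y \<in> V" for y
    by (rule sampling_eq_sum[OF V(3)]) (use that in auto)
  ultimately have "continuous_on V (sampling \<eta> \<tau> J f)"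
    by (simp cong: continuous_on_cong)
  then show "isCont (sampling \<eta> \<tau> J f) x"
    using V(1,2) continuous_on_eq_continuous_at by blast
qed

text \<open>The weights are nonnegative, and those in \<open>J\<close> have total at most 1, so the
  bound does not depend on \<open>J\<close>.\<close>

lemma norm_sampling_le:
  assumes b: "\<And>i. \<eta> i x \<noteq> 0 \<Longrightarrow> norm (f (\<tau> i)) \<le> b" "0 \<le> b"
  shows "norm (sampling \<eta> \<tau> J f x) \<le> b"
proof -
  have "norm (sampling \<eta> \<tau> J f x) \<le> (\<Sum>i | i \<in> J \<and> \<eta> i x \<noteq> 0. \<eta> i x * b)"
    unfolding sampling_def
    by (rule sum_norm_le) (use b nonneg in \<open>auto simp: norm_mult intro!: mult_left_mono\<close>)
  also have "\<dots> \<le> (\<Sum>i | \<eta> i x \<noteq> 0. \<eta> i x * b)"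
    by (rule sum_mono2) (use finite_supp b nonneg in auto)
  also have "\<dots> = b"
    unfolding sum_distrib_right[symmetric] sum_eq_1 by simp
  finally show ?thesis .
qed

lemma sampling_add: "sampling \<eta> \<tau> J (f + g) x = sampling \<eta> \<tau> J f x + sampling \<eta> \<tau> J g x"
  by (simp add: sampling_def distrib_left sum.distrib plus_fun_def)

lemma sampling_scale: "sampling \<eta> \<tau> J (\<lambda>x. c * f x) x = c * sampling \<eta> \<tau> J f x"
  by (simp add: sampling_def sum_distrib_left mult_ac)

lemma sampling_diff: "sampling \<eta> \<tau> J (\<lambda>x. f x - g x) x = sampling \<eta> \<tau> J f x - sampling \<eta> \<tau> J g x"
  by (simp add: sampling_def right_diff_distrib sum_subtractf)

text \<open>Since the weights sum to 1, the number \<open>f x\<close> is the sampled value of a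
  constant function; the error is therefore the sampled value of \<open>f - f x\<close> at
  \<open>x\<close>.\<close>

lemma norm_sampling_diff_le:
  assumes b: "\<And>i. \<eta> i x \<noteq> 0 \<Longrightarrow> norm (f (\<tau> i) - f x) \<le> b" "0 \<le> b"
  shows "norm (sampling \<eta> \<tau> UNIV f x - f x) \<le> b"
proof -
  have "sampling \<eta> \<tau> UNIV (\<lambda>_. f x) x = complex_of_real (\<Sum>i | \<eta> i x \<noteq> 0. \<eta> i x) * f x"
    by (simp add: sampling_def sum_distrib_right)
  then have "sampling \<eta> \<tau> UNIV f x - f x = sampling \<eta> \<tau> UNIV (\<lambda>y. f y - f x) x"
    by (simp add: sampling_diff sum_eq_1)
  also have "norm \<dots> \<le> b" by (rule norm_sampling_le) (use b in auto)
  finally show ?thesis .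
qed

lemma linear_on_sampling_operator: "linear_on {f. continuous_on UNIV f} (sampling_operator \<eta> \<tau> J)"
  unfolding linear_on_def
proof (intro conjI ballI allI)
  fix f g :: "'m \<Rightarrow> complex" assume fg: "f \<in> {f. continuous_on UNIV f}" "g \<in> {f. continuous_on UNIV f}"
  then have "continuous_on UNIV (f + g)"
    unfolding plus_fun_def by (auto intro: continuous_intros)
  with fg show "sampling_operator \<eta> \<tau> J (f + g) = sampling_operator \<eta> \<tau> J f + sampling_operator \<eta> \<tau> J g"
    by (simp add: sampling_operator_def fun_eq_iff sampling_add)
next
  fix c and f :: "'m \<Rightarrow> complex" assume f: "f \<in> {f. continuous_on UNIV f}"
  then have "continuous_on UNIV (c *\<^sub>C f)"
    unfolding scaleC_fun_def scaleC_complex_def by (auto intro: continuous_intros)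
  with f show "sampling_operator \<eta> \<tau> J (c *\<^sub>C f) = c *\<^sub>C sampling_operator \<eta> \<tau> J f"
    by (simp add: sampling_operator_def fun_eq_iff scaleC_fun_def scaleC_complex_def sampling_scale)
qed

text \<open>On a compact \<open>T\<close> only finitely many indices are active, so the values on
  \<open>T\<close> depend on \<open>f\<close> at the finite, hence compact, set of their sample
  points. The bound \<open>e / 2\<close> restores strictness.\<close>

lemma continuous_map_sampling_operator:
  "continuous_map C_natural C_natural (sampling_operator \<eta> \<tau> J)"
proof (rule linear_continuous_mapI[OF lcs_C_natural lcs_C_natural])
  show "linear_on (topspace C_natural) (sampling_operator \<eta> \<tau> J)"
    unfolding topspace_C_natural by (rule linear_on_sampling_operator)
  show "sampling_operator \<eta> \<tau> J f \<in> topspace C_natural" for f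
    unfolding topspace_C_natural by (simp add: sampling_operator_def continuous_on_sampling zero_fun_def)
  fix U :: "('m \<Rightarrow> complex) set" assume "zero_nhd C_natural U"
  then obtain T e where T: "compact T" "e > 0" "uniform_nhd T e \<subseteq> U"
    unfolding zero_nhd_C_natural by auto
  let ?S = "\<tau> ` {i. \<exists>y\<in>T. \<eta> i y \<noteq> 0}"
  have "compact ?S" using finite_supp_compact[OF T(1)] by (intro finite_imp_compact) simp
  moreover have "uniform_nhd ?S (e / 2) \<subseteq> {f \<in> topspace C_natural. sampling_operator \<eta> \<tau> J f \<in> U}"
  proof
    fix f assume f: "f \<in> uniform_nhd ?S (e / 2)"
    then have fc: "continuous_on UNIV f" by (simp add: uniform_nhd_def)
    have "norm (sampling \<eta> \<tau> J f t) < e" if t: "t \<in> T" for t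
    proof -
      have "norm (sampling \<eta> \<tau> J f t) \<le> e / 2"
      proof (rule norm_sampling_le)
        fix i assume "\<eta> i t \<noteq> 0"
        then show "norm (f (\<tau> i)) \<le> e / 2" using f t by (force simp: uniform_nhd_def)
      qed (use T(2) in simp)
      then show ?thesis using T(2) by simp
    qed
    then have "sampling_operator \<eta> \<tau> J f \<in> uniform_nhd T e"
      using fc by (simp add: uniform_nhd_def sampling_operator_def continuous_on_sampling)
    then show "f \<in> {f \<in> topspace C_natural. sampling_operator \<eta> \<tau> J f \<in> U}"
      using T(3) fc by (auto simp: topspace_C_natural)
  qed
  ultimately show "zero_nhd C_natural {f \<in> topspace C_natural. sampling_operator \<eta> \<tau> J f \<in> U}"
    unfolding zero_nhd_C_natural using T(2)
    by (intro conjI exI[of _ ?S] exI[of _ "e / 2"]) (auto simp: topspace_C_natural)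
qed

text \<open>The direct estimate is for \<open>C_natural\<close>; functoriality of the
  pseudosaturation transfers continuity to \<open>C_space\<close>.\<close>

lemma sampling_operator_in_continuous_operators:
  "sampling_operator \<eta> \<tau> J \<in> continuous_operators C_space C_space"
  unfolding continuous_operators_def C_space_def
proof (intro CollectI conjI allI impI)
  note lin = linear_on_sampling_operator[of \<tau> J, folded topspace_C_natural]
  show "linear_on (topspace (pseudosaturation C_natural)) (sampling_operator \<eta> \<tau> J)"
    unfolding topspace_pseudosaturation[OF lcs_C_natural] by (rule lin)
  show "continuous_map (pseudosaturation C_natural) (pseudosaturation C_natural) (sampling_operator \<eta> \<tau> J)"
    by (rule continuous_map_pseudosaturation[OF lcs_C_natural lcs_C_natural lin continuous_map_sampling_operator])
  show "sampling_operator \<eta> \<tau> J f = 0" if "f \<notin> topspace (pseudosaturation C_natural)" for f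
    using that by (simp add: topspace_pseudosaturation[OF lcs_C_natural] topspace_C_natural sampling_operator_def)
qed

lemma sampling_operator_finite_rank:
  assumes J: "finite J"
  shows "sampling_operator \<eta> \<tau> J \<in> finite_rank_operators C_space C_space"
  unfolding finite_rank_operators_def
proof (intro CollectI conjI exI)
  let ?B = "(\<lambda>i x. complex_of_real (\<eta> i x)) ` J"
  show "finite ?B" using J by simp
  show "sampling_operator \<eta> \<tau> J ` topspace C_space \<subseteq> complex_vector.span ?B"
  proof
    fix g assume "g \<in> sampling_operator \<eta> \<tau> J ` topspace C_space"
    then obtain f where g: "g = sampling_operator \<eta> \<tau> J f" by auto
    have "sampling \<eta> \<tau> J f = (\<Sum>i\<in>J. f (\<tau> i) *\<^sub>C (\<lambda>x. complex_of_real (\<eta> i x)))"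
    proof
      fix x
      have "sampling \<eta> \<tau> J f x = (\<Sum>i\<in>J. complex_of_real (\<eta> i x) * f (\<tau> i))"
        unfolding sampling_def by (rule sum.mono_neutral_left) (use J in auto)
      also have "\<dots> = (\<Sum>i\<in>J. f (\<tau> i) *\<^sub>C (\<lambda>x. complex_of_real (\<eta> i x))) x"
      proof -
        have "(\<Sum>i\<in>J'. F i) x = (\<Sum>i\<in>J'. F i x)" for J' and F :: "'i \<Rightarrow> 'm \<Rightarrow> complex"
          by (induction J' rule: infinite_finite_induct) simp_all
        then show ?thesis by (simp add: scaleC_fun_def scaleC_complex_def mult.commute)
      qed
      finally show "sampling \<eta> \<tau> J f x = (\<Sum>i\<in>J. f (\<tau> i) *\<^sub>C (\<lambda>x. complex_of_real (\<eta> i x))) x" .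
    qed
    also have "\<dots> \<in> complex_vector.span ?B"
      by (intro complex_vector.span_sum complex_vector.span_scale complex_vector.span_base imageI)
    finally show "g \<in> complex_vector.span ?B"
      by (simp add: g sampling_operator_def complex_vector.span_zero)
  qed
qed (rule sampling_operator_in_continuous_operators)

text \<open>On \<open>T\<close> the operator for \<open>J\<close> agrees with the one for
  \<open>J \<inter> F\<close>, where \<open>F\<close> is the finite set of indices active somewhere
  on \<open>T\<close>. The subsets of \<open>F\<close> thus give the finite approximating family,
  and \<open>F\<close> itself approximates the full sum.\<close>

lemma sampling_operator_in_closure:
  "sampling_operator \<eta> \<tau> UNIV \<in> L_space C_space closure_of finite_rank_operators C_space C_space"
proof -
  let ?S = "sampling_operator \<eta> \<tau> ` {J. finite J}"
  let ?Y = "pseudosaturation C_natural :: ('m \<Rightarrow> complex) topology"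
  have local: "\<exists>F. finite F \<and> (\<forall>J. \<forall>f\<in>K. sampling_operator \<eta> \<tau> J f - sampling_operator \<eta> \<tau> (J \<inter> F) f \<in> V)"
    if K: "compactin ?Y K" and V: "zero_nhd C_natural V" for K V
  proof -
    have Kc: "continuous_on UNIV f" if "f \<in> K" for f
      using that compactin_subset_topspace[OF K]
      by (auto simp: topspace_pseudosaturation[OF lcs_C_natural] topspace_C_natural)
    obtain T e where T: "compact T" "e > 0" "uniform_nhd T e \<subseteq> V"
      using V unfolding zero_nhd_C_natural by auto
    let ?F = "{i. \<exists>y\<in>T. \<eta> i y \<noteq> 0}"
    have "sampling_operator \<eta> \<tau> J f - sampling_operator \<eta> \<tau> (J \<inter> ?F) f \<in> V" if f: "f \<in> K" for f J
    proof (rule subsetD[OF T(3)])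
      have "continuous_on UNIV (sampling \<eta> \<tau> J f - sampling \<eta> \<tau> (J \<inter> ?F) f)"
        unfolding fun_diff_def by (intro continuous_intros continuous_on_sampling)
      moreover have "sampling \<eta> \<tau> J f t = sampling \<eta> \<tau> (J \<inter> ?F) f t" if "t \<in> T" for t
        by (rule sampling_cong) (use that in auto)
      ultimately show "sampling_operator \<eta> \<tau> J f - sampling_operator \<eta> \<tau> (J \<inter> ?F) f \<in> uniform_nhd T e"
        using Kc[OF f] T(2) by (simp add: uniform_nhd_def sampling_operator_def)
    qed
    then show ?thesis using finite_supp_compact[OF T(1)] by blast
  qed
  have "sampling_operator \<eta> \<tau> UNIV \<in> L_space ?Y closure_of ?S"
  proof (rule in_closure_L_space[OF lcs_C_natural])
    note S = sampling_operator_in_continuous_operators[unfolded C_space_def]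
    show "sampling_operator \<eta> \<tau> UNIV \<in> continuous_operators ?Y ?Y" by (rule S)
    show SC: "?S \<subseteq> continuous_operators ?Y ?Y" using S by auto
    fix K :: "('m \<Rightarrow> complex) set" and V :: "('m \<Rightarrow> complex) set"
    assume KV: "compactin ?Y K" "zero_nhd C_natural V"
    obtain F where F: "finite F"
        "\<And>J f. f \<in> K \<Longrightarrow> sampling_operator \<eta> \<tau> J f - sampling_operator \<eta> \<tau> (J \<inter> F) f \<in> V"
      using local[OF KV] by auto
    show "\<exists>Q'. finite Q' \<and> Q' \<subseteq> continuous_operators ?Y ?Y \<and> (\<forall>s\<in>?S. \<exists>q\<in>Q'. \<forall>f\<in>K. s f - q f \<in> V)"
    proof (intro exI conjI ballI)
      show "finite (sampling_operator \<eta> \<tau> ` Pow F)" using F(1) by simp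
      show "sampling_operator \<eta> \<tau> ` Pow F \<subseteq> continuous_operators ?Y ?Y" using S by auto
      fix s assume "s \<in> ?S"
      then obtain J where "s = sampling_operator \<eta> \<tau> J" by auto
      then show "\<exists>q\<in>sampling_operator \<eta> \<tau> ` Pow F. \<forall>f\<in>K. s f - q f \<in> V"
        using F(2) by (intro bexI[of _ "sampling_operator \<eta> \<tau> (J \<inter> F)"]) auto
    qed
    \<comment> \<open>\<open>local\<close> subtracts the partial sum from the full one, while the
      closure criterion has the opposite sign; a symmetric \<open>V'\<close> makes up for
      this.\<close>
    obtain V' where V': "zero_nhd C_natural V'" "absconvex V'" "V' \<subseteq> V"
      using zero_nhd_absconvex[OF lcs_C_natural KV(2)] by blast
    obtain F' where F': "finite F'"
        "\<And>J f. f \<in> K \<Longrightarrow> sampling_operator \<eta> \<tau> J f - sampling_operator \<eta> \<tau> (J \<inter> F') f \<in> V'"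
      using local[OF KV(1) V'(1)] by auto
    have "sampling_operator \<eta> \<tau> F' f - sampling_operator \<eta> \<tau> UNIV f \<in> V" if "f \<in> K" for f
      using absconvex_uminus[OF V'(2) F'(2)[OF that, of UNIV]] V'(3) by auto
    then show "\<exists>s\<in>?S. \<forall>f\<in>K. s f - sampling_operator \<eta> \<tau> UNIV f \<in> V"
      using F'(1) by (intro bexI[of _ "sampling_operator \<eta> \<tau> F'"]) auto
  qed
  moreover have "?S \<subseteq> finite_rank_operators ?Y ?Y"
    using sampling_operator_finite_rank[unfolded C_space_def] by auto
  ultimately show ?thesis
    unfolding C_space_def using closure_of_mono by blast
qed

end

section \<open>Convergence of the sampling operators to the identity\<close>

lemma compact_Un_shrinking_finite:
  fixes T :: "'m::metric_space set"
  assumes T: "compact T" and S: "\<And>n. finite (S n)"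
    and near: "\<And>n s. s \<in> S n \<Longrightarrow> \<exists>t\<in>T. dist s t < 1 / real (Suc n)"
  shows "compact (T \<union> (\<Union>n. S n))"
proof (rule compactI)
  fix \<C> :: "'m set set" assume \<C>: "\<forall>U\<in>\<C>. open U" "T \<union> (\<Union>n. S n) \<subseteq> \<Union>\<C>"
  obtain \<D> where \<D>: "\<D> \<subseteq> \<C>" "finite \<D>" "T \<subseteq> \<Union>\<D>"
    using compactE[OF T, of \<C>] \<C> by (metis Un_subset_iff)
  \<comment> \<open>A whole \<open>d\<close>-neighbourhood of \<open>T\<close> is already covered by
    \<open>\<D>\<close>, hence so is every \<open>S n\<close> with
    \<open>1 / real (Suc n) < d\<close>. The earlier sets contribute finitely many points.\<close>
  obtain d where d: "d > 0" "(\<Union>t\<in>T. ball t d) \<subseteq> \<Union>\<D>"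
    using compact_subset_open_imp_ball_epsilon_subset[OF T open_Union \<D>(3)] \<C>(1) \<D>(1) by blast
  obtain N where N: "1 / real (Suc N) < d"
    using nat_approx_posE[OF d(1)] by blast
  have tail: "S n \<subseteq> \<Union>\<D>" if "n \<ge> N" for n
  proof
    fix s assume "s \<in> S n"
    then obtain t where t: "t \<in> T" "dist s t < 1 / real (Suc n)" using near by blast
    have "1 / real (Suc n) \<le> 1 / real (Suc N)" using that by (intro divide_left_mono) auto
    then have "dist t s < d" using t(2) N by (simp add: dist_commute)
    then have "s \<in> (\<Union>t\<in>T. ball t d)" using t(1) by auto
    then show "s \<in> \<Union>\<D>" using d(2) by (rule rev_subsetD)
  qed
  have "finite (\<Union>n<N. S n)" using S by simp
  moreover have "(\<Union>n<N. S n) \<subseteq> \<Union>\<C>" using \<C>(2) by blast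
  ultimately obtain \<E> where \<E>: "\<E> \<subseteq> \<C>" "finite \<E>" "(\<Union>n<N. S n) \<subseteq> \<Union>\<E>"
    using finite_subset_Union by metis
  have "S n \<subseteq> \<Union>(\<D> \<union> \<E>)" for n
    using tail[of n] \<E>(3) by (cases "n < N") auto
  then show "\<exists>\<C>'\<subseteq>\<C>. finite \<C>' \<and> T \<union> (\<Union>n. S n) \<subseteq> \<Union>\<C>'"
    using \<D> \<E> by (intro exI[of _ "\<D> \<union> \<E>"]) auto
qed

text \<open>The sample points that matter for a compact set, for all meshes together, form with it a
  compact set, on which the functions of a totally bounded set are equicontinuous.\<close>

lemma sampling_uniform_convergence:
  fixes \<eta> :: "nat \<Rightarrow> 'i \<Rightarrow> 'm::metric_space \<Rightarrow> real"
  assumes \<eta>: "\<And>n. partition_of_unity (\<eta> n)"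
    and near: "\<And>n i x. \<eta> n i x \<noteq> 0 \<Longrightarrow> dist x (\<tau> n i) < 1 / real (Suc n)"
    and K: "totally_bounded_in C_natural K" and T: "compact T" and e: "e > 0"
  shows "\<exists>N. \<forall>n\<ge>N. \<forall>f\<in>K. \<forall>t\<in>T. norm (sampling (\<eta> n) (\<tau> n) UNIV f t - f t) < e"
proof -
  define S where "S n = \<tau> n ` {i. \<exists>y\<in>T. \<eta> n i y \<noteq> 0}" for n
  have "compact (T \<union> (\<Union>n. S n))"
  proof (rule compact_Un_shrinking_finite[OF T])
    show "finite (S n)" for n
      unfolding S_def by (intro finite_imageI partition_of_unity.finite_supp_compact[OF \<eta> T])
    show "\<exists>t\<in>T. dist s t < 1 / real (Suc n)" if "s \<in> S n" for n s
      using that near by (auto simp: S_def dist_commute)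
  qed
  moreover define T' where "T' = T \<union> (\<Union>n. S n)"
  ultimately have T': "compact T'" by simp
  have sample: "\<tau> n i \<in> T'" if "t \<in> T" "\<eta> n i t \<noteq> 0" for n i t
    using that by (auto simp: T'_def S_def)
  have pointwise: "\<exists>N. \<forall>n\<ge>N. \<forall>t\<in>T. norm (sampling (\<eta> n) (\<tau> n) UNIV g t - g t) \<le> e / 4"
    if g: "continuous_on UNIV g" for g
  proof -
    have "uniformly_continuous_on T' g"
      using g T' by (intro compact_uniformly_continuous) (auto intro: continuous_on_subset)
    then obtain d where d: "d > 0" "\<forall>x\<in>T'. \<forall>y\<in>T'. dist y x < d \<longrightarrow> dist (g y) (g x) < e / 4"
      using e unfolding uniformly_continuous_on_def by (metis zero_less_divide_iff zero_less_numeral)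
    obtain N where N: "1 / real (Suc N) < d"
      using nat_approx_posE[OF d(1)] by blast
    have "norm (sampling (\<eta> n) (\<tau> n) UNIV g t - g t) \<le> e / 4" if n: "n \<ge> N" and t: "t \<in> T" for n t
    proof (rule partition_of_unity.norm_sampling_diff_le[OF \<eta>])
      fix i assume i: "\<eta> n i t \<noteq> 0"
      have "1 / real (Suc n) \<le> 1 / real (Suc N)" using n by (intro divide_left_mono) auto
      then have "dist (\<tau> n i) t < d" using near[OF i] N by (simp add: dist_commute)
      then have "dist (g (\<tau> n i)) (g t) < e / 4"
        using d(2) sample[OF t i] t by (simp add: T'_def)
      then show "norm (g (\<tau> n i) - g t) \<le> e / 4" by (simp add: dist_norm)
    qed (use e in simp)
    then show ?thesis by blast
  qed
  \<comment> \<open>Closeness on \<open>T'\<close> rather than on \<open>T\<close> also controls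
    \<open>f - g\<close> at the sample points read by the operators. The final error consists of
    three terms of at most \<open>e / 4\<close> each, which leaves a strict bound.\<close>
  have "zero_nhd C_natural (uniform_nhd T' (e / 4) :: ('m \<Rightarrow> complex) set)"
    unfolding zero_nhd_C_natural using T' e
    by (intro conjI exI[of _ T'] exI[of _ "e / 4"]) (auto simp: uniform_nhd_def)
  from totally_bounded_inD[OF lcs_C_natural K this]
  obtain F where F: "finite F" "F \<subseteq> K" "\<forall>f\<in>K. \<exists>g\<in>F. f - g \<in> uniform_nhd T' (e / 4)"
    by (elim exE conjE)
  have "\<forall>g\<in>F. continuous_on UNIV g"
    using F(2) totally_bounded_in_topspace[OF K] by (auto simp: topspace_C_natural)
  then have "\<forall>g\<in>F. \<exists>N. \<forall>n\<ge>N. \<forall>t\<in>T. norm (sampling (\<eta> n) (\<tau> n) UNIV g t - g t) \<le> e / 4"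
    using pointwise by blast
  then obtain N where N: "\<forall>g\<in>F. \<forall>n\<ge>N g. \<forall>t\<in>T. norm (sampling (\<eta> n) (\<tau> n) UNIV g t - g t) \<le> e / 4"
    by metis
  \<comment> \<open>The inserted 0 keeps the maximum well defined when \<open>F\<close> is
    empty.\<close>
  have "norm (sampling (\<eta> n) (\<tau> n) UNIV f t - f t) < e"
    if n: "n \<ge> Max (insert 0 (N ` F))" and f: "f \<in> K" and t: "t \<in> T" for n f t
  proof -
    obtain g where g: "g \<in> F" "f - g \<in> uniform_nhd T' (e / 4)" using F(3) f by blast
    have small: "norm (f s - g s) < e / 4" if "s \<in> T'" for s
      using g(2) that by (simp add: uniform_nhd_def)
    have "N g \<le> n" using n g(1) F(1) by simp
    then have 1: "norm (sampling (\<eta> n) (\<tau> n) UNIV g t - g t) \<le> e / 4" using N g(1) t by blast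
    have "norm (sampling (\<eta> n) (\<tau> n) UNIV (\<lambda>x. f x - g x) t) \<le> e / 4"
      by (rule partition_of_unity.norm_sampling_le[OF \<eta>])
        (use small[OF sample[OF t]] e in \<open>auto intro: less_imp_le\<close>)
    then have 2: "norm (sampling (\<eta> n) (\<tau> n) UNIV f t - sampling (\<eta> n) (\<tau> n) UNIV g t) \<le> e / 4"
      by (simp add: partition_of_unity.sampling_diff[OF \<eta>])
    have 3: "norm (f t - g t) < e / 4" using t by (intro small) (simp add: T'_def)
    have "sampling (\<eta> n) (\<tau> n) UNIV f t - f t =
        (sampling (\<eta> n) (\<tau> n) UNIV f t - sampling (\<eta> n) (\<tau> n) UNIV g t) +
        (sampling (\<eta> n) (\<tau> n) UNIV g t - g t) - (f t - g t)" by simp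
    also have "norm \<dots> \<le> norm (sampling (\<eta> n) (\<tau> n) UNIV f t - sampling (\<eta> n) (\<tau> n) UNIV g t) +
        norm (sampling (\<eta> n) (\<tau> n) UNIV g t - g t) + norm (f t - g t)"
      by (intro norm_triangle_ineq4[THEN order_trans] add_mono norm_triangle_ineq order_refl)
    finally show ?thesis using 1 2 3 e by simp
  qed
  then show ?thesis by blast
qed

text \<open>A convergent sequence is totally bounded: from \<open>N\<close> on the limit
  \<open>?I\<close> itself is a good enough centre, and the finitely many earlier operators are
  their own centres. The sampling estimate applies because compact sets of the pseudosaturation are
  totally bounded in \<open>C_natural\<close>.\<close>

lemma identity_operator_in_closure:
  fixes \<eta> :: "nat \<Rightarrow> 'i \<Rightarrow> 'm::metric_space \<Rightarrow> real"
  assumes \<eta>: "\<And>n. partition_of_unity (\<eta> n)"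
    and near: "\<And>n i x. \<eta> n i x \<noteq> 0 \<Longrightarrow> dist x (\<tau> n i) < 1 / real (Suc n)"
  shows "identity_operator C_space \<in> L_space C_space closure_of
    range (\<lambda>n. sampling_operator (\<eta> n) (\<tau> n) UNIV)"
  unfolding C_space_def
proof (rule in_closure_L_space[OF lcs_C_natural])
  let ?Y = "pseudosaturation C_natural :: ('m \<Rightarrow> complex) topology"
  let ?P = "\<lambda>n. sampling_operator (\<eta> n) (\<tau> n) UNIV"
  let ?I = "identity_operator ?Y"
  note topY = topspace_pseudosaturation[OF lcs_C_natural]
  note S = partition_of_unity.sampling_operator_in_continuous_operators[OF \<eta>, unfolded C_space_def]
  have V: "complex_vector.subspace (topspace ?Y)"
    by (rule lcs_subspace[OF lcs_pseudosaturation[OF lcs_C_natural]])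
  have "continuous_map ?Y ?Y ?I"
    by (rule continuous_map_eq[OF continuous_map_id]) (simp add: identity_operator_def)
  moreover have "linear_on (topspace ?Y) ?I"
    using complex_vector.subspace_add[OF V] complex_vector.subspace_scale[OF V]
    by (simp add: linear_on_def identity_operator_def)
  ultimately show I: "?I \<in> continuous_operators ?Y ?Y"
    by (simp add: continuous_operators_def identity_operator_def)
  show "range ?P \<subseteq> continuous_operators ?Y ?Y" using S by auto
  have conv: "\<exists>N. \<forall>n\<ge>N. \<forall>f\<in>K. ?P n f - ?I f \<in> V" if K: "compactin ?Y K" and V: "zero_nhd C_natural V" for K V
  proof -
    have Kc: "continuous_on UNIV f" if "f \<in> K" for f
      using that compactin_subset_topspace[OF K] by (auto simp: topY topspace_C_natural)
    obtain T e where T: "compact T" "e > 0" "uniform_nhd T e \<subseteq> V"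
      using V unfolding zero_nhd_C_natural by auto
    have "totally_bounded_in C_natural K"
      by (rule totally_bounded_in_coarser[OF finer_pseudosaturation[OF lcs_C_natural]
            totally_bounded_in_compactin[OF lcs_pseudosaturation[OF lcs_C_natural] K]])
    from sampling_uniform_convergence[where \<eta> = \<eta> and \<tau> = \<tau>, OF \<eta> near this T(1,2)]
    obtain N where N: "\<forall>n\<ge>N. \<forall>f\<in>K. \<forall>t\<in>T. norm (sampling (\<eta> n) (\<tau> n) UNIV f t - f t) < e" by auto
    have "?P n f - ?I f \<in> V" if n: "n \<ge> N" and f: "f \<in> K" for n f
    proof (rule subsetD[OF T(3)])
      have "?P n f - ?I f = (\<lambda>t. sampling (\<eta> n) (\<tau> n) UNIV f t - f t)"
        using Kc[OF f] by (auto simp: sampling_operator_def identity_operator_def topY topspace_C_natural)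
      moreover have "continuous_on UNIV (\<lambda>t. sampling (\<eta> n) (\<tau> n) UNIV f t - f t)"
        by (intro continuous_intros partition_of_unity.continuous_on_sampling[OF \<eta>] Kc[OF f])
      ultimately show "?P n f - ?I f \<in> uniform_nhd T e"
        using N n f by (simp add: uniform_nhd_def)
    qed
    then show ?thesis by blast
  qed
  fix K :: "('m \<Rightarrow> complex) set" and V :: "('m \<Rightarrow> complex) set"
    assume KV: "compactin ?Y K" "zero_nhd C_natural V"
  obtain N where N: "\<forall>n\<ge>N. \<forall>f\<in>K. ?P n f - ?I f \<in> V" using conv[OF KV] by auto
  show "\<exists>s\<in>range ?P. \<forall>f\<in>K. s f - ?I f \<in> V" using N by auto
  have "0 \<in> V" by (rule zero_nhd_mem[OF KV(2)])
  show "\<exists>Q'. finite Q' \<and> Q' \<subseteq> continuous_operators ?Y ?Y \<and> (\<forall>s\<in>range ?P. \<exists>q\<in>Q'. \<forall>f\<in>K. s f - q f \<in> V)"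
  proof (intro exI conjI ballI)
    show "finite (insert ?I (?P ` {..<N}))" by simp
    show "insert ?I (?P ` {..<N}) \<subseteq> continuous_operators ?Y ?Y" using S I by auto
    fix s assume "s \<in> range ?P"
    then obtain n where n: "s = ?P n" by auto
    show "\<exists>q\<in>insert ?I (?P ` {..<N}). \<forall>f\<in>K. s f - q f \<in> V"
    proof (cases "n < N")
      case True
      then show ?thesis using \<open>0 \<in> V\<close> by (intro bexI[of _ "?P n"]) (simp_all add: n)
    next
      case False
      then show ?thesis using N by (intro bexI[of _ ?I]) (simp_all add: n)
    qed
  qed
qed

theorem theorem1:
  shows "stereotype_approximation_property (C_space :: ('m::complete_space \<Rightarrow> complex) topology)"
proof -
  \<comment> \<open>The mesh \<open>1 / real (Suc n)\<close> is positive for every natural number,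
    including 0.\<close>
  have "\<exists>(\<eta> :: 'm set \<Rightarrow> 'm \<Rightarrow> real) \<tau>. partition_of_unity \<eta> \<and>
      (\<forall>i x. \<eta> i x \<noteq> 0 \<longrightarrow> dist x (\<tau> i) < 1 / real (Suc n))" for n
    by (rule fine_partition_of_unity) simp
  then obtain \<eta> :: "nat \<Rightarrow> 'm set \<Rightarrow> 'm \<Rightarrow> real" and \<tau> where
      \<eta>: "\<And>n. partition_of_unity (\<eta> n)"
      "\<And>n i x. \<eta> n i x \<noteq> 0 \<Longrightarrow> dist x (\<tau> n i) < 1 / real (Suc n)"
    by metis
  let ?L = "L_space C_space :: (('m \<Rightarrow> complex) \<Rightarrow> 'm \<Rightarrow> complex) topology"
  let ?F = "finite_rank_operators C_space C_space :: (('m \<Rightarrow> complex) \<Rightarrow> 'm \<Rightarrow> complex) set"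
  have "range (\<lambda>n. sampling_operator (\<eta> n) (\<tau> n) UNIV) \<subseteq> ?L closure_of ?F"
    using partition_of_unity.sampling_operator_in_closure[OF \<eta>(1)] by auto
  then have "?L closure_of range (\<lambda>n. sampling_operator (\<eta> n) (\<tau> n) UNIV) \<subseteq> ?L closure_of ?F"
    by (rule closure_of_minimal) (rule closedin_closure_of)
  then show ?thesis
    using identity_operator_in_closure[where \<eta> = \<eta> and \<tau> = \<tau>, OF \<eta>] unfolding stereotype_approximation_property_def by auto
qed

end
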